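(* Let $G$ be a nonelementary word hyperbolic group with finite symmetric generating set $A$. Then $M_R(\mathcal{H}_0)$ is nonempty and there are only finitely many ergodic measures in $M_R(\mathcal{H}_0)$.
   Context: $\Gamma$ is the Cayley graph of $(G,A)$, a path metric space in which every edge is isometric to the unit interval, with metric $d$. A function $F:\Gamma\to\mathbb{R}$ is $\epsilon$-convex if for all geodesic segments $[x_0,x_1]\subset\Gamma$ and all $t\in[0,1]$, $F(x_t)\le tF(x_0)+(1-t)F(x_1)+\epsilon$, where $x_t$ is the point of $[x_0,x_1]$ with $d(x_0,x_t)=t\,d(x_0,x_1)$ replaced, equivalently up to reversing the segment's parametrization, by the convention that the weights match the position of $x_t$ (i.e. the point $x_t$ at distance $t\,d(x_0,x_1)$ from $x_1$). $F$ is distance-like if for every $x\in\Gamma$ and $\lambda\in\mathbb{R}$ with $F(x)\ge\lambda$, $F(x)=\lambda+d(x,F^{-1}(\lambda))$. A horofunction on $\Gamma$ is a distance-like function that is $\epsilon$-convex for some $\epsilon>0$. $\mathcal{H}$ is the set of functions $h:G\to\mathbb{Z}$ that are restrictions to $G$ of a horofunction on $\Gamma$ (which is then unique and is identified with $h$), with the topology of uniform convergence on finite subsets of $G$. $\mathcal{H}_0=\{h\in\mathcal{H}: h(e)=0\}$. $G$ acts on functions by $(gh)(f)=h(g^{-1}f)$. The equivalence relation $R$ on $\mathcal{H}_0$ is $R=\{(h,gh): g\in G,\ h\in\mathcal{H}_0,\ gh\in\mathcal{H}_0\}$. A partial transformation of $R$ is a Borel bijection $\phi:\mathrm{Dom}\,\phi\to\mathrm{Im}\,\phi$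 between Borel subsets of $\mathcal{H}_0$ whose graph is contained in $R$. $M_R(\mathcal{H}_0)$ is the set of Borel probability measures $\eta$ on $\mathcal{H}_0$ that are $R$-invariant: $\phi_*(\eta|_{\mathrm{Dom}\,\phi})=\eta|_{\mathrm{Im}\,\phi}$ for every partial transformation $\phi$. Such $\eta$ is ergodic if for every Borel $R$-saturated set $S\subset\mathcal{H}_0$ (a union of $R$-classes), $\eta(S)=0$ or $\eta(\mathcal{H}_0\setminus S)=0$. *)

theory Defs
  imports "HOL-Probability.Probability" "HOL-Algebra.Algebra"
begin

section \<open>The Cayley graph as a path metric space\<close>

definition fin_sym_generating_set :: "('a, 'b) monoid_scheme \<Rightarrow> 'a set \<Rightarrow> bool" where
  "fin_sym_generating_set G A \<longleftrightarrow>
     finite A \<and> A \<subseteq> carrier G \<and> (\<forall>a\<in>A. inv\<^bsub>G\<^esub> a \<in> A) \<and> generate G A = carrier G"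

text \<open>The Cayley graph is simplicial: the identity may belong to \<open>A\<close> but gives no loop, and an
  involution in \<open>A\<close> gives a single edge.  The group acts on it by left multiplication.\<close>

definition cayley_adj :: "('a, 'b) monoid_scheme \<Rightarrow> 'a set \<Rightarrow> 'a \<Rightarrow> 'a \<Rightarrow> bool" where
  "cayley_adj G A u v \<longleftrightarrow>
     u \<in> carrier G \<and> v \<in> carrier G \<and> u \<noteq> v \<and> inv\<^bsub>G\<^esub> u \<otimes>\<^bsub>G\<^esub> v \<in> A"

text \<open>Points of the geometric realization are given by their barycentric coordinates, that is, by
  functions from the vertices to the reals; \<open>edge_point u v t\<close> is the point at distance \<open>t\<close>
  from \<open>u\<close> on the edge from \<open>u\<close> to \<open>v\<close>.\<close>

definition vertex :: "'a \<Rightarrow> 'a \<Rightarrow> real" where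
  "vertex u = (\<lambda>g. of_bool (g = u))"

definition edge_point :: "'a \<Rightarrow> 'a \<Rightarrow> real \<Rightarrow> 'a \<Rightarrow> real" where
  "edge_point u v t = (\<lambda>g. (1 - t) * vertex u g + t * vertex v g)"

definition cayley_graph :: "('a, 'b) monoid_scheme \<Rightarrow> 'a set \<Rightarrow> ('a \<Rightarrow> real) set" where
  "cayley_graph G A =
     vertex ` carrier G \<union> {edge_point u v t | u v t. cayley_adj G A u v \<and> t \<in> {0..1}}"

text \<open>\<open>pl_path G A x y l\<close>: some piecewise linear path from \<open>x\<close> to \<open>y\<close> has length \<open>l\<close>, where
  each linear piece runs inside one closed edge and edges have length 1.\<close>

inductive pl_path ::
  "('a, 'b) monoid_scheme \<Rightarrow> 'a set \<Rightarrow> ('a \<Rightarrow> real) \<Rightarrow> ('a \<Rightarrow> real) \<Rightarrow> real \<Rightarrow> bool"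
  for G (structure) and A where
  const: "x \<in> cayley_graph G A \<Longrightarrow> pl_path G A x x 0"
| extend: "pl_path G A x (edge_point u v s) l \<Longrightarrow> cayley_adj G A u v \<Longrightarrow> s \<in> {0..1} \<Longrightarrow> t \<in> {0..1}
    \<Longrightarrow> pl_path G A x (edge_point u v t) (l + \<bar>s - t\<bar>)"

definition cayley_dist ::
  "('a, 'b) monoid_scheme \<Rightarrow> 'a set \<Rightarrow> ('a \<Rightarrow> real) \<Rightarrow> ('a \<Rightarrow> real) \<Rightarrow> real" where
  "cayley_dist G A x y = Inf {l. pl_path G A x y l}"

text \<open>A geodesic segment is parametrized by arc length on \<open>{0..L}\<close>; the values of \<open>c\<close> outside
  this interval are irrelevant.\<close>

definition geodesic ::
  "('a, 'b) monoid_scheme \<Rightarrow> 'a set \<Rightarrow> (real \<Rightarrow> 'a \<Rightarrow> real) \<Rightarrow> real \<Rightarrow> bool" where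
  "geodesic G A c L \<longleftrightarrow> 0 \<le> L \<and> c ` {0..L} \<subseteq> cayley_graph G A \<and>
     (\<forall>s\<in>{0..L}. \<forall>t\<in>{0..L}. cayley_dist G A (c s) (c t) = \<bar>s - t\<bar>)"

section \<open>Nonelementary word hyperbolic groups\<close>

text \<open>Every geodesic triangle is \<open>\<delta>\<close>-slim.  The condition is stated for the side \<open>p\<close>; the other
  sides are covered by cyclic permutation of \<open>p, q, r\<close>.\<close>

definition slim_triangles :: "('a, 'b) monoid_scheme \<Rightarrow> 'a set \<Rightarrow> real \<Rightarrow> bool" where
  "slim_triangles G A \<delta> \<longleftrightarrow>
     (\<forall>p q r K L M. geodesic G A p K \<and> geodesic G A q L \<and> geodesic G A r M \<and>
        p K = q 0 \<and> q L = r 0 \<and> r M = p 0 \<longrightarrow>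
        (\<forall>s\<in>{0..K}. (\<exists>t\<in>{0..L}. cayley_dist G A (p s) (q t) \<le> \<delta>) \<or>
                     (\<exists>t\<in>{0..M}. cayley_dist G A (p s) (r t) \<le> \<delta>)))"

text \<open>Hyperbolicity is a property of the group alone, so it refers to some finite generating set,
  not to the one for which horofunctions are considered.\<close>

definition word_hyperbolic :: "('a, 'b) monoid_scheme \<Rightarrow> bool" where
  "word_hyperbolic G \<longleftrightarrow> (\<exists>S \<delta>. fin_sym_generating_set G S \<and> slim_triangles G S \<delta>)"

text \<open>Elementary means virtually cyclic; finite groups are included.\<close>

definition nonelementary :: "('a, 'b) monoid_scheme \<Rightarrow> bool" where
  "nonelementary G \<longleftrightarrow> \<not> (\<exists>H. subgroup H G \<and> finite (rcosets\<^bsub>G\<^esub> H) \<and>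
                               (\<exists>c\<in>carrier G. H = generate G {c}))"

section \<open>Horofunctions\<close>

definition eps_convex ::
  "('a, 'b) monoid_scheme \<Rightarrow> 'a set \<Rightarrow> real \<Rightarrow> (('a \<Rightarrow> real) \<Rightarrow> real) \<Rightarrow> bool" where
  "eps_convex G A \<epsilon> F \<longleftrightarrow>
     (\<forall>c L. geodesic G A c L \<longrightarrow>
        (\<forall>t\<in>{0..1}. F (c ((1 - t) * L)) \<le> t * F (c 0) + (1 - t) * F (c L) + \<epsilon>))"

text \<open>The distance to the empty set being infinite, the defining equation entails that the level
  set is nonempty.\<close>

definition distance_like ::
  "('a, 'b) monoid_scheme \<Rightarrow> 'a set \<Rightarrow> (('a \<Rightarrow> real) \<Rightarrow> real) \<Rightarrow> bool" where
  "distance_like G A F \<longleftrightarrow>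
     (\<forall>x\<in>cayley_graph G A. \<forall>l. F x \<ge> l \<longrightarrow>
        {y \<in> cayley_graph G A. F y = l} \<noteq> {} \<and>
        F x = l + (INF y\<in>{y \<in> cayley_graph G A. F y = l}. cayley_dist G A x y))"

definition horofunction ::
  "('a, 'b) monoid_scheme \<Rightarrow> 'a set \<Rightarrow> (('a \<Rightarrow> real) \<Rightarrow> real) \<Rightarrow> bool" where
  "horofunction G A F \<longleftrightarrow> distance_like G A F \<and> (\<exists>\<epsilon>>0. eps_convex G A \<epsilon> F)"

definition horo :: "('a, 'b) monoid_scheme \<Rightarrow> 'a set \<Rightarrow> ('a \<Rightarrow> int) set" where
  "horo G A = {h \<in> extensional (carrier G).
     \<exists>F. horofunction G A F \<and> (\<forall>g\<in>carrier G. F (vertex g) = of_int (h g))}"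

text \<open>Uniform convergence on finite subsets of the group.\<close>

definition horo_topology :: "('a, 'b) monoid_scheme \<Rightarrow> 'a set \<Rightarrow> ('a \<Rightarrow> int) topology" where
  "horo_topology G A = topology_generated_by
     {{h' \<in> horo G A. \<forall>g\<in>K. of_int \<bar>h' g - h g\<bar> < \<epsilon>} | h K \<epsilon>.
        h \<in> horo G A \<and> finite K \<and> K \<subseteq> carrier G \<and> (0::real) < \<epsilon>}"

definition horo0 :: "('a, 'b) monoid_scheme \<Rightarrow> 'a set \<Rightarrow> ('a \<Rightarrow> int) set" where
  "horo0 G A = {h \<in> horo G A. h \<one>\<^bsub>G\<^esub> = 0}"

definition translate :: "('a, 'b) monoid_scheme \<Rightarrow> 'a \<Rightarrow> ('a \<Rightarrow> int) \<Rightarrow> 'a \<Rightarrow> int" where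
  "translate G g h = (\<lambda>f\<in>carrier G. h (inv\<^bsub>G\<^esub> g \<otimes>\<^bsub>G\<^esub> f))"

definition horo_rel ::
  "('a, 'b) monoid_scheme \<Rightarrow> 'a set \<Rightarrow> (('a \<Rightarrow> int) \<times> ('a \<Rightarrow> int)) set" where
  "horo_rel G A = {(h, translate G g h) | g h.
     g \<in> carrier G \<and> h \<in> horo0 G A \<and> translate G g h \<in> horo0 G A}"

section \<open>Invariant and ergodic measures\<close>

text \<open>The measurable space underlying \<open>horo0\<close>; only its space and sets matter.\<close>

definition horo0_borel :: "('a, 'b) monoid_scheme \<Rightarrow> 'a set \<Rightarrow> ('a \<Rightarrow> int) measure" where
  "horo0_borel G A =
     sigma (horo0 G A) {U. openin (subtopology (horo_topology G A) (horo0 G A)) U}"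

definition partial_transformation ::
  "('a, 'b) monoid_scheme \<Rightarrow> 'a set \<Rightarrow> ('a \<Rightarrow> int) set \<Rightarrow> ('a \<Rightarrow> int) set \<Rightarrow>
   (('a \<Rightarrow> int) \<Rightarrow> ('a \<Rightarrow> int)) \<Rightarrow> bool" where
  "partial_transformation G A D E \<phi> \<longleftrightarrow>
     D \<in> sets (horo0_borel G A) \<and> E \<in> sets (horo0_borel G A) \<and> bij_betw \<phi> D E \<and>
     \<phi> \<in> restrict_space (horo0_borel G A) D \<rightarrow>\<^sub>M restrict_space (horo0_borel G A) E \<and>
     (\<forall>h\<in>D. (h, \<phi> h) \<in> horo_rel G A)"

definition invariant_measures ::
  "('a, 'b) monoid_scheme \<Rightarrow> 'a set \<Rightarrow> ('a \<Rightarrow> int) measure set" where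
  "invariant_measures G A = {\<eta>. sets \<eta> = sets (horo0_borel G A) \<and> prob_space \<eta> \<and>
     (\<forall>D E \<phi>. partial_transformation G A D E \<phi> \<longrightarrow>
        distr (restrict_space \<eta> D) (restrict_space \<eta> E) \<phi> = restrict_space \<eta> E)}"

definition ergodic_measure ::
  "('a, 'b) monoid_scheme \<Rightarrow> 'a set \<Rightarrow> ('a \<Rightarrow> int) measure \<Rightarrow> bool" where
  "ergodic_measure G A \<eta> \<longleftrightarrow>
     (\<forall>S\<in>sets (horo0_borel G A). (\<exists>C\<subseteq>horo0 G A // horo_rel G A. S = \<Union>C) \<longrightarrow>
        emeasure \<eta> S = 0 \<or> emeasure \<eta> (horo0 G A - S) = 0)"

end

theory Submission
  imports Defs "HOL-Real_Asymp.Real_Asymp"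
begin

text \<open>
  The relation identifies a horofunction that vanishes at the identity with those of its translates that
  do so too; it amounts to moving the base point within the zero level.  Both halves of the theorem
  compare invariant measures with the uniform measures on the spheres of the group.

  \<^bold>\<open>Existence.\<close>  For \<open>x\<close> on the sphere of radius \<open>n\<close>, the function \<open>f \<mapsto> d(x, f) - n\<close> vanishes at the identity.
  Translation by \<open>g\<close> turns it into the function of \<open>g x\<close>, provided that \<open>g x\<close> has length \<open>n\<close> too.  So the
  uniform measure on the functions of one sphere is exactly invariant, and so is every limit of these
  measures as \<open>n\<close> grows (\<open>sphere_weight_translate\<close>, \<open>invariant_measure_exists\<close>).  The limit lives on
  horofunctions, since the conditions that characterise them (\<open>horo_iff\<close>) are local and hold for
  distance functions away from their source.

  \<^bold>\<open>Finiteness.\<close>  Let \<open>x\<close> have length \<open>n\<close>, and consider the horofunctions that descend from \<open>0\<close> at the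
  identity to \<open>-n\<close> at \<open>x\<close>.  Two facts about this deep set of \<open>x\<close> are needed.

  \<^item> Its elements show only boundedly many patterns on the ball of radius \<open>n\<close>.  By hyperbolicity all
    gradient rays from that ball pass near \<open>x\<close>, so the values near \<open>x\<close> determine the rest
    (\<open>determined_by_deep_values\<close>).

  \<^item> For infinitely many \<open>n\<close>, every invariant probability measure gives it mass at most a constant divided by
    the size of the sphere (\<open>deep_set_mass_uniform\<close>).  In general one can walk from \<open>x\<close> back to the zero level
    in about as many ways as the sphere has points, and invariance turns these ways into sets of
    the same measure that overlap boundedly.  Walking back can only fail if the group nearly fixes a point at
    infinity; then balls grow linearly, some spheres are small, and the bound is trivial.

  Distinct ergodic measures are mutually singular, so finitely many of them are nearly
  supported by disjoint sets that only depend on the values on some ball.  Each of these sets meets the deep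
  sets of a definite proportion of a large sphere, by the mass bound, while each deep set
  meets only boundedly many of them.  This bounds the number of measures (\<open>finite_ergodic\<close>).

  Hyperbolicity enters as the four-point condition for the word metric.  It is derived from slim
  triangles for some generating set and carried over to the given one by the stability of
  quasi-geodesics (\<open>four_point_transfer\<close>).
\<close>


lemma last_true_before_false:
  assumes "P 0" "\<not> P (n::nat)"
  shows "\<exists>i<n. P i \<and> \<not> P (Suc i)"
  using assms by (induction n) (auto intro: less_SucI)

section \<open>Integer-valued path metrics and the four-point condition\<close>

locale graph_metric =
  fixes V :: "'p set" and d :: "'p \<Rightarrow> 'p \<Rightarrow> int"
  assumes d_nonneg: "x \<in> V \<Longrightarrow> y \<in> V \<Longrightarrow> 0 \<le> d x y"
    and d_eq_0: "x \<in> V \<Longrightarrow> y \<in> V \<Longrightarrow> d x y = 0 \<longleftrightarrow> x = y"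
    and d_sym: "x \<in> V \<Longrightarrow> y \<in> V \<Longrightarrow> d x y = d y x"
    and d_tri: "x \<in> V \<Longrightarrow> y \<in> V \<Longrightarrow> z \<in> V \<Longrightarrow> d x z \<le> d x y + d y z"
    and d_interp: "x \<in> V \<Longrightarrow> y \<in> V \<Longrightarrow> 0 \<le> k \<Longrightarrow> k \<le> d x y
      \<Longrightarrow> \<exists>z\<in>V. d x z = k \<and> d z y = d x y - k"
begin

definition between :: "'p \<Rightarrow> 'p \<Rightarrow> 'p \<Rightarrow> bool" where
  "between x m y \<longleftrightarrow> m \<in> V \<and> d x m + d m y = d x y"

definition slim :: "int \<Rightarrow> bool" where
  "slim \<delta> \<longleftrightarrow> (\<forall>x\<in>V. \<forall>y\<in>V. \<forall>z\<in>V. \<forall>m. between x m y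
     \<longrightarrow> (\<exists>u. (between x u z \<or> between z u y) \<and> d m u \<le> \<delta>))"

definition four_point :: "int \<Rightarrow> bool" where
  "four_point D \<longleftrightarrow> (\<forall>x\<in>V. \<forall>y\<in>V. \<forall>z\<in>V. \<forall>w\<in>V.
     d x y + d z w \<le> max (d x z + d y w) (d x w + d y z) + D)"

definition disc_geodesic :: "(nat \<Rightarrow> 'p) \<Rightarrow> nat \<Rightarrow> bool" where
  "disc_geodesic c n \<longleftrightarrow> (\<forall>i\<le>n. c i \<in> V) \<and> (\<forall>i\<le>n. \<forall>j\<le>n. d (c i) (c j) = \<bar>int i - int j\<bar>)"

lemma d_self [simp]: "x \<in> V \<Longrightarrow> d x x = 0"
  using d_eq_0 by blast

lemma betweenD: "between x m y \<Longrightarrow> m \<in> V" "between x m y \<Longrightarrow> d x m + d m y = d x y"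
  by (auto simp: between_def)

lemma path_length:
  assumes "\<And>i. i \<le> n \<Longrightarrow> c i \<in> V" "\<And>i. i < n \<Longrightarrow> d (c i) (c (Suc i)) \<le> l"
    "i \<le> j" "j \<le> n"
  shows "d (c i) (c j) \<le> l * (int j - int i)"
  using assms(3,4)
proof (induction j)
  case 0
  then show ?case using assms(1) by simp
next
  case (Suc j)
  show ?case
  proof (cases "i = Suc j")
    case True
    then show ?thesis using assms(1) Suc.prems by simp
  next
    case False
    have "d (c i) (c (Suc j)) \<le> d (c i) (c j) + d (c j) (c (Suc j))"
      using assms(1) Suc.prems by (intro d_tri) auto
    also have "\<dots> \<le> l * (int j - int i) + l"
      using Suc False assms(2)[of j] by force
    finally show ?thesis by (simp add: algebra_simps)
  qed
qed

lemma disc_geodesicI: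
  assumes "\<And>i. i \<le> n \<Longrightarrow> c i \<in> V" "\<And>i. i < n \<Longrightarrow> d (c i) (c (Suc i)) \<le> 1"
    "d (c 0) (c n) = int n"
  shows "disc_geodesic c n"
proof -
  have *: "d (c i) (c j) = int j - int i" if "i \<le> j" "j \<le> n" for i j
  proof -
    have "d (c i) (c j) \<le> 1 * (int j - int i)" "d (c 0) (c i) \<le> 1 * (int i - int 0)"
      "d (c j) (c n) \<le> 1 * (int n - int j)"
      using path_length[of n c 1 i j] path_length[of n c 1 0 i] path_length[of n c 1 j n] assms(1,2) that
      by auto
    moreover have "d (c 0) (c n) \<le> d (c 0) (c i) + d (c i) (c n)"
      "d (c i) (c n) \<le> d (c i) (c j) + d (c j) (c n)"
      using assms(1) that by (auto intro!: d_tri)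
    ultimately show ?thesis using assms(3) by (intro antisym) simp_all
  qed
  have "d (c i) (c j) = \<bar>int i - int j\<bar>" if "i \<le> n" "j \<le> n" for i j
  proof (cases "i \<le> j")
    case True
    then show ?thesis using *[of i j] that by simp
  next
    case False
    then show ?thesis using *[of j i] d_sym[of "c i" "c j"] assms(1) that by simp
  qed
  then show ?thesis using assms(1) by (simp add: disc_geodesic_def)
qed

lemma disc_geodesic_ends:
  assumes "x \<in> V" "y \<in> V"
  shows "\<exists>c. c 0 = x \<and> c (nat (d x y)) = y \<and> disc_geodesic c (nat (d x y))"
proof -
  have "\<exists>c. c 0 = x \<and> c n = y \<and> disc_geodesic c n" if "y \<in> V" "d x y = int n" for n y
    using that
  proof (induction n arbitrary: y)
    case 0
    then have "x = y" using d_eq_0[OF \<open>x \<in> V\<close>] by simp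
    then show ?case using \<open>x \<in> V\<close> by (intro exI[of _ "\<lambda>_. x"]) (simp add: disc_geodesic_def)
  next
    case (Suc n)
    obtain z where z: "z \<in> V" "d x z = int n" "d z y = 1"
      using d_interp[OF \<open>x \<in> V\<close> Suc.prems(1), of "int n"] Suc.prems(2) by auto
    obtain c where c: "c 0 = x" "c n = z" "disc_geodesic c n"
      using Suc.IH[OF z(1,2)] by auto
    have "disc_geodesic (c(Suc n := y)) (Suc n)"
    proof (rule disc_geodesicI)
      show "(c(Suc n := y)) i \<in> V" if "i \<le> Suc n" for i
        using c(3) Suc.prems(1) that by (auto simp: disc_geodesic_def le_Suc_eq)
      show "d ((c(Suc n := y)) i) ((c(Suc n := y)) (Suc i)) \<le> 1" if "i < Suc n" for i
        using c z that by (cases "i = n") (auto simp: disc_geodesic_def)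
      show "d ((c(Suc n := y)) 0) ((c(Suc n := y)) (Suc n)) = int (Suc n)"
        using c Suc.prems by simp
    qed
    moreover have "(c(Suc n := y)) 0 = x" "(c(Suc n := y)) (Suc n) = y" using c by auto
    ultimately show ?case by blast
  qed
  from this[of y "nat (d x y)"] show ?thesis using assms d_nonneg by simp
qed

lemma disc_geodesic_through:
  assumes "x \<in> V" "y \<in> V" "between x m y"
  shows "\<exists>c. c 0 = x \<and> c (nat (d x m)) = m \<and> c (nat (d x y)) = y \<and> nat (d x m) \<le> nat (d x y)
    \<and> disc_geodesic c (nat (d x y))"
proof -
  have m: "m \<in> V" "d x m + d m y = d x y" using assms(3) by (auto simp: between_def)
  define k l where "k = nat (d x m)" and "l = nat (d m y)"
  have kl: "int k = d x m" "int l = d m y" "nat (d x y) = k + l"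
    using m assms d_nonneg unfolding k_def l_def by (auto simp: nat_add_distrib simp flip: m(2))
  obtain c1 where c1: "c1 0 = x" "c1 k = m" "disc_geodesic c1 k"
    using disc_geodesic_ends[OF assms(1) m(1)] k_def by auto
  obtain c2 where c2: "c2 0 = m" "c2 l = y" "disc_geodesic c2 l"
    using disc_geodesic_ends[OF m(1) assms(2)] l_def by auto
  define c where "c i = (if i \<le> k then c1 i else c2 (i - k))" for i
  have ends: "c 0 = x" "c k = m" "c (k + l) = y"
    using c1 c2 by (auto simp: c_def)
  have "disc_geodesic c (k + l)"
  proof (rule disc_geodesicI)
    show "c i \<in> V" if "i \<le> k + l" for i
      using c1(3) c2(3) that by (auto simp: c_def disc_geodesic_def)
    show "d (c i) (c (Suc i)) \<le> 1" if "i < k + l" for i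
    proof -
      consider "i < k" | "i = k" | "i > k" by linarith
      then show ?thesis
      proof cases
        case 1
        then show ?thesis using c1 by (simp add: c_def disc_geodesic_def)
      next
        case 2
        then have "d (c2 0) (c2 1) = 1" "c i = c2 0" "c (Suc i) = c2 1"
          using c1 c2 that by (auto simp: c_def disc_geodesic_def)
        then show ?thesis by simp
      next
        case 3
        then have "Suc i - k = Suc (i - k)" by simp
        then show ?thesis using 3 c2 that by (simp add: c_def disc_geodesic_def)
      qed
    qed
    show "d (c 0) (c (k + l)) = int (k + l)" using ends kl m by simp
  qed
  then show ?thesis using ends kl k_def by (intro exI[of _ c]) simp
qed

lemma disc_geodesic_between:
  assumes "disc_geodesic c n" "i \<le> n"
  shows "between (c 0) (c i) (c n)"
  using assms by (auto simp: disc_geodesic_def between_def)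

lemma four_pointD:
  assumes "four_point D" "x \<in> V" "y \<in> V" "z \<in> V" "w \<in> V"
  shows "d x y + d z w \<le> d x z + d y w + D \<or> d x y + d z w \<le> d x w + d y z + D"
proof -
  have "d x y + d z w \<le> max (d x z + d y w) (d x w + d y z) + D"
    using assms unfolding four_point_def by blast
  then show ?thesis by linarith
qed

text \<open>Walking along a side of a slim triangle, one follows first one and then the other of the two remaining
  sides.  A point where this changes is close to both of them, and adding up the distances shows that
  its distance to the opposite vertex exceeds the Gromov product by at most a constant.\<close>

lemma slim_dist_le_product:
  assumes "slim \<delta>" "0 \<le> \<delta>" and V: "p \<in> V" "x \<in> V" "y \<in> V"
  shows "\<exists>w. between x w y \<and> 2 * d p w \<le> d p x + d p y - d x y + 4 * \<delta> + 2"
proof -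
  define n where "n = nat (d x y)"
  have n: "int n = d x y" using V d_nonneg by (simp add: n_def)
  obtain c where c: "c 0 = x" "c n = y" "disc_geodesic c n"
    using disc_geodesic_ends[OF V(2,3)] n_def by auto
  have cV: "c i \<in> V" if "i \<le> n" for i using c that by (simp add: disc_geodesic_def)
  define P where "P i \<longleftrightarrow> (\<exists>u. between x u p \<and> d (c i) u \<le> \<delta>)" for i
  show ?thesis
  proof (cases "P n")
    case True
    then obtain u where u: "u \<in> V" "d x u + d u p = d x p" "d y u \<le> \<delta>"
      using c by (auto simp: P_def between_def)
    have "d p y \<le> d p u + d u y" "d x y \<le> d x u + d u y" "d u y = d y u" "d x p = d p x"
      "d u p = d p u"
      using V u(1) by (auto intro: d_tri d_sym)
    then have "2 * d p y \<le> d p x + d p y - d x y + 2 * \<delta>"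
      using u by linarith
    moreover have "between x y y" using V by (simp add: between_def)
    ultimately show ?thesis using \<open>0 \<le> \<delta>\<close> by (intro exI[of _ y]) simp
  next
    case False
    have "P 0" using c V \<open>0 \<le> \<delta>\<close> by (auto simp: P_def between_def intro!: exI[of _ x])
    then obtain i where i: "i < n" "P i" "\<not> P (Suc i)"
      using False last_true_before_false[of P n] by blast
    have btw: "between x (c (Suc i)) y"
      using disc_geodesic_between[OF c(3), of "Suc i"] i(1) c by auto
    obtain u where u: "u \<in> V" "d x u + d u p = d x p" "d (c i) u \<le> \<delta>"
      using i(2) by (auto simp: P_def between_def)
    have "\<exists>v. (between x v p \<or> between p v y) \<and> d (c (Suc i)) v \<le> \<delta>"
      using \<open>slim \<delta>\<close> V btw unfolding slim_def by blast
    then obtain v where v: "v \<in> V" "d p v + d v y = d p y" "d (c (Suc i)) v \<le> \<delta>"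
      using i(3) by (auto simp: P_def between_def)
    have step: "d (c i) (c (Suc i)) = 1" using c(3) i(1) by (simp add: disc_geodesic_def)
    have ciV: "c i \<in> V" "c (Suc i) \<in> V" using cV i(1) by auto
    have b: "between x (c i) y" using disc_geodesic_between[OF c(3), of i] i(1) c by auto
    have "d p (c i) \<le> d p u + d u (c i)" "d x (c i) \<le> d x u + d u (c i)"
      "d p (c i) \<le> d p v + d v (c i)" "d (c i) y \<le> d (c i) v + d v y"
      "d (c i) v \<le> d (c i) (c (Suc i)) + d (c (Suc i)) v"
      "d u (c i) = d (c i) u" "d v (c i) = d (c i) v" "d x p = d p x" "d u p = d p u"
      using V u(1) v(1) ciV by (auto intro: d_tri d_sym)
    then have "2 * d p (c i) \<le> d p x + d p y - d x y + 4 * \<delta> + 2"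
      using u v step betweenD(2)[OF b] by linarith
    then show ?thesis using b by blast
  qed
qed

text \<open>The distance from \<open>p\<close> to a side measures the Gromov product at \<open>p\<close>.  The point of the side \<open>x z\<close> that
  realises it is close to \<open>x y\<close> or to \<open>y z\<close>, hence one of the other two products is not much larger.\<close>

lemma slim_imp_four_point:
  assumes "slim \<delta>" "0 \<le> \<delta>"
  shows "four_point (6 * \<delta> + 2)"
  unfolding four_point_def
proof (intro ballI)
  fix p y x z assume V: "p \<in> V" "y \<in> V" "x \<in> V" "z \<in> V"
  obtain w where w: "between x w z" "2 * d p w \<le> d p x + d p z - d x z + 4 * \<delta> + 2"
    using slim_dist_le_product[OF assms V(1,3,4)] by blast
  obtain u where u: "between x u y \<or> between y u z" "d w u \<le> \<delta>"
    using assms(1) V w(1) unfolding slim_def by blast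
  have uV: "u \<in> V" "w \<in> V" using u w by (auto simp: between_def)
  have "d p u \<le> d p w + d w u" "d p x \<le> d p u + d u x" "d p y \<le> d p u + d u y"
    "d p z \<le> d p u + d u z" "d u x = d x u" "d u y = d y u" "d y x = d x y"
    using V uV by (auto intro: d_tri d_sym)
  then show "d p y + d x z \<le> max (d p x + d y z) (d p z + d y x) + (6 * \<delta> + 2)"
    using u w unfolding between_def by linarith
qed

section \<open>Stability of quasi-geodesics\<close>

text \<open>Subdividing a path dyadically, each level of the subdivision costs one use of the
  four-point condition.  Hence a path that stays outside a ball needs exponentially many steps
  to get around it.\<close>

lemma product_along_path:
  assumes D: "four_point D" "0 \<le> D" and "0 \<le> l" and x: "x \<in> V"
    and c: "\<And>h. i \<le> h \<Longrightarrow> h \<le> j \<Longrightarrow> c h \<in> V"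
    and step: "\<And>h. i \<le> h \<Longrightarrow> h < j \<Longrightarrow> d (c h) (c (Suc h)) \<le> l"
    and far: "\<And>h. i \<le> h \<Longrightarrow> h \<le> j \<Longrightarrow> R \<le> d x (c h)"
    and "i \<le> j" "j - i \<le> 2 ^ k"
  shows "2 * R - l - int k * D \<le> d x (c i) + d x (c j) - d (c i) (c j)"
  using assms(5-)
proof (induction k arbitrary: i j)
  case 0
  have cij: "c i \<in> V" "c j \<in> V" "R \<le> d x (c i)" "R \<le> d x (c j)" using 0 by auto
  have "j = i \<or> j = Suc i" using 0 by auto
  then have "d (c i) (c j) \<le> l" using 0 \<open>0 \<le> l\<close> by auto
  then show ?case using cij by simp
next
  case (Suc k)
  define m where "m = (i + j) div 2"
  have m: "i \<le> m" "m \<le> j" "m - i \<le> 2 ^ k" "j - m \<le> 2 ^ k"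
    using Suc.prems(4,5) unfolding m_def by auto
  have 1: "2 * R - l - int k * D \<le> d x (c i) + d x (c m) - d (c i) (c m)"
    by (rule Suc.IH) (use Suc.prems m in auto)
  have 2: "2 * R - l - int k * D \<le> d x (c m) + d x (c j) - d (c m) (c j)"
    by (rule Suc.IH) (use Suc.prems m in auto)
  have V: "c i \<in> V" "c j \<in> V" "c m \<in> V" using Suc.prems m by auto
  have "d x (c m) + d (c i) (c j) \<le> d x (c i) + d (c m) (c j) + D
      \<or> d x (c m) + d (c i) (c j) \<le> d x (c j) + d (c m) (c i) + D"
    by (rule four_pointD[OF D(1)]) (use x V in auto)
  moreover have "d (c m) (c i) = d (c i) (c m)" using V by (auto intro: d_sym)
  ultimately have "2 * R - l - int k * D - D \<le> d x (c i) + d x (c j) - d (c i) (c j)"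
    using 1 2 by linarith
  then show ?case by (simp add: algebra_simps)
qed

end

text \<open>The bound on the distance \<open>M\<close> of a geodesic from a quasi-geodesic: avoiding the ball of radius \<open>M\<close> needs
  exponentially many steps, but only linearly many are available.\<close>

lemma exp_beats_linear:
  fixes l \<mu> D :: int
  assumes "0 \<le> l" "0 \<le> \<mu>" "0 \<le> D"
  shows "\<exists>B\<ge>0. \<forall>M\<ge>0. (\<forall>k. 6 * \<mu> * M \<le> 2 ^ k \<longrightarrow> 2 * M \<le> l + (int k + 2) * D) \<longrightarrow> M \<le> B"
proof -
  define l' \<mu>' D' where "l' = real_of_int l" and "\<mu>' = real_of_int \<mu> + 1" and "D' = real_of_int D"
  have pos: "0 \<le> l'" "0 < \<mu>'" "0 \<le> D'" using assms by (auto simp: l'_def \<mu>'_def D'_def)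
  have "eventually (\<lambda>x::real. l' + (log 2 (6 * \<mu>' * x + 1) + 3) * D' < 2 * x) at_top"
    using pos by real_asymp
  then obtain B where B: "\<And>x. x \<ge> B \<Longrightarrow> l' + (log 2 (6 * \<mu>' * x + 1) + 3) * D' < 2 * x"
    by (auto simp: eventually_at_top_linorder)
  have "M \<le> max 0 \<lceil>B\<rceil>" if M: "M \<ge> 0" "\<forall>k. 6 * \<mu> * M \<le> 2 ^ k \<longrightarrow> 2 * M \<le> l + (int k + 2) * D" for M
  proof (rule ccontr)
    assume "\<not> M \<le> max 0 \<lceil>B\<rceil>"
    then have MB: "real_of_int M \<ge> B" by linarith
    define y where "y = 6 * \<mu>' * real_of_int M + 1"
    have "0 \<le> 6 * \<mu>' * real_of_int M" using M(1) pos by simp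
    then have y1: "1 \<le> y" by (simp add: y_def)
    define k where "k = nat \<lceil>log 2 y\<rceil>"
    have "log 2 y \<ge> 0" using y1 by simp
    then have k: "log 2 y \<le> real k" "real k \<le> log 2 y + 1" unfolding k_def by linarith+
    have "y = 2 powr (log 2 y)" using y1 by simp
    also have "\<dots> \<le> 2 powr real k" using k by simp
    also have "\<dots> = 2 ^ k" by (simp add: powr_realpow)
    finally have yk: "y \<le> 2 ^ k" .
    have "real_of_int (6 * \<mu> * M) \<le> y" using M(1) by (simp add: y_def \<mu>'_def algebra_simps)
    then have "real_of_int (6 * \<mu> * M) \<le> real_of_int (2 ^ k)" using yk by simp
    then have "6 * \<mu> * M \<le> 2 ^ k" by (simp only: of_int_le_iff)
    then have "2 * M \<le> l + (int k + 2) * D" using M(2) by blast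
    then have "real_of_int (2 * M) \<le> real_of_int (l + (int k + 2) * D)" by (simp only: of_int_le_iff)
    then have "2 * real_of_int M \<le> l' + (real k + 2) * D'" by (simp add: l'_def D'_def)
    also have "\<dots> \<le> l' + (log 2 y + 3) * D'" using k pos by (intro add_left_mono mult_right_mono) auto
    finally show False using B[OF MB] by (simp add: y_def)
  qed
  then show ?thesis by (intro exI[of _ "max 0 \<lceil>B\<rceil>"]) auto
qed

context graph_metric
begin

definition quasi_geodesic :: "int \<Rightarrow> int \<Rightarrow> (nat \<Rightarrow> 'p) \<Rightarrow> nat \<Rightarrow> bool" where
  "quasi_geodesic l \<mu> c n \<longleftrightarrow> (\<forall>i\<le>n. c i \<in> V) \<and> (\<forall>i<n. d (c i) (c (Suc i)) \<le> l)
     \<and> (\<forall>i\<le>n. \<forall>j\<le>n. \<bar>int i - int j\<bar> \<le> \<mu> * d (c i) (c j))"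

text \<open>Take a point of the geodesic at maximal distance \<open>M\<close> from the quasi-geodesic.  The part of
  the quasi-geodesic that shadows the segment of radius \<open>2 * M\<close> around it has a number of
  steps linear in \<open>M\<close>, but passes around a ball of radius \<open>M\<close>.\<close>

lemma geodesic_near_quasi_geodesic:
  assumes D: "four_point D" "0 \<le> D" and "0 \<le> l" "0 \<le> \<mu>"
  shows "\<exists>B\<ge>0. \<forall>c n w. quasi_geodesic l \<mu> c n \<longrightarrow> between (c 0) w (c n)
    \<longrightarrow> (\<exists>i\<le>n. d w (c i) \<le> B)"
proof -
  obtain B where B: "B \<ge> 0"
    "\<And>M. M \<ge> 0 \<Longrightarrow> (\<forall>k. 6 * \<mu> * M \<le> 2 ^ k \<longrightarrow> 2 * M \<le> l + (int k + 2) * D) \<Longrightarrow> M \<le> B"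
    using exp_beats_linear[OF assms(3,4,2)] by blast
  have "\<exists>i\<le>n. d w (c i) \<le> B" if qg: "quasi_geodesic l \<mu> c n" and w0: "between (c 0) w (c n)" for c n w
  proof (rule ccontr)
    assume neg: "\<not> (\<exists>i\<le>n. d w (c i) \<le> B)"
    have cV: "\<And>i. i \<le> n \<Longrightarrow> c i \<in> V" using qg by (simp add: quasi_geodesic_def)
    define P where "P M \<longleftrightarrow> (\<exists>w. between (c 0) w (c n) \<and> (\<forall>i\<le>n. int M \<le> d w (c i)))" for M
    have PB: "P (nat B + 1)" unfolding P_def using w0 neg B(1) by force
    have bound: "M \<le> nat (d (c 0) (c n))" if PM: "P M" for M
    proof -
      obtain w where w: "between (c 0) w (c n)" "int M \<le> d w (c 0)"
        using PM le0[of n] unfolding P_def by blast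
      moreover have "d (c 0) w = d w (c 0)" "0 \<le> d w (c n)"
        using w betweenD cV d_sym d_nonneg by auto
      ultimately show ?thesis unfolding between_def by linarith
    qed
    define M where "M = (GREATEST M. P M)"
    have PM: "P M" unfolding M_def using GreatestI_nat[of P, OF PB] bound by blast
    have maxM: "\<And>M'. P M' \<Longrightarrow> M' \<le> M" unfolding M_def using Greatest_le_nat[of P] bound by blast
    have MB: "int M > B" using maxM[OF PB] by linarith
    have near: "\<exists>i\<le>n. d v (c i) \<le> int M" if "between (c 0) v (c n)" for v
    proof (rule ccontr)
      assume "\<not> ?thesis"
      then have "P (Suc M)" using that unfolding P_def by force
      then show False using maxM by fastforce
    qed
    obtain w where w: "between (c 0) w (c n)" "\<And>i. i \<le> n \<Longrightarrow> int M \<le> d w (c i)"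
      using PM by (auto simp: P_def)
    have wV: "w \<in> V" using w betweenD by auto
    \<comment> \<open>A point of the geodesic at distance at most \<open>2 * M\<close> on a given side of \<open>w\<close>, together with
      a nearby point of the quasi-geodesic; near the end both are the endpoint.\<close>
    have side: "\<exists>y\<in>V. \<exists>a\<le>n. d e y + d y w = d e w \<and> d w y \<le> 2 * int M \<and> d y (c a) \<le> int M
        \<and> 2 * int M \<le> d w y + d w (c a) - d y (c a)"
      if e: "e = c 0 \<or> e = c n" for e
    proof -
      obtain b where b: "b \<le> n" "e = c b" using e by blast
      have eV: "e \<in> V" using b cV by auto
      show ?thesis
      proof (cases "2 * int M \<le> d w e")
        case True
        obtain y where y: "y \<in> V" "d w y = 2 * int M" "d y e = d w e - 2 * int M"
          using d_interp[OF wV eV _ True] by auto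
        have "between (c 0) y (c n)"
        proof -
          have c0: "c 0 \<in> V" "c n \<in> V" using cV by auto
          have "d (c 0) y \<le> d (c 0) w + d w y" "d y (c n) \<le> d y w + d w (c n)"
            "d (c 0) (c n) \<le> d (c 0) y + d y (c n)" "d (c 0) w = d w (c 0)" "d y w = d w y"
            "d (c 0) y = d y (c 0)"
            using c0 wV y(1) by (auto intro: d_tri d_sym)
          then show ?thesis using e y w(1) unfolding between_def by force
        qed
        then obtain a where a: "a \<le> n" "d y (c a) \<le> int M" using near by blast
        have "d e y = d y e" "d y w = d w y" "d e w = d w e" using d_sym y eV wV by auto
        then show ?thesis using y a w(2)[of a] by (intro bexI[of _ y] exI[of _ a]) auto
      next
        case False
        then show ?thesis using b w(2)[of b] eV wV
          by (intro bexI[of _ e] exI[of _ b]) auto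
      qed
    qed
    obtain y a where y: "y \<in> V" "a \<le> n" "d (c 0) y + d y w = d (c 0) w" "d w y \<le> 2 * int M"
      "d y (c a) \<le> int M" "2 * int M \<le> d w y + d w (c a) - d y (c a)"
      using side[OF disjI1[OF refl]] by blast
    obtain z b where z: "z \<in> V" "b \<le> n" "d (c n) z + d z w = d (c n) w" "d w z \<le> 2 * int M"
      "d z (c b) \<le> int M" "2 * int M \<le> d w z + d w (c b) - d z (c b)"
      using side[OF disjI2[OF refl]] by blast
    have V: "c a \<in> V" "c b \<in> V" "c 0 \<in> V" "c n \<in> V" using cV y z by auto
    have tri: "d (c a) (c b) \<le> d (c a) y + d y (c b)" "d y (c b) \<le> d y z + d z (c b)"
      "d y z \<le> d y w + d w z" "d (c a) y = d y (c a)" "d y w = d w y"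
      using V y(1) z(1) wV by (auto intro: d_tri d_sym)
    have len: "d (c a) (c b) \<le> 6 * int M" using tri y z by linarith
    have ab: "\<bar>int a - int b\<bar> \<le> 6 * \<mu> * int M"
    proof -
      have "\<bar>int a - int b\<bar> \<le> \<mu> * d (c a) (c b)" using qg y z by (simp add: quasi_geodesic_def)
      also have "\<dots> \<le> \<mu> * (6 * int M)" using len \<open>0 \<le> \<mu>\<close> by (rule mult_left_mono)
      finally show ?thesis by simp
    qed
    have "2 * int M \<le> l + (int k + 2) * D" if k: "6 * \<mu> * int M \<le> 2 ^ k" for k
    proof -
      have "int (max a b - min a b) = \<bar>int a - int b\<bar>" by (simp add: max_def min_def)
      also have "\<dots> \<le> int (2 ^ k)" using order.trans[OF ab k] by simp
      finally have abk: "max a b - min a b \<le> 2 ^ k" by (simp only: of_nat_le_iff)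
      have "2 * int M - l - int k * D \<le> d w (c (min a b)) + d w (c (max a b)) - d (c (min a b)) (c (max a b))"
        by (rule product_along_path[OF D \<open>0 \<le> l\<close> wV]) (use qg y z w abk in \<open>auto simp: quasi_geodesic_def\<close>)
      moreover have "d (c b) (c a) = d (c a) (c b)" using V by (auto intro: d_sym)
      ultimately have chain: "2 * int M - l - int k * D \<le> d w (c a) + d w (c b) - d (c a) (c b)"
        by (auto simp: min_def max_def split: if_splits)
      have yz: "d y z = d y w + d w z"
      proof -
        have "d (c 0) (c n) \<le> d (c 0) y + d y (c n)" "d y (c n) \<le> d y z + d z (c n)"
          "d (c n) z = d z (c n)" "d (c n) w = d w (c n)" "d z w = d w z"
          using V y(1) z(1) wV by (auto intro: d_tri d_sym)
        then show ?thesis using y z w(1) tri unfolding between_def by linarith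
      qed
      have 1: "d w (c a) + d y (c b) \<le> d w y + d (c a) (c b) + D \<or> d w (c a) + d y (c b) \<le> d w (c b) + d (c a) y + D"
        by (rule four_pointD[OF D(1)]) (use V y(1) wV in auto)
      have 2: "d w (c b) + d y z \<le> d w y + d (c b) z + D \<or> d w (c b) + d y z \<le> d w z + d (c b) y + D"
        by (rule four_pointD[OF D(1)]) (use V y(1) z(1) wV in auto)
      have "d (c b) y = d y (c b)" "d (c b) z = d z (c b)" using V y z by (auto intro: d_sym)
      moreover have "0 \<le> int k * D" using D by simp
      ultimately have "2 * int M - l - int k * D - 2 * D \<le> 0"
        using 1 2 chain yz tri y z \<open>0 \<le> l\<close> D(2) by linarith
      then show ?thesis by (simp add: algebra_simps)
    qed
    then have "int M \<le> B" by (intro B(2)) auto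
    then show False using MB by simp
  qed
  then show ?thesis using B(1) by blast
qed

text \<open>Every point of the geodesic is close to the quasi-geodesic before or after the given point \<open>c i\<close>.  Where this
  changes, two points of the quasi-geodesic on either side of \<open>c i\<close> are close to each other, so
  few steps lead from them to \<open>c i\<close>.\<close>

lemma quasi_geodesic_near_geodesic:
  assumes D: "four_point D" "0 \<le> D" and l: "0 \<le> l" "0 \<le> \<mu>"
  shows "\<exists>B\<ge>0. \<forall>c n i. quasi_geodesic l \<mu> c n \<longrightarrow> i \<le> n
    \<longrightarrow> (\<exists>w. between (c 0) w (c n) \<and> d (c i) w \<le> B)"
proof -
  obtain B where B: "B \<ge> 0"
    "\<And>c n w. quasi_geodesic l \<mu> c n \<Longrightarrow> between (c 0) w (c n) \<Longrightarrow> \<exists>i\<le>n. d w (c i) \<le> B"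
    using geodesic_near_quasi_geodesic[OF assms] by blast
  define B2 where "B2 = B + l * (\<mu> * (2 * B + 1))"
  have "\<exists>w. between (c 0) w (c n) \<and> d (c i) w \<le> B2" if qg: "quasi_geodesic l \<mu> c n" "i \<le> n" for c n i
  proof -
    have cV: "\<And>i. i \<le> n \<Longrightarrow> c i \<in> V" using qg by (simp add: quasi_geodesic_def)
    have V: "c 0 \<in> V" "c n \<in> V" "c i \<in> V" using cV qg(2) by auto
    have run: "d (c j) (c i) \<le> l * (\<mu> * (2 * B + 1))"
      if "j \<le> i" "i \<le> h" "h \<le> n" "d (c j) (c h) \<le> 2 * B + 1" for j h
    proof -
      have "d (c j) (c i) \<le> l * (int i - int j)"
        by (rule path_length) (use qg that in \<open>auto simp: quasi_geodesic_def\<close>)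
      also have "int i - int j \<le> \<bar>int j - int h\<bar>" using that by linarith
      also have "\<dots> \<le> \<mu> * d (c j) (c h)"
      proof -
        have "j \<le> n" "h \<le> n" using that by auto
        then show ?thesis using qg(1) unfolding quasi_geodesic_def by blast
      qed
      also have "\<dots> \<le> \<mu> * (2 * B + 1)" using that l by (intro mult_left_mono) auto
      finally show ?thesis using l by (simp add: mult_left_mono)
    qed
    define N where "N = nat (d (c 0) (c n))"
    obtain e where e: "e 0 = c 0" "e N = c n" "disc_geodesic e N"
      using disc_geodesic_ends[OF V(1,2)] N_def by auto
    have btw: "between (c 0) (e t) (c n)" if "t \<le> N" for t
      using disc_geodesic_between[OF e(3) that] e by simp
    define Q where "Q t \<longleftrightarrow> (\<exists>j\<le>i. d (e t) (c j) \<le> B)" for t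
    show ?thesis
    proof (cases "Q N")
      case True
      then obtain j where j: "j \<le> i" "d (c n) (c j) \<le> B" using e by (auto simp: Q_def)
      have "d (c j) (c n) \<le> 2 * B + 1" using j d_sym[of "c n" "c j"] cV qg(2) B(1) by auto
      then have "d (c j) (c i) \<le> l * (\<mu> * (2 * B + 1))" using run[of j n] j qg(2) by auto
      moreover have "d (c i) (c n) \<le> d (c i) (c j) + d (c j) (c n)" "d (c i) (c j) = d (c j) (c i)"
        "d (c j) (c n) = d (c n) (c j)"
        using cV V j qg(2) by (auto intro: d_tri d_sym)
      ultimately have "d (c i) (c n) \<le> B2" using j unfolding B2_def by linarith
      moreover have "between (c 0) (c n) (c n)" using V by (simp add: between_def)
      ultimately show ?thesis by blast
    next
      case False
      have "Q 0" using e V B(1) by (auto simp: Q_def intro!: exI[of _ 0])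
      then obtain t where t: "t < N" "Q t" "\<not> Q (Suc t)"
        using False last_true_before_false[of Q N] by blast
      obtain j where j: "j \<le> i" "d (e t) (c j) \<le> B" using t by (auto simp: Q_def)
      obtain h where h: "h \<le> n" "d (e (Suc t)) (c h) \<le> B"
        using B(2)[OF qg(1) btw[of "Suc t"]] t by auto
      have "i \<le> h" using h t(3) by (metis Q_def nat_le_linear)
      have eV: "e t \<in> V" "e (Suc t) \<in> V" "d (e t) (e (Suc t)) = 1"
        using e(3) t(1) by (auto simp: disc_geodesic_def)
      have jV: "c j \<in> V" "c h \<in> V" using cV j h qg(2) by auto
      have tri: "d (c j) (c h) \<le> d (c j) (e t) + d (e t) (c h)" "d (e t) (c h) \<le> d (e t) (e (Suc t)) + d (e (Suc t)) (c h)"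
        "d (c j) (e t) = d (e t) (c j)" "d (c i) (e t) \<le> d (c i) (c j) + d (c j) (e t)"
        "d (c i) (c j) = d (c j) (c i)"
        using eV jV V by (auto intro: d_tri d_sym)
      then have "d (c j) (c h) \<le> 2 * B + 1" using eV j h by linarith
      then have "d (c j) (c i) \<le> l * (\<mu> * (2 * B + 1))" using run[of j h] j h \<open>i \<le> h\<close> by auto
      then have "d (c i) (e t) \<le> B2" using tri j unfolding B2_def by linarith
      then show ?thesis using btw[of t] t by auto
    qed
  qed
  moreover have "B2 \<ge> 0" using B(1) l by (simp add: B2_def)
  ultimately show ?thesis by blast
qed

end


text \<open>Geodesics of the second metric are quasi-geodesics of the first, hence close to its geodesics.  A point on
  a side of a triangle of the second metric therefore has a small product for the first metric with respect
  to the ends of that side, and by the four-point condition with respect to those of another side.\<close>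

lemma four_point_transfer:
  assumes "graph_metric V d" "graph_metric V d'"
    and l: "1 \<le> l" "\<And>x y. x \<in> V \<Longrightarrow> y \<in> V \<Longrightarrow> d x y \<le> l * d' x y"
    and \<mu>: "1 \<le> \<mu>" "\<And>x y. x \<in> V \<Longrightarrow> y \<in> V \<Longrightarrow> d' x y \<le> \<mu> * d x y"
    and D: "graph_metric.four_point V d D" "0 \<le> D"
  shows "\<exists>D'\<ge>0. graph_metric.four_point V d' D'"
proof -
  interpret s: graph_metric V d by fact
  interpret a: graph_metric V d' by fact
  have l0: "0 \<le> l" "0 \<le> \<mu>" using l \<mu> by auto
  obtain B1 where B1: "B1 \<ge> 0" "\<And>c n w. s.quasi_geodesic l \<mu> c n \<Longrightarrow> s.between (c 0) w (c n)
      \<Longrightarrow> \<exists>i\<le>n. d w (c i) \<le> B1"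
    using s.geodesic_near_quasi_geodesic[OF D l0] by blast
  obtain B2 where B2: "B2 \<ge> 0" "\<And>c n i. s.quasi_geodesic l \<mu> c n \<Longrightarrow> i \<le> n
      \<Longrightarrow> \<exists>w. s.between (c 0) w (c n) \<and> d (c i) w \<le> B2"
    using s.quasi_geodesic_near_geodesic[OF D l0] by blast
  have qg: "s.quasi_geodesic l \<mu> c n" if geo: "a.disc_geodesic c n" for c n
  proof -
    have cV: "c i \<in> V" if "i \<le> n" for i
      using geo that unfolding a.disc_geodesic_def by blast
    have dist: "d' (c i) (c j) = \<bar>int i - int j\<bar>" if "i \<le> n" "j \<le> n" for i j
      using geo that unfolding a.disc_geodesic_def by blast
    have "d (c i) (c (Suc i)) \<le> l" if "i < n" for i
      using l(2)[OF cV cV, of i "Suc i"] dist[of i "Suc i"] that by simp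
    moreover have "\<bar>int i - int j\<bar> \<le> \<mu> * d (c i) (c j)" if "i \<le> n" "j \<le> n" for i j
      using \<mu>(2)[OF cV cV, of i j] dist[of i j] that by presburger
    ultimately show ?thesis using cV unfolding s.quasi_geodesic_def by blast
  qed
  define E where "E = 2 * B2 + D"
  define \<delta> where "\<delta> = \<mu> * (E + D + B1)"
  have E: "0 \<le> E" using B2(1) D(2) unfolding E_def by linarith
  have EDB: "0 \<le> E + D + B1" using E B1(1) D(2) by linarith
  have \<delta>: "0 \<le> \<delta>" using mult_nonneg_nonneg[OF l0(2) EDB] by (simp only: \<delta>_def)
  \<comment> \<open>A point with small product with respect to two others is close to every geodesic
    of the second metric between them.\<close>
  have close: "\<exists>u. a.between z u y \<and> d' m u \<le> \<delta>"
    if V: "m \<in> V" "z \<in> V" "y \<in> V" and small: "d m z + d m y - d z y \<le> E" for m z y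
  proof -
    have "\<exists>w. s.between z w y \<and> d m w \<le> E + D"
    proof (cases "d m z \<le> d z y")
      case True
      obtain w where w: "w \<in> V" "d z w = d m z" "d w y = d z y - d m z"
        using s.d_interp[OF V(2,3) s.d_nonneg[OF V(1,2)] True] by blast
      have "d m w + d z y \<le> d m z + d w y + D \<or> d m w + d z y \<le> d m y + d w z + D"
        by (rule s.four_pointD[OF D(1)]) (use V w in auto)
      moreover have "d w z = d z w" by (rule s.d_sym[OF w(1) V(2)])
      ultimately have "d m w \<le> E + D" using w small E by linarith
      then show ?thesis using w by (auto simp: s.between_def)
    next
      case False
      then have "d m y \<le> E + D" using small D by linarith
      then show ?thesis using V by (intro exI[of _ y]) (auto simp: s.between_def)
    qed
    then obtain w where w: "s.between z w y" "d m w \<le> E + D" by blast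
    define n where "n = nat (d' z y)"
    obtain c where c: "c 0 = z" "c n = y" "a.disc_geodesic c n"
      using a.disc_geodesic_ends[OF V(2,3)] n_def by auto
    obtain i where i: "i \<le> n" "d w (c i) \<le> B1"
      using B1(2)[OF qg[OF c(3)]] w c by auto
    have ci: "c i \<in> V" "w \<in> V" using c(3) i w by (auto simp: a.disc_geodesic_def s.between_def)
    have "d m (c i) \<le> d m w + d w (c i)" using V ci by (auto intro: s.d_tri)
    then have "d m (c i) \<le> E + D + B1" using w i by linarith
    then have "d' m (c i) \<le> \<delta>" unfolding \<delta>_def
      using \<mu>(2)[OF V(1) ci(1)] l0 by (meson mult_left_mono order_trans)
    moreover have "a.between z (c i) y" using a.disc_geodesic_between[OF c(3) i(1)] c by simp
    ultimately show ?thesis by blast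
  qed
  have "a.slim \<delta>"
    unfolding a.slim_def
  proof (intro ballI allI impI)
    fix x y z m assume V: "x \<in> V" "y \<in> V" "z \<in> V" and m: "a.between x m y"
    have mV: "m \<in> V" using m a.betweenD by auto
    obtain c where c: "c 0 = x" "c (nat (d' x m)) = m" "c (nat (d' x y)) = y"
      "nat (d' x m) \<le> nat (d' x y)" "a.disc_geodesic c (nat (d' x y))"
      using a.disc_geodesic_through[OF V(1,2) m] by blast
    obtain w where w: "s.between x w y" "d m w \<le> B2"
      using B2(2)[OF qg[OF c(5)] c(4)] c by auto
    have wV: "w \<in> V" using w s.betweenD by auto
    have "d m x \<le> d m w + d w x" "d m y \<le> d m w + d w y" "d w x = d x w"
      using V mV wV by (auto intro: s.d_tri s.d_sym)
    then have prod: "d m x + d m y - d x y \<le> 2 * B2" using w by (auto simp: s.between_def)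
    have "d m z + d x y \<le> d m x + d z y + D \<or> d m z + d x y \<le> d m y + d z x + D"
      by (rule s.four_pointD[OF D(1)]) (use V mV in auto)
    moreover have "d z x = d x z" using V by (auto intro: s.d_sym)
    ultimately have "d m z + d m y - d z y \<le> E \<or> d m x + d m z - d x z \<le> E"
      using prod unfolding E_def by linarith
    then show "\<exists>u. (a.between x u z \<or> a.between z u y) \<and> d' m u \<le> \<delta>"
      using close[of m z y] close[of m x z] V mV by blast
  qed
  then have "a.four_point (6 * \<delta> + 2)" using a.slim_imp_four_point \<delta> by blast
  then show ?thesis using \<delta> by (intro exI[of _ "6 * \<delta> + 2"]) auto
qed


section \<open>Word metrics\<close>

locale cayley = group G for G :: "('a, 'b) monoid_scheme" (structure) +
  fixes A :: "'a set"
  assumes generating: "fin_sym_generating_set G A"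
begin

definition word_prod :: "'a list \<Rightarrow> 'a" where
  "word_prod ws = foldr (\<otimes>) ws \<one>"

definition word_len :: "'a \<Rightarrow> nat" where
  "word_len g = (LEAST n. \<exists>ws. set ws \<subseteq> A \<and> length ws = n \<and> word_prod ws = g)"

definition wd :: "'a \<Rightarrow> 'a \<Rightarrow> int" where
  "wd u v = int (word_len (inv u \<otimes> v))"

lemma A_props: "finite A" "A \<subseteq> carrier G" "a \<in> A \<Longrightarrow> inv a \<in> A" "generate G A = carrier G"
  using generating by (auto simp: fin_sym_generating_set_def)

lemma word_prod_simps [simp]: "word_prod [] = \<one>" "word_prod (a # ws) = a \<otimes> word_prod ws"
  by (auto simp: word_prod_def)

lemma word_prod_closed: "set ws \<subseteq> A \<Longrightarrow> word_prod ws \<in> carrier G"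
  using A_props(2) by (induction ws) auto

lemma word_prod_append:
  "set ws \<subseteq> A \<Longrightarrow> set ws' \<subseteq> A \<Longrightarrow> word_prod (ws @ ws') = word_prod ws \<otimes> word_prod ws'"
  using A_props(2) by (induction ws) (auto simp: m_assoc word_prod_closed subset_iff)

lemma word_exists: "g \<in> carrier G \<Longrightarrow> \<exists>ws. set ws \<subseteq> A \<and> word_prod ws = g"
proof -
  assume "g \<in> carrier G"
  then have "g \<in> generate G A" using A_props by simp
  then show ?thesis
  proof (induction rule: generate.induct)
    case one
    show ?case by (intro exI[of _ "[]"]) simp
  next
    case (incl h)
    then show ?case using A_props(2) by (intro exI[of _ "[h]"]) auto
  next
    case (inv h)
    then show ?case using A_props(2) A_props(3)[of h] by (intro exI[of _ "[inv h]"]) auto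
  next
    case (eng h1 h2)
    then obtain ws1 ws2 where "set ws1 \<subseteq> A" "word_prod ws1 = h1" "set ws2 \<subseteq> A" "word_prod ws2 = h2"
      by blast
    then show ?case by (intro exI[of _ "ws1 @ ws2"]) (auto simp: word_prod_append)
  qed
qed

lemma shortest_word:
  assumes "g \<in> carrier G"
  shows "\<exists>ws. set ws \<subseteq> A \<and> length ws = word_len g \<and> word_prod ws = g"
proof -
  obtain ws where ws: "set ws \<subseteq> A" "word_prod ws = g" using word_exists[OF assms] by blast
  define P where "P n \<longleftrightarrow> (\<exists>ws. set ws \<subseteq> A \<and> length ws = n \<and> word_prod ws = g)" for n
  have "P (length ws)" using ws unfolding P_def by blast
  then have "P (LEAST n. P n)" by (rule LeastI)
  then show ?thesis unfolding P_def word_len_def .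
qed

lemma word_len_le: "set ws \<subseteq> A \<Longrightarrow> word_len (word_prod ws) \<le> length ws"
  unfolding word_len_def by (rule Least_le) blast

lemma word_len_eq_0: "g \<in> carrier G \<Longrightarrow> word_len g = 0 \<longleftrightarrow> g = \<one>"
  using shortest_word[of g] word_len_le[of "[]"] by auto

lemma word_len_mult:
  assumes "g \<in> carrier G" "h \<in> carrier G"
  shows "word_len (g \<otimes> h) \<le> word_len g + word_len h"
proof -
  obtain ws1 ws2 where "set ws1 \<subseteq> A" "length ws1 = word_len g" "word_prod ws1 = g"
    "set ws2 \<subseteq> A" "length ws2 = word_len h" "word_prod ws2 = h"
    using shortest_word assms by meson
  then show ?thesis using word_len_le[of "ws1 @ ws2"] by (auto simp: word_prod_append)
qed

lemma inv_word:
  assumes "set ws \<subseteq> A"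
  shows "set (rev (map (m_inv G) ws)) \<subseteq> A \<and> word_prod (rev (map (m_inv G) ws)) = inv (word_prod ws)"
  using assms
proof (induction ws)
  case (Cons a ws)
  have a: "a \<in> A" "a \<in> carrier G" "inv a \<in> A" using Cons.prems A_props by auto
  have ws: "set ws \<subseteq> A" "word_prod ws \<in> carrier G" using Cons.prems word_prod_closed by auto
  have IH: "set (rev (map (m_inv G) ws)) \<subseteq> A" "word_prod (rev (map (m_inv G) ws)) = inv (word_prod ws)"
    using Cons.IH[OF ws(1)] by auto
  have split: "rev (map (m_inv G) (a # ws)) = rev (map (m_inv G) ws) @ [inv a]" by simp
  have single: "set [inv a] \<subseteq> A" "word_prod [inv a] = inv a" using a by auto
  have "word_prod (rev (map (m_inv G) (a # ws))) = inv (word_prod ws) \<otimes> inv a"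
    unfolding split word_prod_append[OF IH(1) single(1)] IH(2) single(2) ..
  also have "\<dots> = inv (word_prod (a # ws))" using a ws by (simp add: inv_mult_group)
  finally show ?case using IH(1) a(3) by simp
qed simp

lemma word_len_inv: "g \<in> carrier G \<Longrightarrow> word_len (inv g) = word_len g"
proof -
  have *: "word_len (inv g) \<le> word_len g" if g: "g \<in> carrier G" for g
  proof -
    obtain ws where ws: "set ws \<subseteq> A" "length ws = word_len g" "word_prod ws = g"
      using shortest_word[OF g] by blast
    then show ?thesis using word_len_le[OF conjunct1[OF inv_word[OF ws(1)]]] inv_word[OF ws(1)] by simp
  qed
  assume "g \<in> carrier G"
  then show ?thesis using *[of g] *[of "inv g"] by simp
qed

lemma mult_inv_cancel:
  assumes "u \<in> carrier G" "v \<in> carrier G" "w \<in> carrier G"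
  shows "(inv u \<otimes> v) \<otimes> (inv v \<otimes> w) = inv u \<otimes> w" "u \<otimes> (inv u \<otimes> v) = v" "inv u \<otimes> (u \<otimes> v) = v"
proof -
  have 1: "u \<otimes> (inv u \<otimes> v) = v" "inv u \<otimes> (u \<otimes> v) = v"
    if "u \<in> carrier G" "v \<in> carrier G" for u v using that by (simp_all flip: m_assoc)
  show "(inv u \<otimes> v) \<otimes> (inv v \<otimes> w) = inv u \<otimes> w"
    using assms 1[of v w] by (simp add: m_assoc)
  show "u \<otimes> (inv u \<otimes> v) = v" "inv u \<otimes> (u \<otimes> v) = v" using 1 assms by auto
qed

lemma wd_left:
  assumes "g \<in> carrier G" "u \<in> carrier G" "v \<in> carrier G"
  shows "wd (g \<otimes> u) (g \<otimes> v) = wd u v"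
proof -
  have "inv (g \<otimes> u) \<otimes> (g \<otimes> v) = inv u \<otimes> v"
    using assms mult_inv_cancel(3)[of g v] by (simp add: inv_mult_group m_assoc)
  then show ?thesis by (simp add: wd_def)
qed

sublocale graph_metric "carrier G" wd
proof
  fix x y z assume x: "x \<in> carrier G" and y: "y \<in> carrier G"
  show "0 \<le> wd x y" by (simp add: wd_def)
  show "wd x y = 0 \<longleftrightarrow> x = y"
    using x y word_len_eq_0[of "inv x \<otimes> y"] mult_inv_cancel(2)[OF x y y]
    by (auto simp: wd_def)
  show "wd x y = wd y x"
    using x y word_len_inv[of "inv x \<otimes> y"] by (simp add: wd_def inv_mult_group)
  assume z: "z \<in> carrier G"
  show "wd x z \<le> wd x y + wd y z"
    using word_len_mult[of "inv x \<otimes> y" "inv y \<otimes> z"] x y z mult_inv_cancel(1)[OF x y z]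
    by (simp add: wd_def)
next
  fix x y k assume xy: "x \<in> carrier G" "y \<in> carrier G" and k: "0 \<le> k" "k \<le> wd x y"
  define g where "g = inv x \<otimes> y"
  have g: "g \<in> carrier G" "y = x \<otimes> g" using xy mult_inv_cancel(2)[OF xy(1,2,2)] by (auto simp: g_def)
  obtain ws where ws: "set ws \<subseteq> A" "length ws = word_len g" "word_prod ws = g"
    using shortest_word[OF g(1)] by blast
  define u where "u = take (nat k) ws"
  define v where "v = drop (nat k) ws"
  have uv: "set u \<subseteq> A" "set v \<subseteq> A" "ws = u @ v"
    using ws(1) set_take_subset[of "nat k" ws] set_drop_subset[of "nat k" ws] by (auto simp: u_def v_def)
  have uvc: "word_prod u \<in> carrier G" "word_prod v \<in> carrier G" using uv word_prod_closed by auto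
  have gp: "g = word_prod u \<otimes> word_prod v" using uv ws(3) word_prod_append by auto
  define z where "z = x \<otimes> word_prod u"
  have z: "z \<in> carrier G" using xy uvc by (simp add: z_def)
  have "inv x \<otimes> z = word_prod u" unfolding z_def using mult_inv_cancel(3) xy uvc by blast
  moreover have "inv z \<otimes> y = word_prod v"
  proof -
    have "y = z \<otimes> word_prod v" using g gp uvc xy by (simp add: z_def m_assoc)
    then show ?thesis using mult_inv_cancel(3)[OF z uvc(2) z] by simp
  qed
  ultimately have le: "word_len (inv x \<otimes> z) \<le> length u" "word_len (inv z \<otimes> y) \<le> length v"
    using word_len_le uv by metis+
  have "word_len g \<le> word_len (inv x \<otimes> z) + word_len (inv z \<otimes> y)"
    using word_len_mult[of "inv x \<otimes> z" "inv z \<otimes> y"] xy z mult_inv_cancel(1)[OF xy(1) z xy(2)]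
    by (simp add: g_def)
  moreover have "length u + length v = word_len g" using uv(3) ws(2) by simp
  ultimately have "word_len (inv x \<otimes> z) = length u" "word_len (inv z \<otimes> y) = length v"
    using le by linarith+
  moreover have "int (length u) = k" using k ws(2) by (auto simp: u_def wd_def g_def min_def)
  ultimately have "wd x z = k \<and> wd z y = wd x y - k"
    using \<open>length u + length v = word_len g\<close> by (simp add: wd_def g_def)
  then show "\<exists>z\<in>carrier G. wd x z = k \<and> wd z y = wd x y - k" using z by blast
qed

lemma finite_ball: "x \<in> carrier G \<Longrightarrow> finite {y \<in> carrier G. wd x y \<le> r}"
proof -
  assume x: "x \<in> carrier G"
  have "{y \<in> carrier G. wd x y \<le> r} \<subseteq> (\<lambda>ws. x \<otimes> word_prod ws) ` {ws. set ws \<subseteq> A \<and> length ws \<le> nat r}"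
  proof safe
    fix y assume y: "y \<in> carrier G" "wd x y \<le> r"
    obtain ws where ws: "set ws \<subseteq> A" "length ws = word_len (inv x \<otimes> y)" "word_prod ws = inv x \<otimes> y"
      using shortest_word[of "inv x \<otimes> y"] x y by auto
    show "y \<in> (\<lambda>ws. x \<otimes> word_prod ws) ` {ws. set ws \<subseteq> A \<and> length ws \<le> nat r}"
      using ws y mult_inv_cancel(2)[OF x y(1) y(1)] by (intro image_eqI[of _ _ ws]) (auto simp: wd_def)
  qed
  then show ?thesis using finite_lists_length_le[OF A_props(1)] by (rule finite_surj[rotated])
qed

lemma countable_carrier: "countable (carrier G)"
proof -
  have "carrier G \<subseteq> (\<Union>n::nat. {y \<in> carrier G. wd \<one> y \<le> int n})"
  proof
    fix g assume "g \<in> carrier G"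
    moreover have "wd \<one> g \<le> int (nat (wd \<one> g))" by simp
    ultimately show "g \<in> (\<Union>n::nat. {y \<in> carrier G. wd \<one> y \<le> int n})" by blast
  qed
  moreover have "countable (\<Union>n::nat. {y \<in> carrier G. wd \<one> y \<le> int n})"
    by (rule countable_UN) (auto intro!: countable_finite finite_ball)
  ultimately show ?thesis by (rule countable_subset)
qed

lemma adj_iff: "cayley_adj G A u v \<longleftrightarrow> u \<in> carrier G \<and> v \<in> carrier G \<and> wd u v = 1"
proof
  assume adj: "cayley_adj G A u v"
  then have uv: "u \<in> carrier G" "v \<in> carrier G" "u \<noteq> v" "inv u \<otimes> v \<in> A"
    by (auto simp: cayley_adj_def)
  then have "word_len (inv u \<otimes> v) \<le> 1" using word_len_le[of "[inv u \<otimes> v]"] by simp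
  then show "u \<in> carrier G \<and> v \<in> carrier G \<and> wd u v = 1"
    using uv d_eq_0[OF uv(1,2)] by (auto simp: wd_def)
next
  assume uv: "u \<in> carrier G \<and> v \<in> carrier G \<and> wd u v = 1"
  then obtain ws where ws: "set ws \<subseteq> A" "length ws = 1" "word_prod ws = inv u \<otimes> v"
    using shortest_word[of "inv u \<otimes> v"] by (auto simp: wd_def)
  then obtain a where a: "ws = [a]" by (cases ws) auto
  then have "a \<in> A" "a = inv u \<otimes> v" using ws A_props(2) by auto
  moreover have "u \<noteq> v" using uv d_eq_0[of u v] by auto
  ultimately show "cayley_adj G A u v" using uv by (simp add: cayley_adj_def)
qed

section \<open>The metric of the Cayley graph\<close>

definition lipschitz :: "('a \<Rightarrow> real) \<Rightarrow> bool" where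
  "lipschitz h \<longleftrightarrow> (\<forall>u\<in>carrier G. \<forall>v\<in>carrier G. \<bar>h u - h v\<bar> \<le> wd u v)"

end

text \<open>The largest extension of a function on the vertices that is 1-Lipschitz along edges.
  At a point of an edge it takes the minimum over the endpoints; the coordinate \<open>x u\<close> is one
  minus the distance to \<open>u\<close>.\<close>

definition graph_ext :: "('a \<Rightarrow> real) \<Rightarrow> ('a \<Rightarrow> real) \<Rightarrow> real" where
  "graph_ext h x = Min {h u + (1 - x u) | u. 0 < x u}"

lemma graph_ext_vertex [simp]: "graph_ext h (vertex u) = h u"
proof -
  have "{h v + (1 - vertex u v) | v. 0 < vertex u v} = {h u}" by (auto simp: vertex_def)
  then show ?thesis by (simp add: graph_ext_def)
qed

lemma edge_point_0 [simp]: "edge_point u v 0 = vertex u"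
  and edge_point_1 [simp]: "edge_point u v 1 = vertex v"
  by (auto simp: edge_point_def)

lemma edge_point_swap: "edge_point u v t = edge_point v u (1 - t)"
  by (simp add: edge_point_def fun_eq_iff algebra_simps)

lemma graph_ext_edge:
  assumes "u \<noteq> v" "\<bar>h u - h v\<bar> \<le> 1" "t \<in> {0..1}"
  shows "graph_ext h (edge_point u v t) = min (h u + t) (h v + 1 - t)"
proof -
  consider "t = 0" | "t = 1" | "0 < t" "t < 1" using assms(3) by fastforce
  then show ?thesis
  proof cases
    case 3
    have "{h w + (1 - edge_point u v t w) | w. 0 < edge_point u v t w} = {h u + t, h v + (1 - t)}"
      using assms(1) 3 by (auto simp: edge_point_def vertex_def of_bool_def split: if_splits)
    then show ?thesis by (simp add: graph_ext_def algebra_simps)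
  qed (use assms in auto)
qed

context cayley
begin

lemma lipschitz_adj: "lipschitz h \<Longrightarrow> cayley_adj G A u v \<Longrightarrow> u \<noteq> v \<and> \<bar>h u - h v\<bar> \<le> 1"
proof
  assume h: "lipschitz h" and adj: "cayley_adj G A u v"
  then have uv: "u \<in> carrier G" "v \<in> carrier G" "wd u v = 1" by (simp_all add: adj_iff)
  then show "u \<noteq> v" using d_eq_0[of u v] by force
  have "\<bar>h u - h v\<bar> \<le> wd u v" using h uv(1,2) unfolding lipschitz_def by blast
  then show "\<bar>h u - h v\<bar> \<le> 1" using uv(3) by simp
qed

lemma ext_edge:
  "lipschitz h \<Longrightarrow> cayley_adj G A u v \<Longrightarrow> t \<in> {0..1}
    \<Longrightarrow> graph_ext h (edge_point u v t) = min (h u + t) (h v + 1 - t)"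
  by (rule graph_ext_edge) (simp_all add: lipschitz_adj)

lemma edge_point_in_graph: "cayley_adj G A u v \<Longrightarrow> t \<in> {0..1} \<Longrightarrow> edge_point u v t \<in> cayley_graph G A"
  unfolding cayley_graph_def by blast

lemma vertex_in_graph: "u \<in> carrier G \<Longrightarrow> vertex u \<in> cayley_graph G A"
  by (simp add: cayley_graph_def)

lemma pl_path_in_graph:
  assumes "pl_path G A x y l"
  shows "x \<in> cayley_graph G A" "y \<in> cayley_graph G A" "0 \<le> l"
proof -
  have "x \<in> cayley_graph G A \<and> y \<in> cayley_graph G A \<and> 0 \<le> l"
    using assms by (induction rule: pl_path.induct) (simp_all add: edge_point_in_graph)
  then show "x \<in> cayley_graph G A" "y \<in> cayley_graph G A" "0 \<le> l" by simp_all
qed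

lemma pl_path_ext:
  assumes "pl_path G A x y l" "lipschitz h"
  shows "\<bar>graph_ext h x - graph_ext h y\<bar> \<le> l"
  using assms(1)
proof (induction rule: pl_path.induct)
  case (extend x u v s l t)
  have "\<bar>min (h u + s) (h v + 1 - s) - min (h u + t) (h v + 1 - t)\<bar> \<le> \<bar>s - t\<bar>"
    by (auto simp: min_def abs_if)
  then have "\<bar>graph_ext h (edge_point u v s) - graph_ext h (edge_point u v t)\<bar> \<le> \<bar>s - t\<bar>"
    using ext_edge[OF assms(2) extend.hyps(2)] extend.hyps(3,4) by simp
  then show ?case using extend.IH by linarith
qed simp

lemma pl_path_trans:
  assumes "pl_path G A y z l'"
  shows "pl_path G A x y l \<Longrightarrow> pl_path G A x z (l + l')"
  using assms
proof (induction rule: pl_path.induct)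
  case (const y)
  then show ?case by simp
next
  case (extend y u v s l' t)
  have "pl_path G A x (edge_point u v t) (l + l' + \<bar>s - t\<bar>)"
    by (rule pl_path.extend[OF extend.IH[OF extend.prems] extend.hyps(2-4)])
  then show ?case by (simp add: add.assoc)
qed

lemma pl_path_edge:
  assumes "cayley_adj G A u v" "s \<in> {0..1}" "t \<in> {0..1}"
  shows "pl_path G A (edge_point u v s) (edge_point u v t) \<bar>s - t\<bar>"
  using pl_path.extend[OF pl_path.const[OF edge_point_in_graph[OF assms(1,2)]] assms] by simp

lemma pl_path_sym: "pl_path G A x y l \<Longrightarrow> pl_path G A y x l"
proof (induction rule: pl_path.induct)
  case (extend x u v s l t)
  then show ?case using pl_path_trans[OF extend.IH pl_path_edge[of u v t s]]
    by (simp add: add.commute abs_minus_commute)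
qed (rule pl_path.const)

lemma adj_path: "cayley_adj G A u v \<Longrightarrow> pl_path G A (vertex u) (vertex v) 1"
  using pl_path_edge[of u v 0 1] by simp

lemma vertex_path:
  assumes "u \<in> carrier G" "v \<in> carrier G"
  shows "pl_path G A (vertex u) (vertex v) (wd u v)"
proof -
  have "pl_path G A (vertex u) (vertex v) (real n)" if "v \<in> carrier G" "wd u v = int n" for n v
    using that
  proof (induction n arbitrary: v)
    case 0
    then show ?case using d_eq_0[OF assms(1)] assms(1) by (auto intro: pl_path.const vertex_in_graph)
  next
    case (Suc n)
    obtain z where z: "z \<in> carrier G" "wd u z = int n" "wd z v = 1"
      using d_interp[OF assms(1) Suc.prems(1), of "int n"] Suc.prems(2) by auto
    have "pl_path G A (vertex z) (vertex v) 1"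
      using z Suc.prems by (intro adj_path) (simp add: adj_iff)
    then have "pl_path G A (vertex u) (vertex v) (real n + 1)"
      using pl_path_trans Suc.IH[OF z(1,2)] by blast
    then show ?case by (simp add: add.commute)
  qed
  from this[of v "nat (wd u v)"] show ?thesis using assms d_nonneg by simp
qed

lemma near_vertex:
  assumes "x \<in> cayley_graph G A"
  shows "\<exists>u\<in>carrier G. \<exists>l\<le>1. pl_path G A (vertex u) x l"
  using assms unfolding cayley_graph_def
proof (elim UnE imageE)
  fix u assume "x = vertex u" "u \<in> carrier G"
  then show ?thesis using pl_path.const[OF vertex_in_graph[of u]]
    by (intro bexI[of _ u] exI[of _ 0]) simp_all
next
  assume "x \<in> {edge_point u v t | u v t. cayley_adj G A u v \<and> t \<in> {0..1}}"
  then obtain u v t where "x = edge_point u v t" "cayley_adj G A u v" "t \<in> {0..1}" by blast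
  then show ?thesis using pl_path_edge[of u v 0 t]
    by (intro bexI[of _ u] exI[of _ t]) (auto simp: adj_iff)
qed

lemma connected_graph:
  assumes "x \<in> cayley_graph G A" "y \<in> cayley_graph G A"
  shows "\<exists>l. pl_path G A x y l"
  using near_vertex[OF assms(1)] near_vertex[OF assms(2)]
  by (meson pl_path_sym pl_path_trans vertex_path)

lemma dist_le: "pl_path G A x y l \<Longrightarrow> cayley_dist G A x y \<le> l"
  unfolding cayley_dist_def
  by (rule cInf_lower) (auto intro!: bdd_belowI[of _ 0] dest: pl_path_in_graph(3))

lemma dist_greatest:
  assumes "x \<in> cayley_graph G A" "y \<in> cayley_graph G A" "\<And>l. pl_path G A x y l \<Longrightarrow> b \<le> l"
  shows "b \<le> cayley_dist G A x y"
  unfolding cayley_dist_def using assms connected_graph by (intro cInf_greatest) auto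

lemma ext_le_dist:
  assumes "x \<in> cayley_graph G A" "y \<in> cayley_graph G A" "lipschitz h"
  shows "\<bar>graph_ext h x - graph_ext h y\<bar> \<le> cayley_dist G A x y"
  using assms pl_path_ext by (intro dist_greatest) auto

lemma dist_nonneg: "x \<in> cayley_graph G A \<Longrightarrow> y \<in> cayley_graph G A \<Longrightarrow> 0 \<le> cayley_dist G A x y"
  by (intro dist_greatest pl_path_in_graph(3))

lemma dist_sym: "cayley_dist G A x y = cayley_dist G A y x"
proof -
  have "{l. pl_path G A x y l} = {l. pl_path G A y x l}" using pl_path_sym by auto
  then show ?thesis by (simp add: cayley_dist_def)
qed

lemma dist_tri:
  assumes "x \<in> cayley_graph G A" "y \<in> cayley_graph G A" "z \<in> cayley_graph G A"
  shows "cayley_dist G A x z \<le> cayley_dist G A x y + cayley_dist G A y z"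
proof -
  have "cayley_dist G A x z - cayley_dist G A y z \<le> cayley_dist G A x y"
  proof (intro dist_greatest assms)
    fix l assume l: "pl_path G A x y l"
    have "cayley_dist G A x z - l \<le> cayley_dist G A y z"
    proof (intro dist_greatest assms)
      fix l' assume "pl_path G A y z l'"
      then show "cayley_dist G A x z - l \<le> l'" using dist_le[OF pl_path_trans[OF _ l]] by force
    qed
    then show "cayley_dist G A x z - cayley_dist G A y z \<le> l" by simp
  qed
  then show ?thesis by simp
qed

lemma lipschitz_wd: "p \<in> carrier G \<Longrightarrow> lipschitz (\<lambda>u. real_of_int (wd p u))"
proof -
  assume p: "p \<in> carrier G"
  have "\<bar>wd p u - wd p v\<bar> \<le> wd u v" if "u \<in> carrier G" "v \<in> carrier G" for u v
    using d_tri[OF p that] d_tri[OF p that(2,1)] d_sym[OF that] by linarith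
  then show ?thesis unfolding lipschitz_def by (metis of_int_abs of_int_diff of_int_le_iff)
qed

lemma dist_vertex:
  assumes "u \<in> carrier G" "v \<in> carrier G"
  shows "cayley_dist G A (vertex u) (vertex v) = wd u v"
proof (rule antisym)
  show "cayley_dist G A (vertex u) (vertex v) \<le> wd u v" by (rule dist_le[OF vertex_path[OF assms]])
  show "wd u v \<le> cayley_dist G A (vertex u) (vertex v)"
    using ext_le_dist[OF vertex_in_graph vertex_in_graph lipschitz_wd, of u v u] assms d_nonneg[OF assms]
    by simp
qed

text \<open>The arc-length parametrisation of the edge path through the vertices \<open>c 0, \<dots>, c n\<close>.  It stays at the
  last vertex from time \<open>n\<close> on, where no edge is left.\<close>

definition edge_path :: "(nat \<Rightarrow> 'a) \<Rightarrow> nat \<Rightarrow> real \<Rightarrow> 'a \<Rightarrow> real" where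
  "edge_path c n t = (if t < real n then edge_point (c (nat \<lfloor>t\<rfloor>)) (c (Suc (nat \<lfloor>t\<rfloor>))) (t - real (nat \<lfloor>t\<rfloor>))
     else vertex (c n))"

lemma edge_path_vertex: "i \<le> n \<Longrightarrow> edge_path c n (real i) = vertex (c i)"
  by (auto simp: edge_path_def)

lemma edge_path_edge:
  assumes "i < n" "real i \<le> t" "t \<le> real i + 1"
  shows "edge_path c n t = edge_point (c i) (c (Suc i)) (t - real i)"
proof (cases "t = real i + 1")
  case True
  then show ?thesis using assms edge_path_vertex[of "Suc i" n c] by (simp add: add.commute)
next
  case False
  then have "\<lfloor>t\<rfloor> = int i" using assms by linarith
  moreover have "t < real n" using assms False by linarith
  ultimately show ?thesis by (simp add: edge_path_def)
qed

lemma edge_path_cell: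
  assumes "0 \<le> t" "t \<le> real n" "0 < n"
  shows "\<exists>i<n. real i \<le> t \<and> t \<le> real i + 1"
proof (cases "t = real n")
  case True
  then show ?thesis using assms by (intro exI[of _ "n - 1"]) (auto simp: of_nat_diff)
next
  case False
  then show ?thesis using assms
    by (intro exI[of _ "nat \<lfloor>t\<rfloor>"] conjI) (use assms in linarith)+
qed

lemma disc_geodesic_adj: "disc_geodesic c n \<Longrightarrow> i < n \<Longrightarrow> cayley_adj G A (c i) (c (Suc i))"
  by (auto simp: adj_iff disc_geodesic_def)

text \<open>The lower bound on distances along the edge path comes from the extension of the distance to its first
  vertex, which is 1-Lipschitz and equals the time parameter on the path.\<close>

lemma geodesic_edge_path:
  assumes c: "disc_geodesic c n"
  shows "geodesic G A (edge_path c n) (real n)"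
proof -
  have cV: "\<And>i. i \<le> n \<Longrightarrow> c i \<in> carrier G" using c by (simp add: disc_geodesic_def)
  have in_graph: "edge_path c n t \<in> cayley_graph G A" if t: "t \<in> {0..real n}" for t
  proof (cases "n = 0")
    case True
    then show ?thesis using that cV[of 0] vertex_in_graph by (simp add: edge_path_def)
  next
    case False
    then obtain i where i: "i < n" "real i \<le> t" "t \<le> real i + 1"
      using t edge_path_cell[of t n] by auto
    then show ?thesis
      using edge_path_edge[OF i] edge_point_in_graph[OF disc_geodesic_adj[OF c i(1)], of "t - real i"] by simp
  qed
  define f where "f = graph_ext (\<lambda>u. real_of_int (wd (c 0) u))"
  have f: "f (edge_path c n t) = t" if t: "t \<in> {0..real n}" for t
  proof (cases "n = 0")
    case True
    then show ?thesis using that cV[of 0] by (simp add: edge_path_def f_def)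
  next
    case False
    then obtain i where i: "i < n" "real i \<le> t" "t \<le> real i + 1"
      using t edge_path_cell[of t n] by auto
    have "wd (c 0) (c i) = int i" "wd (c 0) (c (Suc i)) = int (Suc i)"
      using c i(1) by (auto simp: disc_geodesic_def)
    then show ?thesis
      using ext_edge[OF lipschitz_wd[OF cV[of 0]] disc_geodesic_adj[OF c i(1)], of "t - real i"] i
      unfolding edge_path_edge[OF i] f_def by simp
  qed
  have low: "\<bar>s - t\<bar> \<le> cayley_dist G A (edge_path c n s) (edge_path c n t)"
    if "s \<in> {0..real n}" "t \<in> {0..real n}" for s t
    using ext_le_dist[OF in_graph[OF that(1)] in_graph[OF that(2)] lipschitz_wd[OF cV[of 0]]] f that
    unfolding f_def by simp
  have cell: "cayley_dist G A (edge_path c n s) (edge_path c n t) \<le> t - s"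
    if "i < n" "real i \<le> s" "s \<le> t" "t \<le> real i + 1" for s t i
    using dist_le[OF pl_path_edge[OF disc_geodesic_adj[OF c that(1)], of "s - real i" "t - real i"]]
      edge_path_edge[of i n s c] edge_path_edge[of i n t c] that by simp
  have ints: "cayley_dist G A (edge_path c n (real i)) (edge_path c n (real j)) = real j - real i"
    if "i \<le> j" "j \<le> n" for i j
    using that dist_vertex[OF cV[of i] cV[of j]] c by (simp add: edge_path_vertex disc_geodesic_def)
  have up: "cayley_dist G A (edge_path c n s) (edge_path c n t) \<le> t - s"
    if st: "0 \<le> s" "s \<le> t" "t \<le> real n" for s t
  proof (cases "n = 0")
    case True
    then have "s = 0" "t = 0" using st by auto
    then show ?thesis using ints[of 0 0] by simp
  next
    case False
    obtain i where i: "i < n" "real i \<le> s" "s \<le> real i + 1"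
      using st False edge_path_cell[of s n] by auto
    obtain j where j: "j < n" "real j \<le> t" "t \<le> real j + 1"
      using st False edge_path_cell[of t n] by auto
    show ?thesis
    proof (cases "t \<le> real i + 1")
      case True
      then show ?thesis using cell[of i s t] i st by auto
    next
      case False
      then have "Suc i \<le> j" using j i by linarith
      have g: "edge_path c n s \<in> cayley_graph G A" "edge_path c n t \<in> cayley_graph G A"
        "edge_path c n (real (Suc i)) \<in> cayley_graph G A" "edge_path c n (real j) \<in> cayley_graph G A"
        using in_graph st i j by auto
      have "cayley_dist G A (edge_path c n s) (edge_path c n (real (Suc i))) \<le> real (Suc i) - s"
        using cell[of i s "real (Suc i)"] i by simp
      moreover have "cayley_dist G A (edge_path c n (real j)) (edge_path c n t) \<le> t - real j"
        using cell[of j "real j" t] j by simp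
      moreover have "cayley_dist G A (edge_path c n (real (Suc i))) (edge_path c n (real j)) = real j - real (Suc i)"
        using ints[OF \<open>Suc i \<le> j\<close>] j by simp
      ultimately show ?thesis
        using dist_tri[OF g(1,3,2)] dist_tri[OF g(3,4,2)] by linarith
    qed
  qed
  show ?thesis unfolding geodesic_def
  proof (intro conjI ballI)
    show "edge_path c n ` {0..real n} \<subseteq> cayley_graph G A" using in_graph by auto
    fix s t assume st: "s \<in> {0..real n}" "t \<in> {0..real n}"
    show "cayley_dist G A (edge_path c n s) (edge_path c n t) = \<bar>s - t\<bar>"
    proof (cases "s \<le> t")
      case True
      then show ?thesis using up[of s t] low[OF st] st by auto
    next
      case False
      then show ?thesis using up[of t s] low[OF st] st dist_sym[of "edge_path c n s"] by auto
    qed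
  qed simp
qed

text \<open>Slimness yields a point of the graph that is close to the given vertex; rounding it to a vertex of
  the same geodesic costs at most one.\<close>

lemma slim_from_graph:
  assumes "slim_triangles G A \<delta>"
  shows "\<exists>\<delta>'\<ge>0. slim \<delta>'"
proof -
  define \<delta>' where "\<delta>' = \<lceil>\<bar>\<delta>\<bar>\<rceil> + 1"
  have "slim \<delta>'"
    unfolding slim_def
  proof (intro ballI allI impI)
    fix x y z m assume V: "x \<in> carrier G" "y \<in> carrier G" "z \<in> carrier G" and m: "between x m y"
    have mV: "m \<in> carrier G" using m betweenD by auto
    define K L M where "K = nat (wd x y)" and "L = nat (wd y z)" and "M = nat (wd z x)"
    obtain p where p: "p 0 = x" "p (nat (wd x m)) = m" "p K = y" "nat (wd x m) \<le> K" "disc_geodesic p K"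
      using disc_geodesic_through[OF V(1,2) m] K_def by blast
    obtain q where q: "q 0 = y" "q L = z" "disc_geodesic q L"
      using disc_geodesic_ends[OF V(2,3)] L_def by blast
    obtain r where r: "r 0 = z" "r M = x" "disc_geodesic r M"
      using disc_geodesic_ends[OF V(3,1)] M_def by blast
    have ends: "edge_path p K (real K) = edge_path q L 0" "edge_path q L (real L) = edge_path r M 0"
      "edge_path r M (real M) = edge_path p K 0"
      using p q r edge_path_vertex[of 0] edge_path_vertex[of K K] edge_path_vertex[of L L] edge_path_vertex[of M M]
      by auto
    have "edge_path p K (real (nat (wd x m))) = vertex m" using edge_path_vertex[OF p(4)] p(2) by simp
    moreover have "real (nat (wd x m)) \<in> {0..real K}" using p(4) by simp
    ultimately have near: "(\<exists>t\<in>{0..real L}. cayley_dist G A (vertex m) (edge_path q L t) \<le> \<delta>) \<or>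
        (\<exists>t\<in>{0..real M}. cayley_dist G A (vertex m) (edge_path r M t) \<le> \<delta>)"
      using assms geodesic_edge_path[OF p(5)] geodesic_edge_path[OF q(3)] geodesic_edge_path[OF r(3)] ends
      unfolding slim_triangles_def by metis
    have round: "\<exists>i\<le>N. wd m (c i) \<le> \<delta>'"
      if c: "disc_geodesic c N" and t: "t \<in> {0..real N}" "cayley_dist G A (vertex m) (edge_path c N t) \<le> \<delta>"
      for c N t
    proof -
      have cV: "\<And>i. i \<le> N \<Longrightarrow> c i \<in> carrier G" using c by (simp add: disc_geodesic_def)
      have in_graph: "edge_path c N t \<in> cayley_graph G A"
        using geodesic_edge_path[OF c] t by (auto simp: geodesic_def)
      have "graph_ext (\<lambda>u. real_of_int (wd m u)) (edge_path c N t) \<le> \<delta>"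
        using ext_le_dist[OF vertex_in_graph[OF mV] in_graph lipschitz_wd[OF mV]] t(2) mV by simp
      moreover have "\<exists>i\<le>N. wd m (c i) - 1 \<le> graph_ext (\<lambda>u. real_of_int (wd m u)) (edge_path c N t)"
      proof (cases "N = 0")
        case True
        then have "t = 0" using t(1) by simp
        then show ?thesis using True by (intro exI[of _ 0]) (simp add: edge_path_def)
      next
        case False
        then obtain i where i: "i < N" "real i \<le> t" "t \<le> real i + 1"
          using t edge_path_cell[of t N] by auto
        have "\<bar>real_of_int (wd m (c i)) - real_of_int (wd m (c (Suc i)))\<bar> \<le> 1"
          using lipschitz_adj[OF lipschitz_wd[OF mV] disc_geodesic_adj[OF c i(1)]] by simp
        then have "real_of_int (wd m (c i)) - 1 \<le> graph_ext (\<lambda>u. real_of_int (wd m u)) (edge_path c N t)"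
          using ext_edge[OF lipschitz_wd[OF mV] disc_geodesic_adj[OF c i(1)], of "t - real i"] i
          unfolding edge_path_edge[OF i] by auto
        then show ?thesis using i by (intro exI[of _ i]) simp
      qed
      ultimately obtain i where "i \<le> N" "real_of_int (wd m (c i)) - 1 \<le> \<delta>" by force
      then show ?thesis unfolding \<delta>'_def by (intro exI[of _ i]) linarith
    qed
    from near show "\<exists>u. (between x u z \<or> between z u y) \<and> wd m u \<le> \<delta>'"
    proof (elim disjE bexE)
      fix t assume t: "t \<in> {0..real L}" "cayley_dist G A (vertex m) (edge_path q L t) \<le> \<delta>"
      obtain i where i: "i \<le> L" "wd m (q i) \<le> \<delta>'" using round[OF q(3) t] by blast
      have "between y (q i) z" using disc_geodesic_between[OF q(3) i(1)] q by simp
      then have "between z (q i) y"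
        using d_sym V betweenD(1) unfolding between_def by (metis add.commute)
      then show ?thesis using i by blast
    next
      fix t assume t: "t \<in> {0..real M}" "cayley_dist G A (vertex m) (edge_path r M t) \<le> \<delta>"
      obtain i where i: "i \<le> M" "wd m (r i) \<le> \<delta>'" using round[OF r(3) t] by blast
      have "between z (r i) x" using disc_geodesic_between[OF r(3) i(1)] r by simp
      then have "between x (r i) z"
        using d_sym V betweenD(1) unfolding between_def by (metis add.commute)
      then show ?thesis using i by blast
    qed
  qed
  then show ?thesis unfolding \<delta>'_def by (intro exI[of _ "\<lceil>\<bar>\<delta>\<bar>\<rceil> + 1"]) auto
qed

end


section \<open>Horofunctions in terms of the word metric\<close>

context cayley
begin

definition int_lipschitz :: "('a \<Rightarrow> int) \<Rightarrow> bool" where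
  "int_lipschitz h \<longleftrightarrow> (\<forall>u\<in>carrier G. \<forall>v\<in>carrier G. \<bar>h u - h v\<bar> \<le> wd u v)"

definition descending :: "('a \<Rightarrow> int) \<Rightarrow> bool" where
  "descending h \<longleftrightarrow> (\<forall>x\<in>carrier G. \<exists>y\<in>carrier G. wd x y = 1 \<and> h y = h x - 1)"

definition quasi_convex :: "int \<Rightarrow> ('a \<Rightarrow> int) \<Rightarrow> bool" where
  "quasi_convex \<epsilon> h \<longleftrightarrow> (\<forall>a\<in>carrier G. \<forall>b\<in>carrier G. \<forall>m. between a m b \<longrightarrow> h m \<le> max (h a) (h b) + \<epsilon>)"

text \<open>The four-point condition with one of the points at infinity, the function \<open>h\<close> measuring
  the distance to it.\<close>

definition four_point_fun :: "int \<Rightarrow> ('a \<Rightarrow> int) \<Rightarrow> bool" where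
  "four_point_fun E h \<longleftrightarrow> (\<forall>a\<in>carrier G. \<forall>b\<in>carrier G. \<forall>m\<in>carrier G.
     h m + wd a b \<le> max (h a + wd m b) (h b + wd m a) + E)"

text \<open>A point of the graph is reached from a vertex through one of the ends of its edge.  The strict
  bound on the remaining distance is what later excludes that this end is the starting vertex.\<close>

lemma near_end:
  assumes x: "x \<in> carrier G" and y: "y \<in> cayley_graph G A"
  shows "\<exists>u\<in>carrier G. \<exists>s::real. 0 \<le> s \<and> s < 1 \<and> pl_path G A (vertex u) y s
    \<and> wd x u + s \<le> cayley_dist G A (vertex x) y"
proof -
  have at_vertex: ?thesis if "y = vertex u" "u \<in> carrier G" for u
    using that dist_vertex[OF x that(2)] pl_path.const[OF vertex_in_graph[OF that(2)]]
    by (intro bexI[of _ u] exI[of _ 0]) auto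
  show ?thesis
  proof (cases "y \<in> vertex ` carrier G")
    case True
    then show ?thesis using at_vertex by blast
  next
    case False
    then obtain u v t where uv: "y = edge_point u v t" "cayley_adj G A u v" "t \<in> {0..1}"
      using y unfolding cayley_graph_def by blast
    have V: "u \<in> carrier G" "v \<in> carrier G" using uv by (auto simp: adj_iff)
    have "t \<noteq> 0" "t \<noteq> 1" using False uv V by auto
    then have t: "0 < t" "t < 1" using uv by auto
    have d: "min (wd x u + t) (wd x v + 1 - t) \<le> cayley_dist G A (vertex x) y"
      using ext_le_dist[OF vertex_in_graph[OF x] y lipschitz_wd[OF x]] ext_edge[OF lipschitz_wd[OF x] uv(2,3)]
        uv(1) x by simp
    show ?thesis
    proof (cases "wd x u + t \<le> wd x v + 1 - t")
      case True
      have "pl_path G A (vertex u) y t" using pl_path_edge[OF uv(2), of 0 t] uv by simp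
      then show ?thesis using True d V t by (intro bexI[of _ u] exI[of _ t]) auto
    next
      case False
      have "pl_path G A (vertex v) y (1 - t)" using pl_path_edge[OF uv(2), of 1 t] uv by simp
      then show ?thesis using False d V t by (intro bexI[of _ v] exI[of _ "1 - t"]) auto
    qed
  qed
qed

lemma distance_like_lipschitz:
  assumes F: "distance_like G A F" and xy: "x \<in> cayley_graph G A" "y \<in> cayley_graph G A"
  shows "\<bar>F x - F y\<bar> \<le> cayley_dist G A x y"
proof -
  have *: "F x - F y \<le> cayley_dist G A x y"
    if xy: "x \<in> cayley_graph G A" "y \<in> cayley_graph G A" "F y \<le> F x" for x y
  proof -
    have "F x = F y + (INF z\<in>{z \<in> cayley_graph G A. F z = F y}. cayley_dist G A x z)"
      using F xy unfolding distance_like_def by blast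
    moreover have "(INF z\<in>{z \<in> cayley_graph G A. F z = F y}. cayley_dist G A x z) \<le> cayley_dist G A x y"
      by (rule cINF_lower) (use xy dist_nonneg in \<open>auto intro!: bdd_belowI[of _ 0]\<close>)
    ultimately show ?thesis by linarith
  qed
  show ?thesis using *[of x y] *[of y x] xy dist_sym[of x y] dist_nonneg[OF xy] by linarith
qed

text \<open>The level one below a vertex is reached within distance one, up to an arbitrarily small error.  Integrality
  of the values on vertices turns this into an adjacent vertex on the lower level.\<close>

lemma horofunction_restriction:
  assumes F: "horofunction G A F" and h: "\<And>g. g \<in> carrier G \<Longrightarrow> F (vertex g) = of_int (h g)"
  shows "int_lipschitz h" "descending h" "\<exists>\<epsilon>\<ge>0. quasi_convex \<epsilon> h"
proof -
  have F': "distance_like G A F" using F by (simp add: horofunction_def)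
  obtain \<epsilon> where \<epsilon>: "\<epsilon> > 0" "eps_convex G A \<epsilon> F" using F by (auto simp: horofunction_def)
  show "int_lipschitz h"
    unfolding int_lipschitz_def
  proof (intro ballI)
    fix u v assume uv: "u \<in> carrier G" "v \<in> carrier G"
    have "\<bar>real_of_int (h u) - real_of_int (h v)\<bar> \<le> wd u v"
      using distance_like_lipschitz[OF F' vertex_in_graph[OF uv(1)] vertex_in_graph[OF uv(2)]]
        dist_vertex[OF uv] h uv by simp
    then show "\<bar>h u - h v\<bar> \<le> wd u v" by linarith
  qed
  show "descending h"
    unfolding descending_def
  proof
    fix x assume x: "x \<in> carrier G"
    define Y where "Y = {y \<in> cayley_graph G A. F y = F (vertex x) - 1}"
    have "F (vertex x) \<ge> F (vertex x) - 1" by simp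
    then have Y: "Y \<noteq> {}" "F (vertex x) = F (vertex x) - 1 + (INF y\<in>Y. cayley_dist G A (vertex x) y)"
      using F' vertex_in_graph[OF x] unfolding distance_like_def Y_def by blast+
    have "(INF y\<in>Y. cayley_dist G A (vertex x) y) < 3 / 2" using Y(2) by linarith
    then obtain y where y: "y \<in> Y" "cayley_dist G A (vertex x) y < 3 / 2"
      using cInf_lessD[of "cayley_dist G A (vertex x) ` Y" "3 / 2"] Y(1) by auto
    have yG: "y \<in> cayley_graph G A" "F y = h x - 1" using y h[OF x] by (auto simp: Y_def)
    obtain u and s :: real where u: "u \<in> carrier G" "s \<ge> 0" "s < 1" "pl_path G A (vertex u) y s"
      "wd x u + s \<le> cayley_dist G A (vertex x) y"
      using near_end[OF x yG(1)] by blast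
    have near: "\<bar>real_of_int (h u) - (h x - 1)\<bar> \<le> s"
      using distance_like_lipschitz[OF F' vertex_in_graph[OF u(1)] yG(1)] dist_le[OF u(4)] h[OF u(1)] yG(2)
      by linarith
    have "u \<noteq> x" using near u(3) by auto
    then have "wd x u \<noteq> 0" using d_eq_0[OF x u(1)] by auto
    moreover have "real_of_int (wd x u) < 3 / 2" using u y by linarith
    ultimately have w: "wd x u = 1" using d_nonneg[OF x u(1)] by linarith
    then have "s < 1 / 2" using u y by linarith
    then have "\<bar>real_of_int (h u - (h x - 1))\<bar> < 1 / 2" using near by simp
    then have "h u = h x - 1" by linarith
    then show "\<exists>y\<in>carrier G. wd x y = 1 \<and> h y = h x - 1" using w u(1) by blast
  qed
  show "\<exists>\<epsilon>\<ge>0. quasi_convex \<epsilon> h"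
  proof (intro exI[of _ "\<lceil>\<epsilon>\<rceil>"] conjI)
    show "0 \<le> \<lceil>\<epsilon>\<rceil>" using \<epsilon> by simp
    show "quasi_convex \<lceil>\<epsilon>\<rceil> h"
      unfolding quasi_convex_def
    proof (intro ballI allI impI)
      fix a b m assume ab: "a \<in> carrier G" "b \<in> carrier G" and m: "between a m b"
      have mV: "m \<in> carrier G" using m betweenD by auto
      define n k where "n = nat (wd a b)" and "k = nat (wd a m)"
      obtain c where c: "c 0 = a" "c k = m" "c n = b" "k \<le> n" "disc_geodesic c n"
        using disc_geodesic_through[OF ab m] n_def k_def by blast
      show "h m \<le> max (h a) (h b) + \<lceil>\<epsilon>\<rceil>"
      proof (cases "n = 0")
        case True
        then have "m = a" using c by auto
        then have "h m = h a" by simp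
        moreover have "0 \<le> \<lceil>\<epsilon>\<rceil>" using \<epsilon>(1) by simp
        ultimately show ?thesis by linarith
      next
        case False
        define t where "t = 1 - real k / real n"
        have t: "t \<in> {0..1}" "(1 - t) * real n = real k" using False c(4) by (auto simp: t_def field_simps)
        have "F (edge_path c n ((1 - t) * real n)) \<le> t * F (edge_path c n 0) + (1 - t) * F (edge_path c n (real n)) + \<epsilon>"
          using \<epsilon>(2) geodesic_edge_path[OF c(5)] t(1) unfolding eps_convex_def by blast
        moreover have "F (edge_path c n 0) = h a"
          using edge_path_vertex[of 0 n c] c(1) h[OF ab(1)] by simp
        moreover have "F (edge_path c n (real n)) = h b"
          using edge_path_vertex[of n n c] c(3) h[OF ab(2)] by simp
        moreover have "F (edge_path c n ((1 - t) * real n)) = h m"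
          using edge_path_vertex[OF c(4), of c] c(2) h[OF mV] unfolding t(2) by simp
        ultimately have "real_of_int (h m) \<le> t * real_of_int (h a) + (1 - t) * real_of_int (h b) + \<epsilon>"
          by simp
        also have "t * real_of_int (h a) + (1 - t) * real_of_int (h b)
            \<le> t * real_of_int (max (h a) (h b)) + (1 - t) * real_of_int (max (h a) (h b))"
          using t(1) by (intro add_mono mult_left_mono) simp_all
        also have "\<dots> = real_of_int (max (h a) (h b))" by (simp add: algebra_simps)
        finally have "real_of_int (h m) \<le> real_of_int (max (h a) (h b)) + \<epsilon>" by simp
        then show ?thesis by linarith
      qed
    qed
  qed
qed

lemma lipschitz_of_int: "int_lipschitz h \<Longrightarrow> lipschitz (\<lambda>u. real_of_int (h u))"
  unfolding int_lipschitz_def lipschitz_def by (metis of_int_abs of_int_diff of_int_le_iff)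

text \<open>Descending edge by edge from any point of the graph, the extended function decreases at unit speed, which is
  all that being distance-like requires of a 1-Lipschitz function.  Convexity up to a constant
  follows from the four-point condition at vertices near the three points.\<close>

lemma horo_if_descending:
  assumes lip: "int_lipschitz h" and desc: "descending h" and fp: "four_point_fun E h" and E: "0 \<le> E"
  shows "horofunction G A (graph_ext (\<lambda>u. real_of_int (h u)))"
proof -
  define F where "F = graph_ext (\<lambda>u. real_of_int (h u))"
  have L: "lipschitz (\<lambda>u. real_of_int (h u))" using lip by (rule lipschitz_of_int)
  have Fv: "F (vertex u) = h u" for u by (simp add: F_def)
  have Fe: "F (edge_point u v t) = min (h u + t) (h v + 1 - t)"
    if "cayley_adj G A u v" "t \<in> {0..1}" for u v and t :: real
    using ext_edge[OF L that] by (simp add: F_def)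
  have Flip: "\<bar>F x - F y\<bar> \<le> cayley_dist G A x y"
    if "x \<in> cayley_graph G A" "y \<in> cayley_graph G A" for x y
    using ext_le_dist[OF that L] by (simp add: F_def)
  define down where "down x r \<longleftrightarrow> (\<exists>y. pl_path G A x y r \<and> F y = F x - r)" for x r
  have down_trans: "down x (r + r')" if xy: "pl_path G A x y r" "F y = F x - r" and y: "down y r'"
    for x y r r'
  proof -
    obtain z where z: "pl_path G A y z r'" "F z = F y - r'" using y by (auto simp: down_def)
    have "pl_path G A x z (r + r')" by (rule pl_path_trans[OF z(1) xy(1)])
    then show ?thesis using z xy(2) unfolding down_def by force
  qed
  have down_vertex: "down (vertex u) r" if "u \<in> carrier G" "0 \<le> r" "r \<le> real n" for u r n
    using that
  proof (induction n arbitrary: u r)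
    case 0
    then show ?case using pl_path.const[OF vertex_in_graph[OF 0(1)]] by (auto simp: down_def)
  next
    case (Suc n)
    obtain v where v: "v \<in> carrier G" "wd u v = 1" "h v = h u - 1"
      using desc Suc.prems(1) unfolding descending_def by blast
    have adj: "cayley_adj G A u v" using v Suc.prems by (simp add: adj_iff)
    show ?case
    proof (cases "r \<le> 1")
      case True
      have "pl_path G A (vertex u) (edge_point u v r) r"
        using pl_path_edge[OF adj, of 0 r] Suc.prems True by simp
      moreover have "F (edge_point u v r) = F (vertex u) - r"
        using Fe[OF adj, of r] v Suc.prems True by (simp add: Fv)
      ultimately show ?thesis unfolding down_def by blast
    next
      case False
      have "down (vertex v) (r - 1)" using Suc.IH[OF v(1), of "r - 1"] Suc.prems False by simp
      moreover have "F (vertex v) = F (vertex u) - 1" using v by (simp add: Fv)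
      ultimately have "down (vertex u) (1 + (r - 1))" by (intro down_trans[OF adj_path[OF adj]])
      then show ?thesis by simp
    qed
  qed
  have down_v: "down (vertex u) r" if "u \<in> carrier G" "0 \<le> r" for u r
    using down_vertex[of u r "nat \<lceil>r\<rceil>"] that by linarith
  have down_edge: "down (edge_point u v t) r"
    if adj: "cayley_adj G A u v" and t: "t \<in> {0..1}" and le: "h u + t \<le> h v + 1 - t" and r: "0 \<le> r"
    for u v and t r :: real
  proof (cases "r \<le> t")
    case True
    have "pl_path G A (edge_point u v t) (edge_point u v (t - r)) r"
      using pl_path_edge[OF adj t, of "t - r"] r t True by simp
    moreover have "F (edge_point u v (t - r)) = F (edge_point u v t) - r"
      using Fe[OF adj t] Fe[OF adj, of "t - r"] r t True le by simp
    ultimately show ?thesis unfolding down_def by blast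
  next
    case False
    have "pl_path G A (edge_point u v t) (vertex u) t" using pl_path_edge[OF adj t, of 0] t by simp
    moreover have "F (vertex u) = F (edge_point u v t) - t" using Fe[OF adj t] le by (simp add: Fv)
    ultimately have "down (edge_point u v t) (t + (r - t))"
      using False adj by (intro down_trans) (auto intro: down_v simp: adj_iff)
    then show ?thesis by simp
  qed
  have down: "down x r" if x: "x \<in> cayley_graph G A" and r: "0 \<le> r" for x r
    using x unfolding cayley_graph_def
  proof (elim UnE imageE)
    fix u assume "x = vertex u" "u \<in> carrier G"
    then show ?thesis using down_v r by simp
  next
    assume "x \<in> {edge_point u v t | u v t. cayley_adj G A u v \<and> t \<in> {0..1}}"
    then obtain u v t where uv: "x = edge_point u v t" "cayley_adj G A u v" "t \<in> {0..1}" by blast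
    show ?thesis
    proof (cases "h u + t \<le> h v + 1 - t")
      case True
      then show ?thesis using down_edge[OF uv(2,3) _ r] uv(1) by simp
    next
      case False
      have "cayley_adj G A v u" using uv(2) d_sym by (auto simp: adj_iff)
      moreover have "1 - t \<in> {0..1}" using uv(3) by auto
      ultimately have "down (edge_point v u (1 - t)) r" using False r by (intro down_edge) auto
      then show ?thesis using uv(1) edge_point_swap[of u v t] by simp
    qed
  qed
  have "distance_like G A F"
    unfolding distance_like_def
  proof (intro ballI allI impI conjI)
    fix x l assume x: "x \<in> cayley_graph G A" and l: "l \<le> F x"
    define Y where "Y = {y \<in> cayley_graph G A. F y = l}"
    obtain y where y: "pl_path G A x y (F x - l)" "F y = F x - (F x - l)"
      using down[OF x, of "F x - l"] l unfolding down_def by auto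
    then have yY: "y \<in> Y" using pl_path_in_graph(2)[OF y(1)] by (simp add: Y_def)
    then show "{y \<in> cayley_graph G A. F y = l} \<noteq> {}" unfolding Y_def by blast
    have "(INF y\<in>Y. cayley_dist G A x y) \<le> cayley_dist G A x y"
      by (rule cINF_lower[OF _ yY]) (use x dist_nonneg in \<open>auto intro!: bdd_belowI[of _ 0] simp: Y_def\<close>)
    also have "\<dots> \<le> F x - l" by (rule dist_le[OF y(1)])
    finally have 1: "(INF y\<in>Y. cayley_dist G A x y) \<le> F x - l" .
    have 2: "F x - l \<le> (INF y\<in>Y. cayley_dist G A x y)"
    proof (rule cINF_greatest)
      show "Y \<noteq> {}" using yY by blast
      fix z assume "z \<in> Y"
      then show "F x - l \<le> cayley_dist G A x z" using Flip[OF x, of z] by (auto simp: Y_def)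
    qed
    from 1 2 show "F x = l + (INF y\<in>{y \<in> cayley_graph G A. F y = l}. cayley_dist G A x y)"
      unfolding Y_def by linarith
  qed
  moreover have "eps_convex G A (real_of_int E + 6) F"
    unfolding eps_convex_def
  proof (intro allI impI ballI)
    fix c L and t :: real assume geo: "geodesic G A c L" and t: "t \<in> {0..1}"
    define s where "s = (1 - t) * L"
    have L0: "0 \<le> L" using geo by (simp add: geodesic_def)
    have "s \<le> 1 * L" unfolding s_def using t L0 by (intro mult_right_mono) auto
    then have s: "0 \<le> s" "s \<le> L" using t L0 by (auto simp: s_def)
    have V: "c 0 \<in> cayley_graph G A" "c L \<in> cayley_graph G A" "c s \<in> cayley_graph G A"
      using geo s L0 by (auto simp: geodesic_def)
    have ds: "cayley_dist G A (c 0) (c L) = L" "cayley_dist G A (c s) (c L) = L - s"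
      "cayley_dist G A (c s) (c 0) = s"
      using geo s L0 by (auto simp: geodesic_def)
    have near: "\<exists>u\<in>carrier G. cayley_dist G A (vertex u) x \<le> 1" if x: "x \<in> cayley_graph G A" for x
    proof -
      obtain u l where "u \<in> carrier G" "l \<le> 1" "pl_path G A (vertex u) x l" using near_vertex[OF x] by blast
      then show ?thesis using dist_le[of "vertex u" x l] by force
    qed
    obtain a b m where abm: "a \<in> carrier G" "b \<in> carrier G" "m \<in> carrier G"
      and d1: "cayley_dist G A (vertex a) (c 0) \<le> 1" "cayley_dist G A (vertex b) (c L) \<le> 1"
        "cayley_dist G A (vertex m) (c s) \<le> 1"
      using near[OF V(1)] near[OF V(2)] near[OF V(3)] by blast
    note vg = vertex_in_graph[OF abm(1)] vertex_in_graph[OF abm(2)] vertex_in_graph[OF abm(3)]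
    have "\<bar>h a - F (c 0)\<bar> \<le> 1" "\<bar>h b - F (c L)\<bar> \<le> 1" "\<bar>h m - F (c s)\<bar> \<le> 1"
      using Flip[OF vg(1) V(1)] Flip[OF vg(2) V(2)] Flip[OF vg(3) V(3)] d1 by (simp_all add: Fv)
    moreover have "L - 2 \<le> wd a b"
      using dist_tri[OF V(1) vg(1) V(2)] dist_tri[OF vg(1) vg(2) V(2)] dist_sym[of "c 0" "vertex a"] d1 ds
        dist_vertex[OF abm(1,2)] by linarith
    moreover have "wd m b \<le> L - s + 2"
      using dist_tri[OF vg(3) V(3) vg(2)] dist_tri[OF V(3) V(2) vg(2)] dist_sym[of "c L" "vertex b"] d1 ds
        dist_vertex[OF abm(3,2)] by linarith
    moreover have "wd m a \<le> s + 2"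
      using dist_tri[OF vg(3) V(3) vg(1)] dist_tri[OF V(3) V(1) vg(1)] dist_sym[of "c 0" "vertex a"] d1 ds
        dist_vertex[OF abm(3,1)] by linarith
    moreover have "h m + wd a b \<le> h a + wd m b + E \<or> h m + wd a b \<le> h b + wd m a + E"
    proof -
      have "h m + wd a b \<le> max (h a + wd m b) (h b + wd m a) + E"
        using fp abm unfolding four_point_fun_def by blast
      then show ?thesis by linarith
    qed
    ultimately have "F (c s) \<le> max (F (c 0) - s) (F (c L) - (L - s)) + (E + 6)"
      by linarith
    moreover have Fd: "\<bar>F (c 0) - F (c L)\<bar> \<le> L" using Flip[OF V(1,2)] ds by simp
    have "(1 - t) * (F (c 0) - F (c L)) \<le> (1 - t) * L" using Fd t by (intro mult_left_mono) auto
    then have "F (c 0) - s \<le> t * F (c 0) + (1 - t) * F (c L)" by (simp add: s_def algebra_simps)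
    moreover have "t * (F (c L) - F (c 0)) \<le> t * L" using Fd t by (intro mult_left_mono) auto
    then have "F (c L) - (L - s) \<le> t * F (c 0) + (1 - t) * F (c L)" by (simp add: s_def algebra_simps)
    ultimately show "F (c ((1 - t) * L)) \<le> t * F (c 0) + (1 - t) * F (c L) + (real_of_int E + 6)"
      unfolding s_def[symmetric] by linarith
  qed
  ultimately show ?thesis using E unfolding horofunction_def F_def
    by (intro conjI exI[of _ "real_of_int E + 6"]) auto
qed

definition gradient_ray :: "('a \<Rightarrow> int) \<Rightarrow> (nat \<Rightarrow> 'a) \<Rightarrow> bool" where
  "gradient_ray h r \<longleftrightarrow> (\<forall>i. r i \<in> carrier G \<and> h (r i) = h (r 0) - int i
     \<and> (\<forall>j. wd (r i) (r j) = \<bar>int i - int j\<bar>))"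

text \<open>Steps to a lower neighbour cannot lead back, because the function is 1-Lipschitz: \<open>n\<close> of them change the value
  by \<open>n\<close> and therefore cover the distance \<open>n\<close>.\<close>

lemma gradient_ray_exists:
  assumes "int_lipschitz h" "descending h" "x \<in> carrier G"
  shows "\<exists>r. r 0 = x \<and> gradient_ray h r"
proof -
  obtain r where r: "r 0 = x" "\<And>i. r i \<in> carrier G" "\<And>i. wd (r i) (r (Suc i)) = 1"
    "\<And>i. h (r (Suc i)) = h (r i) - 1"
  proof -
    have "\<exists>r. \<forall>i. (r i \<in> carrier G \<and> (i = 0 \<longrightarrow> r i = x)) \<and> (wd (r i) (r (Suc i)) = 1 \<and> h (r (Suc i)) = h (r i) - 1)"
      by (rule dependent_nat_choice[where P="\<lambda>i y. y \<in> carrier G \<and> (i = 0 \<longrightarrow> y = x)"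
            and Q="\<lambda>_ y z. wd y z = 1 \<and> h z = h y - 1"])
        (use assms(2,3) in \<open>unfold descending_def, blast+\<close>)
    then show ?thesis using that by blast
  qed
  have hr: "h (r i) = h x - int i" for i
    using r(1,4) by (induction i) auto
  have up: "wd (r i) (r j) \<le> int j - int i" if "i \<le> j" for i j
    using path_length[of j r 1 i j] r that by simp
  have low: "\<bar>int i - int j\<bar> \<le> wd (r i) (r j)" for i j
  proof -
    have "\<bar>h (r i) - h (r j)\<bar> \<le> wd (r i) (r j)"
      using assms(1) r(2) unfolding int_lipschitz_def by blast
    then show ?thesis by (simp add: hr abs_minus_commute)
  qed
  have "wd (r i) (r j) = \<bar>int i - int j\<bar>" for i j
  proof (cases "i \<le> j")
    case True
    then show ?thesis using up[of i j] low[of i j] by linarith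
  next
    case False
    then have "wd (r j) (r i) \<le> int i - int j" using up[of j i] by simp
    then show ?thesis using False low[of i j] d_sym[OF r(2) r(2), of i j] by linarith
  qed
  then show ?thesis using r(1,2) hr unfolding gradient_ray_def
    by (intro exI[of _ r]) simp
qed

lemma gradient_rayD:
  assumes "gradient_ray h r"
  shows "r i \<in> carrier G" "h (r i) = h (r 0) - int i" "wd (r i) (r j) = \<bar>int i - int j\<bar>"
  using assms unfolding gradient_ray_def by blast+

lemma int_lipschitzD:
  assumes "int_lipschitz h" "u \<in> carrier G" "v \<in> carrier G"
  shows "h u - h v \<le> wd u v" "h v - h u \<le> wd u v"
proof -
  have "\<bar>h u - h v\<bar> \<le> wd u v" using assms unfolding int_lipschitz_def by blast
  then show "h u - h v \<le> wd u v" "h v - h u \<le> wd u v" by linarith+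
qed

end

locale hyperbolic_cayley = cayley +
  fixes D :: int
  assumes D: "four_point D" "0 \<le> D"
begin

lemmas four_pt = four_pointD[OF D(1)]

text \<open>Quasi-convexity bounds the distance between points at the same height of two gradient rays, by a
  constant that depends on the convexity and on the starting points.  With this bound the four-point condition
  gives an estimate whose error only depends on the group.\<close>

lemma distance_to_gradient_ray:
  assumes lip: "int_lipschitz h" and desc: "descending h" and qc: "quasi_convex \<epsilon> h" "0 \<le> \<epsilon>"
    and r: "gradient_ray h r" and y: "y \<in> carrier G"
  shows "\<exists>N. \<forall>n\<ge>N. wd y (r n) \<le> h y - h (r n) + D"
proof -
  obtain q where q: "q 0 = y" "gradient_ray h q" using gradient_ray_exists[OF lip desc y] by blast
  note r' = gradient_rayD[OF r] and q' = gradient_rayD[OF q(2)]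
  define e where "e = r 0"
  have e: "e \<in> carrier G" using r' by (simp add: e_def)
  define \<kappa> where "\<kappa> = h y - h e"
  define C where "C = 2 * \<epsilon> + 2 * D + 2 * wd e y + 2 * \<bar>\<kappa>\<bar> + 4"
  show ?thesis
  proof (intro exI[of _ "nat (wd e y + C + 2 * \<bar>\<kappa>\<bar>)"] allI impI)
    fix n assume n: "nat (wd e y + C + 2 * \<bar>\<kappa>\<bar>) \<le> n"
    have ey: "0 \<le> wd e y" "wd y e = wd e y" using d_nonneg d_sym e y by auto
    have C0: "0 \<le> C" using ey qc(2) D(2) by (simp add: C_def)
    have nk: "wd e y + C + 2 * \<bar>\<kappa>\<bar> \<le> int n" using n by linarith
    then have nk': "0 \<le> int n + \<kappa>" using ey C0 by linarith
    define p where "p = r n"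
    define z where "z = q (nat (int n + \<kappa>))"
    have pz: "p \<in> carrier G" "z \<in> carrier G" using r' q' by (auto simp: p_def z_def)
    have hp: "h p = h e - int n" unfolding p_def e_def by (rule r'(2))
    have hz: "h z = h e - int n" using q'(2)[of "nat (int n + \<kappa>)"] q(1) nk' by (simp add: z_def \<kappa>_def)
    have dp: "wd e p = int n" using r'(3)[of 0 n] by (simp add: e_def p_def)
    have dz: "wd y z = int n + \<kappa>" using q'(3)[of 0 "nat (int n + \<kappa>)"] q(1) nk' by (simp add: z_def)
    define l where "l = wd p z"
    have l0: "0 \<le> l" using d_nonneg pz by (simp add: l_def)
    obtain k where k: "2 * k \<le> l" "l \<le> 2 * k + 1" "0 \<le> k" "k \<le> l"
    proof
      show "2 * (l div 2) \<le> l" "l \<le> 2 * (l div 2) + 1" "0 \<le> l div 2" "l div 2 \<le> l"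
        using l0 by presburger+
    qed
    obtain m where m: "m \<in> carrier G" "wd p m = k" "wd m z = l - k"
      using d_interp[OF pz k(3)] k(4) unfolding l_def by blast
    have "between p m z" using m by (simp add: between_def l_def)
    then have "h m \<le> max (h p) (h z) + \<epsilon>" using qc(1) pz unfolding quasi_convex_def by blast
    then have em: "int n - \<epsilon> \<le> wd e m" using int_lipschitzD(1)[OF lip e m(1)] hp hz by linarith
    have ez: "wd e z \<le> wd e y + (int n + \<kappa>)" using d_tri[OF e y pz(2)] dz by linarith
    have mp: "wd m p = k" using d_sym[OF m(1) pz(1)] m(2) by simp
    have "wd e m + l \<le> int n + (l - k) + D \<or> wd e m + l \<le> wd e z + k + D"
      using four_pt[OF e m(1) pz] unfolding l_def[symmetric] dp mp m(3) by simp
    then have "k \<le> \<epsilon> + D \<or> l - k \<le> \<epsilon> + D + wd e y + \<kappa>" using em ez by linarith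
    then have lC: "l \<le> C"
    proof
      assume "k \<le> \<epsilon> + D"
      then have "l \<le> 2 * \<epsilon> + 2 * D + 1" using k by linarith
      then show ?thesis using ey unfolding C_def by linarith
    next
      assume "l - k \<le> \<epsilon> + D + wd e y + \<kappa>"
      then have "l \<le> 2 * \<epsilon> + 2 * D + 2 * wd e y + 2 * \<kappa>" using k by linarith
      then show ?thesis unfolding C_def by linarith
    qed
    have "wd y p + wd e z \<le> wd y e + wd p z + D \<or> wd y p + wd e z \<le> wd y z + wd p e + D"
      by (rule four_pt) (use e y pz in auto)
    moreover have "wd p e = wd e p" using e pz by (auto intro: d_sym)
    moreover have "int n \<le> wd e z" using int_lipschitzD(1)[OF lip e pz(2)] hz by linarith
    ultimately have "wd y p \<le> int n + \<kappa> + D"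
      using dp dz lC ey nk unfolding l_def by linarith
    then show "wd y (r n) \<le> h y - h (r n) + D" using hp by (simp add: p_def \<kappa>_def)
  qed
qed

text \<open>Far down a gradient ray the function is, up to the constant \<open>D\<close>, a distance function, and the four-point
  condition for the metric applies.  In this way the unspecified constant of convexity becomes a
  uniform one.\<close>

lemma quasi_convex_imp_four_point:
  assumes lip: "int_lipschitz h" and desc: "descending h" and qc: "quasi_convex \<epsilon> h" "0 \<le> \<epsilon>"
  shows "four_point_fun (2 * D) h"
  unfolding four_point_fun_def
proof (intro ballI)
  fix a b m assume abm: "a \<in> carrier G" "b \<in> carrier G" "m \<in> carrier G"
  obtain r where r: "gradient_ray h r" using gradient_ray_exists[OF lip desc one_closed] by blast
  obtain N1 N2 where N: "\<forall>n\<ge>N1. wd a (r n) \<le> h a - h (r n) + D" "\<forall>n\<ge>N2. wd b (r n) \<le> h b - h (r n) + D"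
    using distance_to_gradient_ray[OF lip desc qc r] abm by meson
  define p where "p = r (max N1 N2)"
  have p: "p \<in> carrier G" "wd a p \<le> h a - h p + D" "wd b p \<le> h b - h p + D"
    using N gradient_rayD(1)[OF r] by (auto simp: p_def)
  have "wd m p + wd a b \<le> wd m a + wd p b + D \<or> wd m p + wd a b \<le> wd m b + wd p a + D"
    by (rule four_pt) (use abm p in auto)
  moreover have "wd p a = wd a p" "wd p b = wd b p" using abm p(1) by (auto intro: d_sym)
  moreover have "h m - h p \<le> wd m p" using int_lipschitzD[OF lip abm(3) p(1)] by simp
  ultimately show "h m + wd a b \<le> max (h a + wd m b) (h b + wd m a) + 2 * D"
    using p by linarith
qed

text \<open>The conditions on the right concern finitely many values at a time, and their constant is
  uniform.  So they define a closed set of functions that is invariant under translations.\<close>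

lemma horo_iff:
  "h \<in> horo G A \<longleftrightarrow> h \<in> extensional (carrier G) \<and> int_lipschitz h \<and> descending h \<and> four_point_fun (2 * D) h"
proof
  assume h: "h \<in> horo G A"
  then have "h \<in> extensional (carrier G) \<and>
      (\<exists>F. horofunction G A F \<and> (\<forall>g\<in>carrier G. F (vertex g) = of_int (h g)))"
    by (simp add: horo_def)
  then obtain F where F: "h \<in> extensional (carrier G)" "horofunction G A F"
    "\<And>g. g \<in> carrier G \<Longrightarrow> F (vertex g) = of_int (h g)"
    by blast
  obtain \<epsilon> where "0 \<le> \<epsilon>" "quasi_convex \<epsilon> h" using horofunction_restriction(3)[OF F(2,3)] by blast
  then show "h \<in> extensional (carrier G) \<and> int_lipschitz h \<and> descending h \<and> four_point_fun (2 * D) h"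
    using F(1) horofunction_restriction[OF F(2,3)] quasi_convex_imp_four_point by blast
next
  assume h: "h \<in> extensional (carrier G) \<and> int_lipschitz h \<and> descending h \<and> four_point_fun (2 * D) h"
  then have "horofunction G A (graph_ext (\<lambda>u. real_of_int (h u)))"
    using D(2) horo_if_descending[of h "2 * D"] by simp
  moreover have "\<forall>g\<in>carrier G. graph_ext (\<lambda>u. real_of_int (h u)) (vertex g) = of_int (h g)" by simp
  ultimately show "h \<in> horo G A" using h unfolding horo_def by blast
qed

lemma horo_distance_to_gradient_ray:
  assumes h: "h \<in> horo G A" and r: "gradient_ray h r" and y: "y \<in> carrier G"
  shows "\<exists>N. \<forall>n\<ge>N. wd y (r n) \<le> h y - h (r n) + D"
proof -
  have hh: "int_lipschitz h" "descending h" "four_point_fun (2 * D) h" using h by (auto simp: horo_iff)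
  have "quasi_convex (2 * D) h"
    unfolding quasi_convex_def
  proof (intro ballI allI impI)
    fix a b m assume ab: "a \<in> carrier G" "b \<in> carrier G" and m: "between a m b"
    have mV: "m \<in> carrier G" using m betweenD by auto
    have "h m + wd a b \<le> max (h a + wd m b) (h b + wd m a) + 2 * D"
      using hh(3) ab mV unfolding four_point_fun_def by blast
    moreover have "wd m b \<le> wd a b" "wd m a \<le> wd a b"
      using m d_sym[OF mV ab(1)] d_nonneg[OF mV ab(2)] d_nonneg[OF ab(1) mV] by (auto simp: between_def)
    ultimately show "h m \<le> max (h a) (h b) + 2 * D" by linarith
  qed
  then show ?thesis using distance_to_gradient_ray[OF hh(1,2) _ _ r y] D(2) by simp
qed

end


section \<open>Horofunctions and the geometry of spheres\<close>

context cayley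
begin

definition ball_at :: "'a \<Rightarrow> int \<Rightarrow> 'a set" where
  "ball_at x r = {y \<in> carrier G. wd x y \<le> r}"

definition sphere_one :: "nat \<Rightarrow> 'a set" where
  "sphere_one n = {y \<in> carrier G. wd \<one> y = int n}"

lemma finite_ball_at: "x \<in> carrier G \<Longrightarrow> finite (ball_at x r)"
  unfolding ball_at_def by (rule finite_ball)

lemma finite_sphere_one: "finite (sphere_one n)"
  by (rule finite_subset[of _ "ball_at \<one> (int n)"])
    (auto simp: sphere_one_def ball_at_def intro: finite_ball)

lemma ball_at_translate:
  assumes "x \<in> carrier G"
  shows "ball_at x r = (\<lambda>y. x \<otimes> y) ` ball_at \<one> r"
proof -
  have "y \<in> (\<lambda>y. x \<otimes> y) ` ball_at \<one> r" if "y \<in> carrier G" "wd x y \<le> r" for y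
  proof (rule image_eqI[of _ _ "inv x \<otimes> y"])
    show "y = x \<otimes> (inv x \<otimes> y)" using mult_inv_cancel(2)[OF assms that(1,1)] by simp
    show "inv x \<otimes> y \<in> ball_at \<one> r"
      using wd_left[of x \<one> "inv x \<otimes> y"] assms that mult_inv_cancel(2)[OF assms that(1,1)]
      by (simp add: ball_at_def)
  qed
  moreover have "x \<otimes> y \<in> carrier G \<and> wd x (x \<otimes> y) \<le> r" if "y \<in> carrier G" "wd \<one> y \<le> r" for y
    using wd_left[of x \<one> y] assms that by simp
  ultimately show ?thesis unfolding ball_at_def by blast
qed

lemma card_ball_at: "x \<in> carrier G \<Longrightarrow> card (ball_at x r) = card (ball_at \<one> r)"
  unfolding ball_at_translate[of x] by (rule card_image) (auto simp: inj_on_def ball_at_def)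

lemma wd_one_mult: "u \<in> carrier G \<Longrightarrow> v \<in> carrier G \<Longrightarrow> wd \<one> (u \<otimes> v) \<le> wd \<one> u + wd \<one> v"
  using d_tri[of \<one> u "u \<otimes> v"] wd_left[of u \<one> v] by simp

lemma wd_one_inv: "u \<in> carrier G \<Longrightarrow> wd \<one> (inv u) = wd \<one> u"
  by (simp add: wd_def word_len_inv)

text \<open>Otherwise the sizes along an arithmetic progression of radii would halve forever.\<close>

lemma sphere_sizes_recur: "\<exists>n\<ge>m. card (sphere_one n) \<le> 2 * card (sphere_one (n + j))"
proof (rule ccontr)
  assume neg: "\<not> ?thesis"
  define a where "a i = card (sphere_one (m + i * j))" for i
  have dec: "a (Suc i) < a i" for i
  proof -
    have "\<not> card (sphere_one (m + i * j)) \<le> 2 * card (sphere_one (m + i * j + j))"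
      using neg by (metis le_add1)
    then show ?thesis by (simp add: a_def algebra_simps)
  qed
  have "a i + i \<le> a 0" for i
  proof (induction i)
    case (Suc i)
    then show ?case using dec[of i] by simp
  qed simp
  from this[of "Suc (a 0)"] show False by simp
qed

end

context hyperbolic_cayley
begin

lemma horoD:
  assumes "h \<in> horo G A"
  shows "int_lipschitz h" "descending h" "four_point_fun (2 * D) h" "h \<in> extensional (carrier G)"
  using assms by (simp_all add: horo_iff)

lemma horo_ray:
  assumes "h \<in> horo G A" "x \<in> carrier G"
  shows "\<exists>r. r 0 = x \<and> gradient_ray h r"
  using gradient_ray_exists horoD[OF assms(1)] assms(2) by blast

lemma horo_lip:
  assumes "h \<in> horo G A" "u \<in> carrier G" "v \<in> carrier G"
  shows "h u \<le> h v + wd u v"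
  using int_lipschitzD(1)[OF horoD(1)[OF assms(1)] assms(2,3)] by simp

lemma far_point_on_ray:
  assumes h: "h \<in> horo G A" and r: "gradient_ray h r" and Z: "finite Z" "Z \<subseteq> carrier G"
  shows "\<exists>n\<ge>m. \<forall>z\<in>Z. wd z (r n) \<le> h z - h (r n) + D"
proof -
  have "\<forall>z\<in>Z. eventually (\<lambda>n. wd z (r n) \<le> h z - h (r n) + D) sequentially"
    using horo_distance_to_gradient_ray[OF h r] Z(2) unfolding eventually_sequentially by blast
  then have "eventually (\<lambda>n. \<forall>z\<in>Z. wd z (r n) \<le> h z - h (r n) + D) sequentially"
    using Z(1) by (simp add: eventually_ball_finite)
  then obtain N where N: "\<And>n. N \<le> n \<Longrightarrow> \<forall>z\<in>Z. wd z (r n) \<le> h z - h (r n) + D"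
    unfolding eventually_sequentially by blast
  show ?thesis using N[of "max N m"] by (intro exI[of _ "max N m"]) simp
qed

text \<open>Such a point \<open>v\<close> lies nearly on a geodesic from the identity to a far point of the ray, at
  about the same distance from the identity as \<open>r n\<close>.\<close>

lemma deep_points_near_ray:
  assumes h: "h \<in> horo G A" and r: "gradient_ray h r" "r 0 = \<one>" and h1: "h \<one> = 0" and "0 \<le> K"
    and v: "v \<in> carrier G" "h v = - int n" "wd \<one> v \<le> int n + K"
  shows "wd (r n) v \<le> K + 2 * D"
proof -
  obtain N where N: "N \<ge> n" "wd v (r N) \<le> h v - h (r N) + D"
    using far_point_on_ray[OF h r(1), of "{v}" n] v by auto
  note r' = gradient_rayD[OF r(1)]
  have "h (r N) = - int N" using r'(2)[of N] r(2) h1 by simp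
  moreover have "wd \<one> (r N) = int N" "wd \<one> (r n) = int n" "wd (r n) (r N) = int N - int n"
    using r'(3)[of 0 N] r'(3)[of 0 n] r'(3)[of n N] r(2) N(1) by auto
  moreover have "wd v (r n) + wd \<one> (r N) \<le> wd v \<one> + wd (r n) (r N) + D
      \<or> wd v (r n) + wd \<one> (r N) \<le> wd v (r N) + wd (r n) \<one> + D"
    using four_pt[of v "r n" \<one> "r N"] v(1) r'(1) by simp
  moreover have "wd v \<one> = wd \<one> v" "wd (r n) \<one> = wd \<one> (r n)" "wd v (r n) = wd (r n) v"
    using d_sym v(1) r'(1) one_closed by blast+
  ultimately show ?thesis using N v \<open>0 \<le> K\<close> D(2) by linarith
qed

lemma card_deep_points:
  assumes h: "h \<in> horo G A" "h \<one> = 0" and "0 \<le> K"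
  shows "card {v \<in> carrier G. h v = - int n \<and> wd \<one> v \<le> int n + K} \<le> card (ball_at \<one> (K + 2 * D))"
proof -
  obtain r where r: "r 0 = \<one>" "gradient_ray h r" using horo_ray[OF h(1) one_closed] by blast
  have rn: "r n \<in> carrier G" using gradient_rayD(1)[OF r(2)] .
  have "{v \<in> carrier G. h v = - int n \<and> wd \<one> v \<le> int n + K} \<subseteq> ball_at (r n) (K + 2 * D)"
    using deep_points_near_ray[OF h(1) r(2,1) h(2) \<open>0 \<le> K\<close>] by (auto simp: ball_at_def)
  then have "card {v \<in> carrier G. h v = - int n \<and> wd \<one> v \<le> int n + K} \<le> card (ball_at (r n) (K + 2 * D))"
    by (intro card_mono finite_ball_at rn)
  then show ?thesis using card_ball_at[OF rn] by simp
qed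

text \<open>The gradient ray from \<open>y\<close> reaches the level of \<open>x\<close> in a point \<open>z\<close>.  All gradient rays
  of a horofunction come close to each other, and \<open>x\<close> is at least as far from the identity as \<open>y\<close>; so \<open>z\<close> is
  near \<open>x\<close>.\<close>

lemma value_from_deep_point:
  assumes h: "h \<in> horo G A" and h1: "h \<one> = 0"
    and x: "x \<in> carrier G" "wd \<one> x = int n" "h x = - int n"
    and y: "y \<in> carrier G" "wd \<one> y \<le> int n"
  shows "\<exists>z\<in>ball_at x (4 * D). h y = h z + wd y z"
proof -
  obtain r where r: "r 0 = \<one>" "gradient_ray h r" using horo_ray[OF h one_closed] by blast
  obtain q where q: "q 0 = y" "gradient_ray h q" using horo_ray[OF h y(1)] by blast
  note r' = gradient_rayD[OF r(2)] and q' = gradient_rayD[OF q(2)]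
  have hy: "- wd \<one> y \<le> h y" using horo_lip[OF h one_closed y(1)] h1 by simp
  define k where "k = nat (h y + int n)"
  have k: "int k = h y + int n" using hy y(2) by (simp add: k_def)
  define z where "z = q k"
  have z: "z \<in> carrier G" "h z = - int n" "wd y z = h y + int n"
    using q'(1)[of k] q'(2)[of k] q'(3)[of 0 k] q(1) k by (simp_all add: z_def)
  obtain N where N: "\<And>v. v \<in> {x, y, z} \<Longrightarrow> wd v (r N) \<le> h v - h (r N) + D"
    using far_point_on_ray[OF h r(2), of "{x, y, z}" 0] x(1) y(1) z(1) by blast
  define p where "p = r N"
  have p: "p \<in> carrier G" "h p = - int N" "wd \<one> p = int N"
    using r'(1)[of N] r'(2)[of N] r'(3)[of 0 N] r(1) h1 by (simp_all add: p_def)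
  have dp: "wd x p \<le> int N - int n + D" "wd y p \<le> h y + int N + D" "wd z p \<le> int N - int n + D"
    using N[of x] N[of y] N[of z] p(2) x(3) z(2) by (simp_all add: p_def)
  have yp: "h y + int N \<le> wd y p" using horo_lip[OF h y(1) p(1)] p(2) by simp
  have s: "wd x \<one> = int n" "wd y \<one> = wd \<one> y" "wd z p = wd z p"
    using d_sym[OF x(1) one_closed] d_sym[OF y(1) one_closed] x(2) by simp_all
  have "wd x y + wd \<one> p \<le> wd x \<one> + wd y p + D \<or> wd x y + wd \<one> p \<le> wd x p + wd y \<one> + D"
    by (rule four_pt[OF x(1) y(1) one_closed p(1)])
  then have xy: "wd x y \<le> int n + h y + 2 * D" using dp p(3) s hy y(2) by linarith
  have "wd x z + wd y p \<le> wd x y + wd z p + D \<or> wd x z + wd y p \<le> wd x p + wd z y + D"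
    by (rule four_pt[OF x(1) z(1) y(1) p(1)])
  moreover have "wd z y = h y + int n" using d_sym[OF z(1) y(1)] z(3) by simp
  ultimately have "wd x z \<le> 4 * D" using dp yp xy D(2) by linarith
  then show ?thesis using z by (intro bexI[of _ z]) (auto simp: ball_at_def)
qed

text \<open>The value at \<open>y\<close> is the minimum of \<open>h z + wd y z\<close> over the points \<open>z\<close> near \<open>x\<close>.\<close>

lemma determined_by_deep_values:
  assumes h: "h \<in> horo G A" "h \<one> = 0" "h x = - int n" and h': "h' \<in> horo G A" "h' \<one> = 0" "h' x = - int n"
    and x: "x \<in> carrier G" "wd \<one> x = int n"
    and agree: "\<And>z. z \<in> ball_at x (4 * D) \<Longrightarrow> h z = h' z"
    and y: "y \<in> carrier G" "wd \<one> y \<le> int n"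
  shows "h y = h' y"
proof (rule antisym)
  obtain z where z: "z \<in> ball_at x (4 * D)" "h' y = h' z + wd y z"
    using value_from_deep_point[OF h'(1,2) x h'(3) y] by blast
  then show "h y \<le> h' y" using horo_lip[OF h(1) y(1), of z] agree[of z] by (simp add: ball_at_def)
  obtain z where z: "z \<in> ball_at x (4 * D)" "h y = h z + wd y z"
    using value_from_deep_point[OF h(1,2) x h(3) y] by blast
  then show "h' y \<le> h y" using horo_lip[OF h'(1) y(1), of z] agree[of z] by (simp add: ball_at_def)
qed

lemma deep_point_exists:
  assumes "h \<in> horo G A" "h \<one> = 0"
  shows "\<exists>x\<in>sphere_one n. h x = - int n"
proof -
  obtain r where r: "r 0 = \<one>" "gradient_ray h r" using horo_ray[OF assms(1) one_closed] by blast
  have "h (r n) = - int n" "r n \<in> sphere_one n"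
    using gradient_rayD(1,2)[OF r(2), of n] gradient_rayD(3)[OF r(2), of 0 n] r(1) assms(2)
    by (simp_all add: sphere_one_def)
  then show ?thesis by blast
qed

text \<open>The geodesics from the identity to \<open>p\<close> and to \<open>g \<otimes> p\<close> separate within distance \<open>k\<close>.  In particular
  no point at infinity is fixed by all elements of \<open>W\<close>.\<close>

definition separating :: "'a set \<Rightarrow> int \<Rightarrow> bool" where
  "separating W k \<longleftrightarrow> finite W \<and> W \<subseteq> carrier G \<and>
     (\<forall>p\<in>carrier G. \<exists>g\<in>W. 2 * wd \<one> p - 2 * k \<le> wd p (g \<otimes> p))"

text \<open>Seen from \<open>x\<close>, the horofunction comes from a far point \<open>p\<close>.  A geodesic to \<open>y\<close> cannot follow both the one to \<open>p\<close> and the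
  one to \<open>g \<otimes> p\<close> for long.  So either \<open>y\<close> or its translate by the inverse of \<open>g\<close> points away from \<open>p\<close>, and
  then the horofunction increases at full speed up to a constant.\<close>

lemma upward_translate:
  assumes W: "separating W k" and L: "\<And>g. g \<in> W \<Longrightarrow> wd \<one> g \<le> L" and "0 \<le> L"
    and h: "h \<in> horo G A" and xy: "x \<in> carrier G" "y \<in> carrier G"
  shows "\<exists>w\<in>insert \<one> (m_inv G ` W). h x + wd \<one> y - (2 * k + 2 * D + L) \<le> h (x \<otimes> (w \<otimes> y))"
proof -
  have W': "finite W" "W \<subseteq> carrier G" using W by (auto simp: separating_def)
  obtain r where r: "r 0 = x" "gradient_ray h r" using horo_ray[OF h xy(1)] by blast
  note r' = gradient_rayD[OF r(2)]
  define Z where "Z = (\<lambda>w. x \<otimes> (w \<otimes> y)) ` insert \<one> (m_inv G ` W)"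
  have Z: "finite Z" "Z \<subseteq> carrier G" using W' xy by (auto simp: Z_def)
  obtain n where n: "\<forall>z\<in>Z. wd z (r n) \<le> h z - h (r n) + D"
    using far_point_on_ray[OF h r(2) Z] by blast
  define p where "p = r n"
  have p: "p \<in> carrier G" "h p = h x - int n" "wd x p = int n"
    using r'(1)[of n] r'(2)[of n] r'(3)[of 0 n] r(1) by (simp_all add: p_def)
  define p' where "p' = inv x \<otimes> p"
  have p': "p' \<in> carrier G" "x \<otimes> p' = p" using xy p mult_inv_cancel(2)[OF xy(1) p(1,1)] by (simp_all add: p'_def)
  have lp': "wd \<one> p' = int n" using wd_left[OF xy(1) one_closed p'(1)] p'(2) p(3) xy by simp
  obtain g where g: "g \<in> W" "2 * wd \<one> p' - 2 * k \<le> wd p' (g \<otimes> p')"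
    using W p'(1) unfolding separating_def by blast
  have gc: "g \<in> carrier G" using g W' by auto
  have gp: "g \<otimes> p' \<in> carrier G" using gc p' by simp
  have "wd p' (g \<otimes> p') + wd \<one> y \<le> wd p' \<one> + wd (g \<otimes> p') y + D
      \<or> wd p' (g \<otimes> p') + wd \<one> y \<le> wd p' y + wd (g \<otimes> p') \<one> + D"
    by (rule four_pt[OF p'(1) gp one_closed xy(2)])
  moreover have "wd p' \<one> = int n" using d_sym[OF p'(1) one_closed] lp' by simp
  moreover have "wd (g \<otimes> p') \<one> \<le> int n + L"
  proof -
    have "wd \<one> (g \<otimes> p') \<le> wd \<one> g + wd \<one> p'" by (rule wd_one_mult[OF gc p'(1)])
    then show ?thesis using L[OF g(1)] lp' d_sym[OF gp one_closed] by linarith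
  qed
  moreover have "wd (g \<otimes> p') y = wd (x \<otimes> (inv g \<otimes> y)) p"
  proof -
    have "wd (x \<otimes> (inv g \<otimes> y)) (x \<otimes> p') = wd (inv g \<otimes> y) p'"
      using xy gc p' by (intro wd_left) auto
    also have "\<dots> = wd (g \<otimes> (inv g \<otimes> y)) (g \<otimes> p')" using xy gc p' by (intro wd_left[symmetric]) auto
    also have "g \<otimes> (inv g \<otimes> y) = y" using mult_inv_cancel(2)[OF gc xy(2,2)] .
    also have "wd y (g \<otimes> p') = wd (g \<otimes> p') y" by (rule d_sym[OF xy(2) gp])
    finally show ?thesis using p'(2) by simp
  qed
  moreover have "wd p' y = wd (x \<otimes> (\<one> \<otimes> y)) p"
  proof -
    have "wd (x \<otimes> (\<one> \<otimes> y)) (x \<otimes> p') = wd y p'" using wd_left[OF xy p'(1)] xy by simp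
    also have "\<dots> = wd p' y" by (rule d_sym[OF xy(2) p'(1)])
    finally show ?thesis using p'(2) by simp
  qed
  moreover have "wd (x \<otimes> (\<one> \<otimes> y)) p \<le> h (x \<otimes> (\<one> \<otimes> y)) - h p + D"
    "wd (x \<otimes> (inv g \<otimes> y)) p \<le> h (x \<otimes> (inv g \<otimes> y)) - h p + D"
    using n g(1) unfolding Z_def p_def by blast+
  ultimately have "h x + wd \<one> y - (2 * k + 2 * D + L) \<le> h (x \<otimes> (inv g \<otimes> y))
      \<or> h x + wd \<one> y - (2 * k + 2 * D + L) \<le> h (x \<otimes> (\<one> \<otimes> y))"
    using g(2) lp' p(2) \<open>0 \<le> L\<close> by linarith
  then show ?thesis using g(1) by blast
qed

text \<open>From depth \<open>n\<close> an upward element of length \<open>n + K\<close> leads to a level between \<open>0\<close> and a constant, and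
  a short piece \<open>u\<close> of a gradient ray leads down to level \<open>0\<close>.\<close>

lemma return_to_level:
  assumes W: "separating W k" and L: "\<And>g. g \<in> W \<Longrightarrow> wd \<one> g \<le> L" "0 \<le> L" and K: "K = 2 * k + 2 * D + L" "0 \<le> K"
    and h: "h \<in> horo G A" and x: "x \<in> carrier G" "h x = - int n" and y: "y \<in> carrier G" "wd \<one> y = int n + K"
  shows "\<exists>w\<in>insert \<one> (m_inv G ` W). \<exists>u\<in>ball_at \<one> (K + L). h (x \<otimes> (w \<otimes> y \<otimes> u)) = 0"
proof -
  obtain w where w: "w \<in> insert \<one> (m_inv G ` W)" "h x + wd \<one> y - K \<le> h (x \<otimes> (w \<otimes> y))"
    using upward_translate[OF W L h x(1) y(1)] K by auto
  have W': "W \<subseteq> carrier G" using W by (auto simp: separating_def)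
  have wc: "w \<in> carrier G" "wd \<one> w \<le> L" using w(1) W' L wd_one_inv by auto
  define v where "v = x \<otimes> (w \<otimes> y)"
  have v: "v \<in> carrier G" "0 \<le> h v" using x y wc w(2) by (simp_all add: v_def)
  have "h v \<le> K + L"
  proof -
    have "wd x v = wd \<one> (w \<otimes> y)" using wd_left[of x \<one> "w \<otimes> y"] x y wc by (simp add: v_def)
    also have "\<dots> \<le> wd \<one> w + wd \<one> y" by (rule wd_one_mult[OF wc(1) y(1)])
    finally have "wd v x \<le> L + int n + K" using wc y(2) d_sym[OF v(1) x(1)] by linarith
    then show ?thesis using horo_lip[OF h v(1) x(1)] x(2) by linarith
  qed
  obtain r where r: "r 0 = v" "gradient_ray h r" using horo_ray[OF h v(1)] by blast
  note r' = gradient_rayD[OF r(2)]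
  define z where "z = r (nat (h v))"
  have z: "z \<in> carrier G" "h z = 0" "wd v z = h v"
    using r'(1)[of "nat (h v)"] r'(2)[of "nat (h v)"] r'(3)[of 0 "nat (h v)"] r(1) v(2) by (simp_all add: z_def)
  define u where "u = inv v \<otimes> z"
  have u: "u \<in> carrier G" "v \<otimes> u = z" using v z mult_inv_cancel(2)[OF v(1) z(1,1)] by (simp_all add: u_def)
  have "wd \<one> u = wd v z" using wd_left[OF v(1) one_closed u(1)] u(2) v(1) by simp
  then have "u \<in> ball_at \<one> (K + L)" using u z \<open>h v \<le> K + L\<close> by (simp add: ball_at_def)
  moreover have "x \<otimes> (w \<otimes> y \<otimes> u) = z" using u(2) x y wc u(1) by (simp add: v_def m_assoc)
  ultimately show ?thesis using w(1) z(2) by (intro bexI[of _ w] bexI[of _ u]) auto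
qed

text \<open>If no finite set separates, then for every \<open>n\<close> all elements of length at most \<open>n\<close> nearly preserve
  a common long geodesic from the identity, sliding it by at most \<open>n\<close>.  Conjugating by a point far along
  it turns the elements with the same displacement into elements of bounded length, so the
  balls grow linearly.\<close>

lemma linear_growth:
  assumes "\<not> (\<exists>W k. separating W k)"
  shows "card (ball_at \<one> (int n)) \<le> (2 * n + 1) * card (ball_at \<one> (3 * D))"
proof -
  define m k where "m = int n + D + 1" and "k = 2 * int n + D + 1"
  have k2: "2 * k = 4 * int n + 2 * D + 2" by (simp add: k_def)
  have m0: "0 \<le> m" using D(2) by (simp add: m_def)
  have "\<not> separating (ball_at \<one> (int n)) k" using assms by blast
  then obtain p where p: "p \<in> carrier G"
    "\<And>g. g \<in> ball_at \<one> (int n) \<Longrightarrow> wd p (g \<otimes> p) < 2 * wd \<one> p - 2 * k"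
    using finite_ball_at[OF one_closed] unfolding separating_def ball_at_def by force
  define P where "P = nat (wd \<one> p)"
  obtain c where c: "c 0 = \<one>" "c P = p" "disc_geodesic c P"
    using disc_geodesic_ends[OF one_closed p(1)] P_def by blast
  have P: "wd \<one> p = int P" using d_nonneg[OF one_closed p(1)] by (simp add: P_def)
  have "\<one> \<in> ball_at \<one> (int n)" by (simp add: ball_at_def)
  then have kP: "k < int P" using p(2)[of \<one>] p(1) P by simp
  have cV: "c i \<in> carrier G" if "i \<le> P" for i using c(3) that by (simp add: disc_geodesic_def)
  have cd: "wd \<one> (c i) = int i" "wd (c i) p = int P - int i" if "i \<le> P" for i
    using c that by (auto simp: disc_geodesic_def)
  define q where "q = c (nat m)"
  have mP: "nat m \<le> P" using kP m0 by (simp add: m_def k_def)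
  have q: "q \<in> carrier G" "wd \<one> q = m" "wd q p = int P - m"
    using cV[OF mP] cd[OF mP] m0 by (simp_all add: q_def)
  define f where "f x = (wd x q, inv q \<otimes> (x \<otimes> c (nat (wd x q))))" for x
  have main: "x \<in> carrier G \<and> m - int n \<le> wd x q \<and> wd x q \<le> m + int n \<and> nat (wd x q) \<le> P
      \<and> wd q (x \<otimes> c (nat (wd x q))) \<le> 3 * D"
    if xb: "x \<in> ball_at \<one> (int n)" for x
  proof -
    have x: "x \<in> carrier G" "wd \<one> x \<le> int n" "wd x \<one> = wd \<one> x"
      using xb d_sym[OF _ one_closed] by (auto simp: ball_at_def)
    define m' where "m' = wd x q"
    have m': "m - int n \<le> m'" "m' \<le> m + int n"
      using d_tri[OF one_closed x(1) q(1)] d_tri[OF x(1) one_closed q(1)] x q by (auto simp: m'_def)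
    have m'P: "0 \<le> m'" "m' \<le> int P" using m' kP d_nonneg[OF x(1) q(1)] by (auto simp: m_def k_def m'_def)
    define q' where "q' = c (nat m')"
    have "nat m' \<le> P" using m'P by simp
    then have q': "q' \<in> carrier G" "wd \<one> q' = m'" "wd q' p = int P - m'"
      using cV cd[of "nat m'"] m'P by (auto simp: q'_def)
    have xp: "x \<otimes> p \<in> carrier G" and xq: "x \<otimes> q' \<in> carrier G" using x p q' by auto
    have dx: "wd x (x \<otimes> p) = int P" "wd (x \<otimes> q') (x \<otimes> p) = int P - m'" "wd (x \<otimes> q') x = m'"
      "wd (x \<otimes> p) x = int P"
      using wd_left[OF x(1) one_closed p(1)] wd_left[OF x(1) q'(1) p(1)] wd_left[OF x(1) one_closed q'(1)]
        d_sym[OF xq x(1)] d_sym[OF xp x(1)] x(1) P q' by auto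
    have ret: "wd (x \<otimes> p) p \<le> 2 * int P - 2 * k"
      using p(2)[OF xb] d_sym[OF xp p(1)] P by linarith
    have sy: "wd q x = m'" "wd q \<one> = m" using d_sym[OF q(1) x(1)] d_sym[OF q(1) one_closed] q by (auto simp: m'_def)
    have "wd q x + wd \<one> p \<le> wd q \<one> + wd x p + D \<or> wd q x + wd \<one> p \<le> wd q p + wd x \<one> + D"
      by (rule four_pt[OF q(1) x(1) one_closed p(1)])
    then have xp_low: "int P + m' - m - D \<le> wd x p"
      using sy P q x m' D(2) unfolding m_def by linarith
    have "wd q (x \<otimes> p) + wd x p \<le> wd q x + wd (x \<otimes> p) p + D
        \<or> wd q (x \<otimes> p) + wd x p \<le> wd q p + wd (x \<otimes> p) x + D"
      by (rule four_pt[OF q(1) xp x(1) p(1)])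
    then have "wd q (x \<otimes> p) \<le> int P - m' + 2 * D"
      using sy ret xp_low q dx m' m_def k2 by linarith
    moreover have "wd q (x \<otimes> q') + wd x (x \<otimes> p) \<le> wd q x + wd (x \<otimes> q') (x \<otimes> p) + D
        \<or> wd q (x \<otimes> q') + wd x (x \<otimes> p) \<le> wd q (x \<otimes> p) + wd (x \<otimes> q') x + D"
      by (rule four_pt[OF q(1) xq x(1) xp])
    ultimately have "wd q (x \<otimes> q') \<le> 3 * D" using sy dx D(2) by linarith
    then show ?thesis using x m' m'P by (simp add: m'_def q'_def)
  qed
  have "inj_on f (ball_at \<one> (int n))"
  proof (rule inj_onI)
    fix x y assume xy: "x \<in> ball_at \<one> (int n)" "y \<in> ball_at \<one> (int n)" "f x = f y"
    define z where "z = c (nat (wd x q))"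
    have z: "z \<in> carrier G" using cV main[OF xy(1)] by (simp add: z_def)
    have c: "x \<in> carrier G" "y \<in> carrier G" using main xy by auto
    have "inv q \<otimes> (x \<otimes> z) = inv q \<otimes> (y \<otimes> z)" using xy(3) unfolding f_def z_def prod.inject by metis
    then have "x \<otimes> z = y \<otimes> z" using c z q(1) by simp
    then show "x = y" using c z by simp
  qed
  moreover have "f ` ball_at \<one> (int n) \<subseteq> {m - int n..m + int n} \<times> ball_at \<one> (3 * D)"
  proof (rule image_subsetI)
    fix x assume "x \<in> ball_at \<one> (int n)"
    note mx = main[OF this]
    define z where "z = x \<otimes> c (nat (wd x q))"
    have z: "z \<in> carrier G" using cV mx by (simp add: z_def)
    have "wd \<one> (inv q \<otimes> z) = wd q z"
      using wd_left[of q \<one> "inv q \<otimes> z"] q(1) z mult_inv_cancel(2)[OF q(1) z z] by simp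
    then show "f x \<in> {m - int n..m + int n} \<times> ball_at \<one> (3 * D)"
      using mx z q(1) by (simp add: f_def ball_at_def flip: z_def)
  qed
  ultimately have "card (ball_at \<one> (int n)) \<le> card ({m - int n..m + int n} \<times> ball_at \<one> (3 * D))"
    by (intro card_inj_on_le) (auto simp: finite_ball_at)
  also have "\<dots> = (2 * n + 1) * card (ball_at \<one> (3 * D))"
    by (simp add: card_cartesian_product nat_add_distrib nat_mult_distrib)
  finally show ?thesis .
qed

text \<open>If all spheres from some radius on were larger than twice the slope of the linear bound, the balls would
  outgrow it.\<close>

lemma small_spheres:
  assumes "\<not> (\<exists>W k. separating W k)"
  shows "\<exists>n\<ge>m. card (sphere_one n) \<le> 2 * card (ball_at \<one> (3 * D))"
proof (rule ccontr)
  define b where "b = card (ball_at \<one> (3 * D))"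
  assume "\<not> ?thesis"
  then have big: "2 * b + 1 \<le> card (sphere_one n)" if "m \<le> n" for n
    using that unfolding b_def by (metis not_less_eq_eq Suc_eq_plus1)
  define k where "k = 2 * b * m + b + 1"
  define n where "n = m + k"
  have "(\<Union>i\<in>{m..<n}. sphere_one i) \<subseteq> ball_at \<one> (int n)"
    by (auto simp: sphere_one_def ball_at_def)
  then have "card (\<Union>i\<in>{m..<n}. sphere_one i) \<le> card (ball_at \<one> (int n))"
    by (intro card_mono finite_ball_at) auto
  moreover have "card (\<Union>i\<in>{m..<n}. sphere_one i) = (\<Sum>i\<in>{m..<n}. card (sphere_one i))"
  proof (rule card_UN_disjoint)
    show "\<forall>i\<in>{m..<n}. finite (sphere_one i)" by (simp add: finite_sphere_one)
  qed (auto simp: sphere_one_def)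
  moreover have "(\<Sum>i\<in>{m..<n}. 2 * b + 1) \<le> (\<Sum>i\<in>{m..<n}. card (sphere_one i))"
    by (intro sum_mono big) auto
  ultimately have "(n - m) * (2 * b + 1) \<le> (2 * n + 1) * b"
    using linear_growth[OF assms, of n] by (simp add: b_def)
  then have "k * (2 * b + 1) \<le> (2 * (m + k) + 1) * b" by (simp add: n_def)
  then have "k \<le> 2 * b * m + b" by (simp add: algebra_simps)
  then show False by (simp add: k_def)
qed

end


section \<open>The Borel structure and the translation relation\<close>

lemma restrict_sets_iff:
  "E \<in> sets M \<Longrightarrow> C \<in> sets (restrict_space M E) \<longleftrightarrow> C \<subseteq> E \<and> C \<in> sets M"
  by (simp add: sets_restrict_space_iff)

lemma emeasure_restrict:
  "E \<in> sets M \<Longrightarrow> C \<subseteq> E \<Longrightarrow> emeasure (restrict_space M E) C = emeasure M C"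
  by (simp add: emeasure_restrict_space)

context hyperbolic_cayley
begin

abbreviation H0 :: "('a \<Rightarrow> int) set" where "H0 \<equiv> horo0 G A"
abbreviation M0 :: "('a \<Rightarrow> int) measure" where "M0 \<equiv> horo0_borel G A"

definition local_at :: "nat \<Rightarrow> ('a \<Rightarrow> int) set \<Rightarrow> bool" where
  "local_at n U \<longleftrightarrow> U \<subseteq> H0 \<and> (\<forall>h\<in>H0. \<forall>h'\<in>H0.
     (\<forall>y\<in>ball_at \<one> (int n). h y = h' y) \<longrightarrow> h \<in> U \<longrightarrow> h' \<in> U)"

definition local_sets :: "('a \<Rightarrow> int) set set" where
  "local_sets = {U. \<exists>n. local_at n U}"

lemma H0_iff: "h \<in> H0 \<longleftrightarrow> h \<in> horo G A \<and> h \<one> = 0"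
  by (simp add: horo0_def)

lemma H0_bound:
  assumes "h \<in> H0" "y \<in> carrier G"
  shows "\<bar>h y\<bar> \<le> wd \<one> y"
proof -
  have h: "h \<in> horo G A" "h \<one> = 0" using assms(1) by (simp_all add: H0_iff)
  show ?thesis
    using horo_lip[OF h(1) assms(2) one_closed] horo_lip[OF h(1) one_closed assms(2)] h(2)
      d_sym[OF assms(2) one_closed] by linarith
qed

lemma local_atD:
  assumes "local_at n U"
  shows "U \<subseteq> H0"
    "h \<in> U \<Longrightarrow> h' \<in> H0 \<Longrightarrow> (\<And>y. y \<in> ball_at \<one> (int n) \<Longrightarrow> h y = h' y) \<Longrightarrow> h' \<in> U"
  using assms unfolding local_at_def by blast+

lemma local_atI:
  assumes "U \<subseteq> H0"
    "\<And>h h'. h \<in> U \<Longrightarrow> h' \<in> H0 \<Longrightarrow> (\<And>y. y \<in> ball_at \<one> (int n) \<Longrightarrow> h y = h' y) \<Longrightarrow> h' \<in> U"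
  shows "local_at n U"
  using assms unfolding local_at_def by blast

lemma local_at_mono:
  assumes "local_at n U" "n \<le> m"
  shows "local_at m U"
proof (rule local_atI)
  show "U \<subseteq> H0" by (rule local_atD(1)[OF assms(1)])
  fix h h' assume h: "h \<in> U" "h' \<in> H0" and eq: "\<And>y. y \<in> ball_at \<one> (int m) \<Longrightarrow> h y = h' y"
  have "ball_at \<one> (int n) \<subseteq> ball_at \<one> (int m)" using assms(2) by (auto simp: ball_at_def)
  then show "h' \<in> U" using eq by (intro local_atD(2)[OF assms(1) h]) blast
qed

lemma local_at_Diff:
  assumes "local_at n U" "local_at n V"
  shows "local_at n (U - V)"
proof (rule local_atI)
  show "U - V \<subseteq> H0" using local_atD(1)[OF assms(1)] by blast
  fix h h' assume h: "h \<in> U - V" "h' \<in> H0" and eq: "\<And>y. y \<in> ball_at \<one> (int n) \<Longrightarrow> h y = h' y"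
  have "h \<in> H0" using h local_atD(1)[OF assms(1)] by blast
  then have "h' \<notin> V" using local_atD(2)[OF assms(2), of h' h] eq h by force
  moreover have "h' \<in> U" using local_atD(2)[OF assms(1), of h h'] eq h by blast
  ultimately show "h' \<in> U - V" by blast
qed

lemma local_at_H0: "local_at n H0"
  unfolding local_at_def by blast

lemma local_at_UN: "(\<And>i. i \<in> I \<Longrightarrow> local_at n (U i)) \<Longrightarrow> local_at n (\<Union>i\<in>I. U i)"
  unfolding local_at_def by blast

lemma local_common_level:
  assumes "finite I" "\<And>i. i \<in> I \<Longrightarrow> U i \<in> local_sets"
  shows "\<exists>n. \<forall>i\<in>I. local_at n (U i)"
proof -
  have "\<forall>i\<in>I. \<exists>n. local_at n (U i)" using assms(2) by (auto simp: local_sets_def)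
  then obtain f where f: "\<forall>i\<in>I. local_at (f i) (U i)" using bchoice by meson
  have "local_at (Max (f ` I)) (U i)" if i: "i \<in> I" for i
    by (rule local_at_mono[of "f i"]) (use f i assms(1) in simp_all)
  then show ?thesis by blast
qed

lemma local_value:
  assumes "g \<in> carrier G"
  shows "{h \<in> H0. P (h g)} \<in> local_sets"
proof -
  have g: "g \<in> ball_at \<one> (int (nat (wd \<one> g)))" using assms by (simp add: ball_at_def)
  have "local_at (nat (wd \<one> g)) {h \<in> H0. P (h g)}"
    by (rule local_atI) (use g in auto)
  then show ?thesis by (auto simp: local_sets_def)
qed

definition basic_nbhd :: "nat \<Rightarrow> ('a \<Rightarrow> int) \<Rightarrow> ('a \<Rightarrow> int) set" where
  "basic_nbhd n h = {h' \<in> H0. \<forall>y\<in>ball_at \<one> (int n). h' y = h y}"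

lemma open_imp_basic_nbhd:
  assumes "openin (horo_topology G A) V" "h \<in> V" "h \<in> H0"
  shows "\<exists>n. basic_nbhd n h \<subseteq> V"
proof -
  define S where "S = {{h' \<in> horo G A. \<forall>g\<in>K. of_int \<bar>h' g - h g\<bar> < \<epsilon>} | h K \<epsilon>.
        h \<in> horo G A \<and> finite K \<and> K \<subseteq> carrier G \<and> (0::real) < \<epsilon>}"
  have "generate_topology_on S V"
    using assms(1) unfolding horo_topology_def S_def by (simp add: openin_topology_generated_by_iff)
  then have "\<forall>h\<in>V \<inter> H0. \<exists>n. basic_nbhd n h \<subseteq> V"
  proof (induction rule: generate_topology_on.induct)
    case Empty
    then show ?case by simp
  next
    case (Int a b)
    show ?case
    proof
      fix h assume "h \<in> a \<inter> b \<inter> H0"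
      then obtain n m where nm: "basic_nbhd n h \<subseteq> a" "basic_nbhd m h \<subseteq> b" using Int.IH by blast
      have "basic_nbhd (max n m) h \<subseteq> basic_nbhd n h \<inter> basic_nbhd m h"
        by (auto simp: basic_nbhd_def ball_at_def)
      then show "\<exists>n. basic_nbhd n h \<subseteq> a \<inter> b" using nm by blast
    qed
  next
    case (UN K)
    show ?case
    proof
      fix h assume "h \<in> \<Union> K \<inter> H0"
      then obtain k where "k \<in> K" "h \<in> k \<inter> H0" by blast
      then show "\<exists>n. basic_nbhd n h \<subseteq> \<Union> K" using UN.IH by blast
    qed
  next
    case (Basis s)
    then obtain k K and \<epsilon> :: real where s: "s = {h' \<in> horo G A. \<forall>g\<in>K. of_int \<bar>h' g - k g\<bar> < \<epsilon>}"
      and K: "finite K" "K \<subseteq> carrier G"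
      unfolding S_def by blast
    show ?case
    proof
      fix h assume h: "h \<in> s \<inter> H0"
      define n where "n = nat (Max (insert 0 (wd \<one> ` K)))"
      have "g \<in> ball_at \<one> (int n)" if "g \<in> K" for g
      proof -
        have "wd \<one> g \<le> Max (insert 0 (wd \<one> ` K))" using K that by (intro Max_ge) auto
        then show ?thesis using K that by (auto simp: ball_at_def n_def)
      qed
      then have "basic_nbhd n h \<subseteq> s" using h unfolding s basic_nbhd_def H0_iff by auto
      then show "\<exists>n. basic_nbhd n h \<subseteq> s" by blast
    qed
  qed
  then show ?thesis using assms by blast
qed

lemma local_open:
  assumes "local_at n U"
  shows "openin (subtopology (horo_topology G A) H0) U"
proof -
  define N where "N h = {h' \<in> horo G A. \<forall>g\<in>ball_at \<one> (int n). of_int \<bar>h' g - h g\<bar> < (1::real)}" for h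
  have "openin (horo_topology G A) (N h)" if "h \<in> H0" for h
  proof -
    have "h \<in> horo G A" "finite (ball_at \<one> (int n))" "ball_at \<one> (int n) \<subseteq> carrier G"
      using that finite_ball_at by (auto simp: H0_iff ball_at_def)
    then show ?thesis unfolding horo_topology_def N_def
      by (intro topology_generated_by_Basis) (blast intro: zero_less_one)
  qed
  then have "openin (horo_topology G A) (\<Union>h\<in>U. N h)"
    using assms by (intro openin_Union) (auto simp: local_at_def)
  moreover have "U = (\<Union>h\<in>U. N h) \<inter> H0"
  proof
    show "U \<subseteq> (\<Union>h\<in>U. N h) \<inter> H0"
    proof
      fix h assume h: "h \<in> U"
      then have "h \<in> H0" using local_atD(1)[OF assms] by blast
      moreover from this have "h \<in> N h" by (simp add: N_def H0_iff)
      ultimately show "h \<in> (\<Union>h\<in>U. N h) \<inter> H0" using h by blast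
    qed
    show "(\<Union>h\<in>U. N h) \<inter> H0 \<subseteq> U"
    proof
      fix h' assume "h' \<in> (\<Union>h\<in>U. N h) \<inter> H0"
      then obtain h where h: "h \<in> U" "h' \<in> N h" "h' \<in> H0" by blast
      then have "\<forall>y\<in>ball_at \<one> (int n). h y = h' y" unfolding N_def by force
      then show "h' \<in> U" using assms h unfolding local_at_def by blast
    qed
  qed
  ultimately show ?thesis unfolding openin_subtopology by blast
qed

text \<open>An open set is the increasing union of the sets of its elements whose basic neighbourhood of level \<open>n\<close> it
  contains, and these are local.  So it is a countable union of local sets.\<close>

lemma sets_M0: "sets M0 = sigma_sets H0 local_sets"
  and space_M0 [simp]: "space M0 = H0"
proof -
  have sub: "{U. openin (subtopology (horo_topology G A) H0) U} \<subseteq> Pow H0"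
    by (auto simp: openin_subtopology)
  show "space M0 = H0" using sub by (simp add: horo0_borel_def space_measure_of)
  have "sets M0 = sigma_sets H0 {U. openin (subtopology (horo_topology G A) H0) U}"
    using sub by (simp add: horo0_borel_def sets_measure_of)
  also have "\<dots> = sigma_sets H0 local_sets"
  proof (rule sigma_sets_eqI)
    fix U assume "U \<in> {U. openin (subtopology (horo_topology G A) H0) U}"
    then obtain V where V: "openin (horo_topology G A) V" "U = V \<inter> H0" by (auto simp: openin_subtopology)
    define Vn where "Vn n = {h \<in> U. basic_nbhd n h \<subseteq> V}" for n
    have "U = (\<Union>n. Vn n)" using V open_imp_basic_nbhd[OF V(1)] by (auto simp: Vn_def)
    moreover have "local_at n (Vn n)" for n
      unfolding local_at_def
    proof (intro conjI ballI impI)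
      show "Vn n \<subseteq> H0" using V by (auto simp: Vn_def)
      fix h h' assume h: "h \<in> H0" "h' \<in> H0" "\<forall>y\<in>ball_at \<one> (int n). h y = h' y" "h \<in> Vn n"
      then have eq: "basic_nbhd n h = basic_nbhd n h'" by (auto simp: basic_nbhd_def)
      then have "h' \<in> basic_nbhd n h" using h by (auto simp: basic_nbhd_def)
      then show "h' \<in> Vn n" using h eq V by (auto simp: Vn_def)
    qed
    then have "\<And>n. Vn n \<in> local_sets" by (auto simp: local_sets_def)
    ultimately show "U \<in> sigma_sets H0 local_sets"
      by (auto intro: sigma_sets.Union sigma_sets.Basic)
  next
    fix U assume "U \<in> local_sets"
    then show "U \<in> sigma_sets H0 {U. openin (subtopology (horo_topology G A) H0) U}"
      using local_open by (auto simp: local_sets_def)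
  qed
  finally show "sets M0 = sigma_sets H0 local_sets" .
qed

lemma local_in_sets: "U \<in> local_sets \<Longrightarrow> U \<in> sets M0"
  unfolding sets_M0 by (rule sigma_sets.Basic)

lemma value_in_sets: "g \<in> carrier G \<Longrightarrow> {h \<in> H0. P (h g)} \<in> sets M0"
  by (intro local_in_sets local_value)

lemma H0_sets: "H0 \<in> sets M0"
  using sets.top[of M0] by simp

subsection \<open>Translations\<close>

lemma translate_apply: "f \<in> carrier G \<Longrightarrow> translate G g h f = h (inv g \<otimes> f)"
  by (simp add: translate_def)

lemma translate_horo:
  assumes g: "g \<in> carrier G" and h: "h \<in> horo G A"
  shows "translate G g h \<in> horo G A"
  unfolding horo_iff
proof (intro conjI)
  have ig: "inv g \<in> carrier G" using g by simp
  have wl: "wd (inv g \<otimes> u) (inv g \<otimes> v) = wd u v" if "u \<in> carrier G" "v \<in> carrier G" for u v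
    using wd_left[OF ig that] .
  show "translate G g h \<in> extensional (carrier G)" by (simp add: translate_def)
  show "int_lipschitz (translate G g h)"
    using horoD(1)[OF h] wl ig unfolding int_lipschitz_def by (simp add: translate_apply) (metis m_closed)
  show "four_point_fun (2 * D) (translate G g h)"
    unfolding four_point_fun_def
  proof (intro ballI)
    fix a b m assume abm: "a \<in> carrier G" "b \<in> carrier G" "m \<in> carrier G"
    have "h (inv g \<otimes> m) + wd (inv g \<otimes> a) (inv g \<otimes> b) \<le> max (h (inv g \<otimes> a) + wd (inv g \<otimes> m) (inv g \<otimes> b))
        (h (inv g \<otimes> b) + wd (inv g \<otimes> m) (inv g \<otimes> a)) + 2 * D"
      using horoD(3)[OF h] abm ig unfolding four_point_fun_def by blast
    then show "translate G g h m + wd a b \<le> max (translate G g h a + wd m b) (translate G g h b + wd m a) + 2 * D"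
      using abm wl by (simp add: translate_apply)
  qed
  show "descending (translate G g h)"
    unfolding descending_def
  proof
    fix x assume x: "x \<in> carrier G"
    obtain y where y: "y \<in> carrier G" "wd (inv g \<otimes> x) y = 1" "h y = h (inv g \<otimes> x) - 1"
      using horoD(2)[OF h] x ig unfolding descending_def by (metis m_closed)
    have "inv g \<otimes> (g \<otimes> y) = y" using mult_inv_cancel(3)[OF g y(1,1)] .
    then have "wd x (g \<otimes> y) = 1" "translate G g h (g \<otimes> y) = translate G g h x - 1"
      using wl[of x "g \<otimes> y"] x y g by (simp_all add: translate_apply)
    then show "\<exists>y\<in>carrier G. wd x y = 1 \<and> translate G g h y = translate G g h x - 1" using y(1) g by blast
  qed
qed

text \<open>The domain of the partial transformation by which \<open>g\<close> acts on \<open>H0\<close>.\<close>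

definition trans_dom :: "'a \<Rightarrow> ('a \<Rightarrow> int) set" where
  "trans_dom g = {h \<in> H0. h (inv g) = 0}"

lemma trans_dom_sets: "g \<in> carrier G \<Longrightarrow> trans_dom g \<in> sets M0"
  unfolding trans_dom_def using value_in_sets[of "inv g" "\<lambda>v. v = 0"] by simp

lemma translate_H0:
  assumes "g \<in> carrier G" "h \<in> trans_dom g"
  shows "translate G g h \<in> trans_dom (inv g)"
  using assms translate_horo[OF assms(1), of h] by (simp add: trans_dom_def H0_iff translate_apply)

lemma translate_H0_iff:
  assumes "g \<in> carrier G" "h \<in> H0"
  shows "translate G g h \<in> H0 \<longleftrightarrow> h \<in> trans_dom g"
  using assms translate_horo[OF assms(1), of h] by (simp add: trans_dom_def H0_iff translate_apply)

lemma translate_translate: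
  assumes "g \<in> carrier G" "h \<in> H0"
  shows "translate G (inv g) (translate G g h) = h"
proof
  fix f
  show "translate G (inv g) (translate G g h) f = h f"
  proof (cases "f \<in> carrier G")
    case True
    then show ?thesis using assms mult_inv_cancel(3)[of g f] by (simp add: translate_apply)
  next
    case False
    then show ?thesis using horoD(4)[of h] assms by (simp add: translate_def H0_iff extensional_def)
  qed
qed

lemma translate_bij:
  assumes g: "g \<in> carrier G"
  shows "inj_on (translate G g) (trans_dom g)"
    "B \<subseteq> trans_dom g \<Longrightarrow> translate G g ` B = {h \<in> trans_dom (inv g). translate G (inv g) h \<in> B}"
proof -
  have sub: "trans_dom g \<subseteq> H0" for g by (auto simp: trans_dom_def)
  show "inj_on (translate G g) (trans_dom g)"
    using translate_translate[OF g] sub by (metis inj_on_inverseI subsetD)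
  assume B: "B \<subseteq> trans_dom g"
  show "translate G g ` B = {h \<in> trans_dom (inv g). translate G (inv g) h \<in> B}"
  proof safe
    fix h assume h: "h \<in> B"
    then show "translate G g h \<in> trans_dom (inv g)" using B translate_H0[OF g] by blast
    show "translate G (inv g) (translate G g h) \<in> B" using h B sub translate_translate[OF g, of h] by force
  next
    fix h assume h: "h \<in> trans_dom (inv g)" "translate G (inv g) h \<in> B"
    then have "translate G g (translate G (inv g) h) = h"
      using translate_translate[of "inv g" h] g sub[of "inv g"] by auto
    then show "h \<in> translate G g ` B" using h(2) by (metis imageI)
  qed
qed

lemma translate_preimage_local:
  assumes g: "g \<in> carrier G" and U: "local_at n U"
  shows "{h \<in> trans_dom g. translate G g h \<in> U} \<in> local_sets"
proof -
  define m where "m = n + nat (wd \<one> g)"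
  have "local_at m {h \<in> trans_dom g. translate G g h \<in> U}"
    unfolding local_at_def
  proof (intro conjI ballI impI)
    show "{h \<in> trans_dom g. translate G g h \<in> U} \<subseteq> H0" by (auto simp: trans_dom_def)
    fix h h' assume h: "h \<in> H0" "h' \<in> H0" and eq: "\<forall>y\<in>ball_at \<one> (int m). h y = h' y"
      and hU: "h \<in> {h \<in> trans_dom g. translate G g h \<in> U}"
    have ig: "inv g \<in> carrier G" "wd \<one> (inv g) = wd \<one> g" "0 \<le> wd \<one> g"
      using g wd_one_inv d_nonneg by auto
    then have "inv g \<in> ball_at \<one> (int m)" by (simp add: ball_at_def m_def)
    then have h'g: "h' \<in> trans_dom g" using eq hU h(2) by (auto simp: trans_dom_def)
    have "translate G g h y = translate G g h' y" if y: "y \<in> ball_at \<one> (int n)" for y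
    proof -
      have yc: "y \<in> carrier G" "wd \<one> y \<le> int n" using y by (auto simp: ball_at_def)
      have "wd \<one> (inv g \<otimes> y) \<le> int m" using wd_one_mult[OF ig(1) yc(1)] yc ig by (simp add: m_def)
      then have "inv g \<otimes> y \<in> ball_at \<one> (int m)" using yc ig by (simp add: ball_at_def)
      then show ?thesis using eq yc by (simp add: translate_apply)
    qed
    moreover have "translate G g h \<in> H0" "translate G g h' \<in> H0"
      using translate_H0[OF g] hU h'g by (auto simp: trans_dom_def)
    ultimately have "translate G g h' \<in> U" using U hU unfolding local_at_def by blast
    then show "h' \<in> {h \<in> trans_dom g. translate G g h \<in> U}" using h'g by simp
  qed
  then show ?thesis by (auto simp: local_sets_def)
qed

lemma translate_preimage:
  assumes g: "g \<in> carrier G" and B: "B \<in> sets M0"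
  shows "{h \<in> trans_dom g. translate G g h \<in> B} \<in> sets M0"
  using B unfolding sets_M0
proof (induction rule: sigma_sets.induct)
  case (Basic U)
  then obtain n where "local_at n U" by (auto simp: local_sets_def)
  then show ?case using translate_preimage_local[OF g] by (blast intro: sigma_sets.Basic)
next
  case Empty
  then show ?case by (simp add: sigma_sets.Empty)
next
  case (Compl U)
  have "{h \<in> trans_dom g. translate G g h \<in> H0 - U} = trans_dom g - {h \<in> trans_dom g. translate G g h \<in> U}"
    using translate_H0[OF g] by (auto simp: trans_dom_def)
  then show ?case using Compl trans_dom_sets[OF g] sets.Diff[of _ M0] by (simp add: sets_M0)
next
  case (Union a)
  have "{h \<in> trans_dom g. translate G g h \<in> \<Union> (range a)} = (\<Union>i. {h \<in> trans_dom g. translate G g h \<in> a i})"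
    by auto
  then show ?case using Union by (auto intro: sigma_sets.Union)
qed

lemma translate_image_sets:
  assumes g: "g \<in> carrier G" and B: "B \<in> sets M0" "B \<subseteq> trans_dom g"
  shows "translate G g ` B \<in> sets M0"
  using translate_preimage[of "inv g" B] translate_bij(2)[OF g B(2)] g B(1) by simp

lemma translate_partial_transformation:
  assumes g: "g \<in> carrier G" and B: "B \<in> sets M0" "B \<subseteq> trans_dom g"
  shows "partial_transformation G A B (translate G g ` B) (translate G g)"
  unfolding partial_transformation_def
proof (intro conjI ballI)
  note img = translate_image_sets[OF assms]
  show "B \<in> sets M0" "translate G g ` B \<in> sets M0" using B img by auto
  show "bij_betw (translate G g) B (translate G g ` B)"
    using translate_bij(1)[OF g] B(2) by (simp add: bij_betw_def inj_on_subset)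
  show "(h, translate G g h) \<in> horo_rel G A" if "h \<in> B" for h
  proof -
    have "h \<in> trans_dom g" using that B(2) by blast
    then have "h \<in> H0" "translate G g h \<in> H0" using translate_H0[OF g, of h] by (auto simp: trans_dom_def)
    then show ?thesis using g unfolding horo_rel_def by blast
  qed
  have sub: "B \<subseteq> H0" "translate G g ` B \<subseteq> H0" using B img sets.sets_into_space[of _ M0] by auto
  show "translate G g \<in> restrict_space M0 B \<rightarrow>\<^sub>M restrict_space M0 (translate G g ` B)"
  proof (rule measurableI)
    show "translate G g h \<in> space (restrict_space M0 (translate G g ` B))" if "h \<in> space (restrict_space M0 B)" for h
      using that sub by (auto simp: space_restrict_space)
    fix C assume "C \<in> sets (restrict_space M0 (translate G g ` B))"
    then have C: "C \<in> sets M0" using img by (simp add: restrict_sets_iff)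
    have "translate G g -` C \<inter> space (restrict_space M0 B) = {h \<in> trans_dom g. translate G g h \<in> C} \<inter> B"
      using B sub by (auto simp: space_restrict_space)
    also have "\<dots> \<in> sets (restrict_space M0 B)"
      using translate_preimage[OF g C] B sub by (simp add: restrict_sets_iff)
    finally show "translate G g -` C \<inter> space (restrict_space M0 B) \<in> sets (restrict_space M0 B)" .
  qed
qed

lemma invariant_measuresD:
  assumes "\<eta> \<in> invariant_measures G A"
  shows "sets \<eta> = sets M0" "prob_space \<eta>" "space \<eta> = H0"
  using assms sets_eq_imp_space_eq[of \<eta> M0] by (auto simp: invariant_measures_def)

lemma invariant_translate:
  assumes \<eta>: "\<eta> \<in> invariant_measures G A" and g: "g \<in> carrier G" and B: "B \<in> sets M0" "B \<subseteq> trans_dom g"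
  shows "emeasure \<eta> (translate G g ` B) = emeasure \<eta> B"
proof -
  define E where "E = translate G g ` B"
  note s = invariant_measuresD[OF \<eta>]
  have pt: "partial_transformation G A B E (translate G g)"
    unfolding E_def by (rule translate_partial_transformation[OF g B])
  have E: "E \<in> sets M0" using translate_image_sets[OF g B] by (simp add: E_def)
  have sub: "B \<subseteq> H0" "E \<subseteq> H0" using B(1) E sets.sets_into_space[of _ M0] by auto
  have meas: "translate G g \<in> restrict_space \<eta> B \<rightarrow>\<^sub>M restrict_space \<eta> E"
    using pt measurable_cong_sets[OF sets_restrict_space_cong[OF s(1)] sets_restrict_space_cong[OF s(1)]]
    unfolding partial_transformation_def by blast
  have "emeasure \<eta> E = emeasure (restrict_space \<eta> E) E"
    using E s sub by (simp add: emeasure_restrict)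
  also have "\<dots> = emeasure (distr (restrict_space \<eta> B) (restrict_space \<eta> E) (translate G g)) E"
    using \<eta> pt unfolding invariant_measures_def by simp
  also have "\<dots> = emeasure (restrict_space \<eta> B) (translate G g -` E \<inter> space (restrict_space \<eta> B))"
    using meas E s sub by (intro emeasure_distr) (auto simp: restrict_sets_iff)
  also have "translate G g -` E \<inter> space (restrict_space \<eta> B) = B"
    using s sub by (auto simp: E_def space_restrict_space)
  also have "emeasure (restrict_space \<eta> B) B = emeasure \<eta> B"
    using B s sub by (simp add: emeasure_restrict)
  finally show ?thesis by (simp add: E_def)
qed

subsection \<open>The measure of the set of horofunctions with a given deep point\<close>

definition deep_set :: "nat \<Rightarrow> 'a \<Rightarrow> ('a \<Rightarrow> int) set" where
  "deep_set n x = {h \<in> H0. h x = - int n}"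

lemma deep_set_sets: "x \<in> carrier G \<Longrightarrow> deep_set n x \<in> sets M0"
  unfolding deep_set_def using value_in_sets[of x "\<lambda>v. v = - int n"] by simp

end

lemma (in prob_space) sum_prob_le_multiplicity:
  assumes "finite V" "\<And>v. v \<in> V \<Longrightarrow> Q v \<in> sets M"
    and mult: "\<And>x. x \<in> space M \<Longrightarrow> card {v \<in> V. x \<in> Q v} \<le> P"
  shows "(\<Sum>v\<in>V. prob (Q v)) \<le> real P"
proof -
  have int: "integrable M (indicator (Q v) :: _ \<Rightarrow> real)" if "v \<in> V" for v
    using assms(2)[OF that] by (simp add: integrable_indicator_iff emeasure_eq_measure)
  have "(\<Sum>v\<in>V. prob (Q v)) = (\<Sum>v\<in>V. (\<integral>x. indicator (Q v) x \<partial>M))"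
    using assms(2) by (intro sum.cong) (auto simp: sets.Int_space_eq2)
  also have "\<dots> = (\<integral>x. (\<Sum>v\<in>V. indicator (Q v) x) \<partial>M)"
    using int by (intro Bochner_Integration.integral_sum[symmetric]) auto
  also have "\<dots> \<le> (\<integral>x. real P \<partial>M)"
  proof (rule integral_mono)
    show "integrable M (\<lambda>x. \<Sum>v\<in>V. indicator (Q v) x :: real)" using int by (intro Bochner_Integration.integrable_sum) auto
    fix x assume x: "x \<in> space M"
    have "(\<Sum>v\<in>V. indicator (Q v) x :: real) = real (card {v \<in> V. x \<in> Q v})"
      using \<open>finite V\<close> by (simp add: indicator_def sum.If_cases Int_def)
    then show "(\<Sum>v\<in>V. indicator (Q v) x) \<le> real P" using mult[OF x] by simp
  qed simp
  finally show ?thesis by (simp add: prob_space)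
qed

context hyperbolic_cayley
begin

text \<open>For every \<open>y\<close> on the larger sphere, \<open>return_to_level\<close> covers the deep set of \<open>x\<close> by boundedly many pieces, each
  of which a translation carries into the deep set of a point of length about \<open>n\<close>.  Summed over \<open>y\<close>, the images
  overlap boundedly by \<open>card_deep_points\<close>, so their total measure is bounded.\<close>

lemma deep_set_mass:
  assumes "separating W k"
  shows "\<exists>j C. \<forall>n. \<forall>\<eta>\<in>invariant_measures G A. \<forall>x\<in>sphere_one n.
    real (card (sphere_one (n + j))) * measure \<eta> (deep_set n x) \<le> real C"
proof -
  have W: "finite W" "W \<subseteq> carrier G" using assms by (auto simp: separating_def)
  define k' where "k' = max k 0"
  have sep: "separating W k'"
    unfolding separating_def
  proof (intro conjI ballI W)
    fix p assume "p \<in> carrier G"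
    then obtain g where "g \<in> W" "2 * wd \<one> p - 2 * k \<le> wd p (g \<otimes> p)" using assms by (auto simp: separating_def)
    then show "\<exists>g\<in>W. 2 * wd \<one> p - 2 * k' \<le> wd p (g \<otimes> p)" unfolding k'_def by (intro bexI[of _ g]) auto
  qed
  define L where "L = Max (insert 0 (wd \<one> ` W))"
  have L: "wd \<one> g \<le> L" if "g \<in> W" for g unfolding L_def using W that by (intro Max_ge) auto
  have L0: "0 \<le> L" unfolding L_def using W by (intro Max_ge) auto
  define K where "K = 2 * k' + 2 * D + L"
  have K0: "0 \<le> K" using D(2) L0 by (simp add: K_def k'_def)
  define j where "j = nat K"
  define W' where "W' = insert \<one> (m_inv G ` W)"
  have W': "finite W'" "W' \<subseteq> carrier G" "\<And>w. w \<in> W' \<Longrightarrow> wd \<one> w \<le> L"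
    using W L L0 wd_one_inv by (auto simp: W'_def)
  define I where "I = W' \<times> ball_at \<one> (K + L)"
  have fI: "finite I" using W' finite_ball_at by (simp add: I_def)
  define K3 where "K3 = K + L + (K + L)"
  define P where "P = card (ball_at \<one> (K3 + 2 * D))"
  have "real (card (sphere_one (n + j))) * measure \<eta> (deep_set n x) \<le> real (card I * P)"
    if \<eta>: "\<eta> \<in> invariant_measures G A" and x: "x \<in> sphere_one n" for n \<eta> x
  proof -
    note s = invariant_measuresD[OF \<eta>]
    interpret prob_space \<eta> by fact
    have xc: "x \<in> carrier G" using x by (simp add: sphere_one_def)
    define T where "T v = {h \<in> deep_set n x. h (x \<otimes> v) = 0}" for v
    have T_sets: "T v \<in> sets M0" if "v \<in> carrier G" for v
    proof -
      have "T v = deep_set n x \<inter> {h \<in> H0. h (x \<otimes> v) = 0}" by (auto simp: T_def deep_set_def)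
      then show ?thesis using deep_set_sets[OF xc] value_in_sets[of "x \<otimes> v" "\<lambda>t. t = 0"] xc that by auto
    qed
    have T_le: "prob (T v) \<le> prob (deep_set n (inv v))" if v: "v \<in> carrier G" for v
    proof -
      define g where "g = inv (x \<otimes> v)"
      have g: "g \<in> carrier G" "inv g = x \<otimes> v" using xc v by (auto simp: g_def)
      have Tg: "T v \<subseteq> trans_dom g" by (auto simp: T_def trans_dom_def g deep_set_def)
      have "translate G g ` T v \<subseteq> deep_set n (inv v)"
      proof
        fix h' assume "h' \<in> translate G g ` T v"
        then obtain h where h: "h \<in> T v" "h' = translate G g h" by blast
        have "h' \<in> H0" using translate_H0[OF g(1)] h Tg by (auto simp: trans_dom_def)
        moreover have "h' (inv v) = h (x \<otimes> v \<otimes> inv v)" using v by (simp add: h(2) translate_apply g)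
        moreover have "x \<otimes> v \<otimes> inv v = x" using xc v by (simp add: m_assoc)
        ultimately show "h' \<in> deep_set n (inv v)" using h(1) by (simp add: deep_set_def T_def)
      qed
      then have "prob (translate G g ` T v) \<le> prob (deep_set n (inv v))"
        using deep_set_sets[of "inv v" n] v s by (intro finite_measure_mono) auto
      moreover have "prob (translate G g ` T v) = prob (T v)"
        using invariant_translate[OF \<eta> g(1) T_sets[OF v] Tg] by (simp add: measure_def)
      ultimately show ?thesis by simp
    qed
    have one_y: "prob (deep_set n x) \<le> (\<Sum>(w, u)\<in>I. prob (deep_set n (inv (w \<otimes> y \<otimes> u))))"
      if y: "y \<in> sphere_one (n + j)" for y
    proof -
      have yc: "y \<in> carrier G" "wd \<one> y = int n + K" using y K0 by (auto simp: sphere_one_def j_def)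
      have vc: "w \<otimes> y \<otimes> u \<in> carrier G" if "(w, u) \<in> I" for w u
        using that W' yc by (auto simp: I_def ball_at_def)
      have "deep_set n x \<subseteq> (\<Union>(w, u)\<in>I. T (w \<otimes> y \<otimes> u))"
      proof
        fix h assume h: "h \<in> deep_set n x"
        then have "h \<in> horo G A" "h x = - int n" by (auto simp: deep_set_def H0_iff)
        then obtain w u where "w \<in> W'" "u \<in> ball_at \<one> (K + L)" "h (x \<otimes> (w \<otimes> y \<otimes> u)) = 0"
          using return_to_level[OF sep L L0 K_def K0 _ xc _ yc] unfolding W'_def by blast
        then show "h \<in> (\<Union>(w, u)\<in>I. T (w \<otimes> y \<otimes> u))" using h by (auto simp: I_def T_def)
      qed
      then have "prob (deep_set n x) \<le> prob (\<Union>(w, u)\<in>I. T (w \<otimes> y \<otimes> u))"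
        using T_sets vc fI s by (intro finite_measure_mono sets.finite_UN) auto
      also have "\<dots> \<le> (\<Sum>(w, u)\<in>I. prob (T (w \<otimes> y \<otimes> u)))"
        using T_sets vc fI s
        by (intro order_trans[OF finite_measure_subadditive_finite] sum_mono) (auto split: prod.splits)
      also have "\<dots> \<le> (\<Sum>(w, u)\<in>I. prob (deep_set n (inv (w \<otimes> y \<otimes> u))))"
        using T_le vc by (intro sum_mono) auto
      finally show ?thesis .
    qed
    have one_wu: "(\<Sum>y\<in>sphere_one (n + j). prob (deep_set n (inv (w \<otimes> y \<otimes> u)))) \<le> real P"
      if wu: "(w, u) \<in> I" for w u
    proof -
      have c: "w \<in> carrier G" "u \<in> carrier G" "wd \<one> w \<le> L" "wd \<one> u \<le> K + L"
        using wu W' by (auto simp: I_def ball_at_def)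
      define f where "f y = inv (w \<otimes> y \<otimes> u)" for y
      have inj: "inj_on f (sphere_one (n + j))"
      proof (rule inj_onI)
        fix y y' assume y: "y \<in> sphere_one (n + j)" "y' \<in> sphere_one (n + j)" "f y = f y'"
        then have yc: "y \<in> carrier G" "y' \<in> carrier G" by (auto simp: sphere_one_def)
        then have "w \<otimes> y \<otimes> u = w \<otimes> y' \<otimes> u" using y(3) c inj_onD[OF inv_inj] by (auto simp: f_def)
        then show "y = y'" using c yc by simp
      qed
      have img: "f ` sphere_one (n + j) \<subseteq> ball_at \<one> (int n + K3)"
      proof (rule image_subsetI)
        fix y assume "y \<in> sphere_one (n + j)"
        then have y: "y \<in> carrier G" "wd \<one> y = int n + K" using K0 by (auto simp: sphere_one_def j_def)
        have "wd \<one> (w \<otimes> y \<otimes> u) \<le> wd \<one> (w \<otimes> y) + wd \<one> u" "wd \<one> (w \<otimes> y) \<le> wd \<one> w + wd \<one> y"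
          using c y by (auto intro!: wd_one_mult)
        then have "wd \<one> (f y) \<le> int n + K3"
          using c y wd_one_inv[of "w \<otimes> y \<otimes> u"] unfolding f_def K3_def by simp
        then show "f y \<in> ball_at \<one> (int n + K3)" using c y by (simp add: ball_at_def f_def)
      qed
      have "(\<Sum>y\<in>sphere_one (n + j). prob (deep_set n (f y))) = (\<Sum>v\<in>f ` sphere_one (n + j). prob (deep_set n v))"
        using inj by (simp add: sum.reindex)
      also have "\<dots> \<le> (\<Sum>v\<in>ball_at \<one> (int n + K3). prob (deep_set n v))"
        using img by (intro sum_mono2 finite_ball_at) auto
      also have "\<dots> \<le> real P"
      proof (rule sum_prob_le_multiplicity)
        show "finite (ball_at \<one> (int n + K3))" by (intro finite_ball_at) simp
        show "deep_set n v \<in> sets \<eta>" if "v \<in> ball_at \<one> (int n + K3)" for v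
          using that deep_set_sets s by (simp add: ball_at_def)
        fix h assume "h \<in> space \<eta>"
        then have h: "h \<in> H0" using s by simp
        have "{v \<in> ball_at \<one> (int n + K3). h \<in> deep_set n v} = {v \<in> carrier G. h v = - int n \<and> wd \<one> v \<le> int n + K3}"
          using h by (auto simp: ball_at_def deep_set_def)
        then show "card {v \<in> ball_at \<one> (int n + K3). h \<in> deep_set n v} \<le> P"
          using card_deep_points[of h K3 n] h K0 L0 by (simp add: P_def H0_iff K3_def)
      qed
      finally show ?thesis by (simp add: f_def)
    qed
    have "real (card (sphere_one (n + j))) * prob (deep_set n x) = (\<Sum>y\<in>sphere_one (n + j). prob (deep_set n x))"
      by simp
    also have "\<dots> \<le> (\<Sum>y\<in>sphere_one (n + j). \<Sum>(w, u)\<in>I. prob (deep_set n (inv (w \<otimes> y \<otimes> u))))"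
      by (intro sum_mono one_y)
    also have "\<dots> = (\<Sum>(w, u)\<in>I. \<Sum>y\<in>sphere_one (n + j). prob (deep_set n (inv (w \<otimes> y \<otimes> u))))"
      unfolding split_def by (rule sum.swap)
    also have "\<dots> \<le> (\<Sum>i\<in>I. real P)" using one_wu by (intro sum_mono) auto
    finally show ?thesis by simp
  qed
  then show ?thesis by blast
qed

text \<open>Without a separating set the bound holds for the trivial reason that the sphere is small.\<close>

lemma deep_set_mass_uniform:
  "\<exists>C>0. \<forall>m. \<exists>n\<ge>m. \<forall>\<eta>\<in>invariant_measures G A. \<forall>x\<in>sphere_one n.
     real (card (sphere_one n)) * measure \<eta> (deep_set n x) \<le> C"
proof (cases "\<exists>W k. separating W k")
  case True
  then obtain j C where jC: "\<And>n \<eta> x. \<eta> \<in> invariant_measures G A \<Longrightarrow> x \<in> sphere_one n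
      \<Longrightarrow> real (card (sphere_one (n + j))) * measure \<eta> (deep_set n x) \<le> real C"
    using deep_set_mass by blast
  have "\<exists>n\<ge>m. \<forall>\<eta>\<in>invariant_measures G A. \<forall>x\<in>sphere_one n.
     real (card (sphere_one n)) * measure \<eta> (deep_set n x) \<le> 2 * real C + 1" for m
  proof -
    obtain n where n: "n \<ge> m" "card (sphere_one n) \<le> 2 * card (sphere_one (n + j))"
      using sphere_sizes_recur by blast
    have "real (card (sphere_one n)) * measure \<eta> (deep_set n x) \<le> 2 * real C + 1"
      if "\<eta> \<in> invariant_measures G A" "x \<in> sphere_one n" for \<eta> x
    proof -
      have "real (card (sphere_one n)) * measure \<eta> (deep_set n x)
          \<le> real (2 * card (sphere_one (n + j))) * measure \<eta> (deep_set n x)"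
        using n(2) by (intro mult_right_mono) (simp_all only: of_nat_le_iff measure_nonneg)
      then show ?thesis using jC[OF that] by simp
    qed
    then show ?thesis using n(1) by blast
  qed
  then show ?thesis by (intro exI[of _ "2 * real C + 1"]) auto
next
  case False
  define b where "b = 2 * card (ball_at \<one> (3 * D))"
  have "\<exists>n\<ge>m. \<forall>\<eta>\<in>invariant_measures G A. \<forall>x\<in>sphere_one n.
     real (card (sphere_one n)) * measure \<eta> (deep_set n x) \<le> real b + 1" for m
  proof -
    obtain n where n: "n \<ge> m" "card (sphere_one n) \<le> b"
      using small_spheres[OF False] unfolding b_def by blast
    have "real (card (sphere_one n)) * measure \<eta> (deep_set n x) \<le> real b + 1"
      if "\<eta> \<in> invariant_measures G A" "x \<in> sphere_one n" for \<eta> x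
    proof -
      have "measure \<eta> (deep_set n x) \<le> 1"
        using prob_space.prob_le_1[OF invariant_measuresD(2)[OF that(1)]] .
      then have "real (card (sphere_one n)) * measure \<eta> (deep_set n x) \<le> real b * 1"
        using n(2) by (intro mult_mono) auto
      then show ?thesis by simp
    qed
    then show ?thesis using n(1) by blast
  qed
  then show ?thesis by (intro exI[of _ "real b + 1"]) auto
qed

end


section \<open>Finitely many ergodic measures\<close>

lemma prob_space_eq_if_le:
  assumes "prob_space M" "prob_space N" "sets M = sets N"
    and le: "\<And>T. T \<in> sets M \<Longrightarrow> emeasure M T \<le> emeasure N T"
  shows "M = N"
proof (rule measure_eqI[OF assms(3)])
  interpret M: prob_space M by fact
  interpret N: prob_space N by fact
  have sp: "space M = space N" using sets_eq_imp_space_eq[OF assms(3)] .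
  fix T assume T: "T \<in> sets M"
  have "M.prob T \<le> N.prob T" using le[OF T] by (simp add: M.emeasure_eq_measure N.emeasure_eq_measure)
  moreover have "M.prob (space M - T) \<le> N.prob (space M - T)"
    using le[of "space M - T"] T by (simp add: M.emeasure_eq_measure N.emeasure_eq_measure)
  then have "1 - M.prob T \<le> 1 - N.prob T"
    using M.prob_compl[OF T] N.prob_compl[of T] T assms(3) sp by simp
  ultimately show "emeasure M T = emeasure N T" by (simp add: M.emeasure_eq_measure N.emeasure_eq_measure)
qed

context hyperbolic_cayley
begin

lemma saturation_eq: "Y \<subseteq> H0 \<Longrightarrow> horo_rel G A `` Y = (\<Union>g\<in>carrier G. translate G g ` (Y \<inter> trans_dom g))"
proof -
  assume Y: "Y \<subseteq> H0"
  have "h' \<in> horo_rel G A `` Y \<longleftrightarrow> (\<exists>g\<in>carrier G. \<exists>h\<in>Y \<inter> trans_dom g. h' = translate G g h)" for h'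
    using Y translate_H0_iff unfolding horo_rel_def Image_def by blast
  then show ?thesis by blast
qed

lemma saturation_sets:
  assumes "Y \<in> sets M0"
  shows "horo_rel G A `` Y \<in> sets M0"
proof -
  have "translate G g ` (Y \<inter> trans_dom g) \<in> sets M0" if "g \<in> carrier G" for g
    using that assms trans_dom_sets[OF that] by (intro translate_image_sets) auto
  moreover have "Y \<subseteq> H0" using assms sets.sets_into_space by force
  ultimately show ?thesis
    unfolding saturation_eq[OF \<open>Y \<subseteq> H0\<close>] by (intro sets.countable_UN' countable_carrier) auto
qed

lemma subset_saturation: "Y \<subseteq> H0 \<Longrightarrow> Y \<subseteq> horo_rel G A `` Y"
proof
  fix h assume Y: "Y \<subseteq> H0" "h \<in> Y"
  then have h: "h \<in> trans_dom \<one>" by (auto simp: trans_dom_def H0_iff)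
  have "translate G \<one> h = h"
  proof
    fix f
    show "translate G \<one> h f = h f"
      using horoD(4)[of h] Y by (cases "f \<in> carrier G") (auto simp: translate_def H0_iff extensional_def)
  qed
  then have "h \<in> translate G \<one> ` (Y \<inter> trans_dom \<one>)" using h Y(2) by (metis IntI imageI)
  then show "h \<in> horo_rel G A `` Y" unfolding saturation_eq[OF Y(1)] by (rule UN_I[OF one_closed])
qed

text \<open>Saturating one half of a Hahn decomposition of the difference of two invariant measures yields a
  Hahn decomposition again: what is added is moved by the relation from one half to the other, so
  both measures agree on it.\<close>

lemma invariant_Hahn_decomposition:
  assumes \<eta>: "\<eta>1 \<in> invariant_measures G A" "\<eta>2 \<in> invariant_measures G A"
  shows "\<exists>Y\<in>sets M0. (\<forall>T\<in>sets M0. T \<subseteq> horo_rel G A `` Y \<longrightarrow> emeasure \<eta>2 T \<le> emeasure \<eta>1 T) \<and>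
    (\<forall>T\<in>sets M0. T \<inter> horo_rel G A `` Y = {} \<longrightarrow> emeasure \<eta>1 T \<le> emeasure \<eta>2 T)"
proof -
  note s1 = invariant_measuresD[OF \<eta>(1)] and s2 = invariant_measuresD[OF \<eta>(2)]
  interpret p1: prob_space \<eta>1 by fact
  interpret p2: prob_space \<eta>2 by fact
  have "sets \<eta>2 = sets \<eta>1" using s1 s2 by simp
  from finite_unsigned_Hahn_decomposition[OF p1.finite_measure_axioms p2.finite_measure_axioms this]
  obtain Y where Y: "Y \<in> sets M0" "\<forall>T\<in>sets M0. T \<subseteq> Y \<longrightarrow> emeasure \<eta>2 T \<le> emeasure \<eta>1 T"
    "\<forall>T\<in>sets M0. T \<inter> Y = {} \<longrightarrow> emeasure \<eta>1 T \<le> emeasure \<eta>2 T"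
    unfolding s1(1) by (elim bexE conjE)
  have YH: "Y \<subseteq> H0" using Y(1) sets.sets_into_space by force
  define S where "S = horo_rel G A `` Y"
  have S: "S \<in> sets M0" using saturation_sets[OF Y(1)] by (simp add: S_def)
  have one: "emeasure \<eta>2 Z \<le> emeasure \<eta>1 Z"
    if g: "g \<in> carrier G" and Z: "Z \<in> sets M0" "Z \<subseteq> translate G g ` (Y \<inter> trans_dom g)" for Z g
  proof -
    define B where "B = {h \<in> trans_dom g. translate G g h \<in> Z}"
    have B: "B \<in> sets M0" "B \<subseteq> trans_dom g" using translate_preimage[OF g Z(1)] by (auto simp: B_def)
    have BY: "B \<subseteq> Y"
    proof
      fix h assume h: "h \<in> B"
      then obtain h' where h': "h' \<in> Y" "h' \<in> trans_dom g" "translate G g h = translate G g h'"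
        using Z(2) by (auto simp: B_def)
      have "h \<in> trans_dom g" using h by (simp add: B_def)
      then have "h = h'" using translate_bij(1)[OF g] h'(2,3) unfolding inj_on_def by blast
      then show "h \<in> Y" using h'(1) by simp
    qed
    have ZB: "Z = translate G g ` B"
    proof
      show "Z \<subseteq> translate G g ` B" using Z(2) by (auto simp: B_def)
      show "translate G g ` B \<subseteq> Z" by (auto simp: B_def)
    qed
    have "emeasure \<eta>2 Z = emeasure \<eta>2 B" unfolding ZB by (rule invariant_translate[OF \<eta>(2) g B])
    also have "\<dots> \<le> emeasure \<eta>1 B" using Y(2) B(1) BY by blast
    also have "\<dots> = emeasure \<eta>1 Z" unfolding ZB by (rule invariant_translate[OF \<eta>(1) g B, symmetric])
    finally show ?thesis .
  qed
  have below: "emeasure \<eta>2 T \<le> emeasure \<eta>1 T" if T: "T \<in> sets M0" "T \<subseteq> S" for T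
  proof -
    define e where "e = from_nat_into (carrier G)"
    have e: "e i \<in> carrier G" for i unfolding e_def using from_nat_into[of "carrier G" i] by blast
    have eS: "S = (\<Union>i. translate G (e i) ` (Y \<inter> trans_dom (e i)))"
    proof -
      have re: "range e = carrier G" unfolding e_def using range_from_nat_into[OF _ countable_carrier] by blast
      show ?thesis by (simp only: S_def saturation_eq[OF YH] re[symmetric] image_image)
    qed
    define F where "F i = translate G (e i) ` (Y \<inter> trans_dom (e i))" for i
    have F: "F i \<in> sets M0" for i
      unfolding F_def using Y(1) trans_dom_sets[OF e] by (intro translate_image_sets e) auto
    define Z where "Z i = T \<inter> disjointed F i" for i
    have Zs: "Z i \<in> sets M0" for i
      using T(1) sets.range_disjointed_sets[of F M0] F by (auto simp: Z_def)
    have dis: "disjoint_family Z"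
      using disjoint_family_disjointed[of F] unfolding Z_def disjoint_family_on_def by blast
    have U: "(\<Union>i. Z i) = T"
    proof -
      have "(\<Union>i. Z i) = T \<inter> (\<Union>i. disjointed F i)" by (auto simp: Z_def)
      also have "\<dots> = T \<inter> S" unfolding UN_disjointed_eq eS F_def ..
      finally show ?thesis using T(2) by blast
    qed
    have le: "emeasure \<eta>2 (Z i) \<le> emeasure \<eta>1 (Z i)" for i
      using disjointed_subset[of F i] by (intro one[OF e Zs]) (auto simp: Z_def F_def)
    have "emeasure \<eta>2 T = suminf (\<lambda>i. emeasure \<eta>2 (Z i))"
    proof -
      have "range Z \<subseteq> sets \<eta>2" using Zs s2 by auto
      from suminf_emeasure[OF this dis] show ?thesis using U by simp
    qed
    also have "\<dots> \<le> suminf (\<lambda>i. emeasure \<eta>1 (Z i))" by (intro suminf_le le) auto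
    also have "\<dots> = emeasure \<eta>1 T"
    proof -
      have "range Z \<subseteq> sets \<eta>1" using Zs s1 by auto
      from suminf_emeasure[OF this dis] show ?thesis using U by simp
    qed
    finally show ?thesis .
  qed
  have "emeasure \<eta>1 T \<le> emeasure \<eta>2 T" if T: "T \<in> sets M0" "T \<inter> S = {}" for T
  proof -
    have "T \<inter> Y = {}" using T(2) subset_saturation[OF YH] unfolding S_def by blast
    then show ?thesis using Y(3) T(1) by blast
  qed
  then show ?thesis
    unfolding S_def[symmetric] using below by (intro bexI[OF _ Y(1)] conjI ballI impI) (simp_all flip: S_def)
qed

text \<open>By ergodicity, the saturated half \<open>S\<close> of the decomposition and its complement have measure zero or one.  If
  both measures lived on the same half, one would be dominated by the other, and
  probability measures that are so related are equal.\<close>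

lemma ergodic_singular:
  assumes \<eta>: "\<eta>1 \<in> invariant_measures G A" "\<eta>2 \<in> invariant_measures G A"
    and erg: "ergodic_measure G A \<eta>1" "ergodic_measure G A \<eta>2" and "\<eta>1 \<noteq> \<eta>2"
  shows "\<exists>S\<in>sets M0. measure \<eta>1 S = 1 \<and> measure \<eta>2 S = 0"
proof -
  note s1 = invariant_measuresD[OF \<eta>(1)] and s2 = invariant_measuresD[OF \<eta>(2)]
  interpret p1: prob_space \<eta>1 by fact
  interpret p2: prob_space \<eta>2 by fact
  from invariant_Hahn_decomposition[OF \<eta>] obtain Y where Y: "Y \<in> sets M0"
    "\<forall>T\<in>sets M0. T \<subseteq> horo_rel G A `` Y \<longrightarrow> emeasure \<eta>2 T \<le> emeasure \<eta>1 T"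
    "\<forall>T\<in>sets M0. T \<inter> horo_rel G A `` Y = {} \<longrightarrow> emeasure \<eta>1 T \<le> emeasure \<eta>2 T"
    by (elim bexE conjE)
  define S where "S = horo_rel G A `` Y"
  have S: "S \<in> sets M0" "S \<subseteq> H0"
    using saturation_sets[OF Y(1)] sets.sets_into_space[of S M0] by (auto simp: S_def)
  have YH: "Y \<subseteq> H0" using Y(1) sets.sets_into_space by force
  have "\<exists>C\<subseteq>H0 // horo_rel G A. S = \<Union>C"
  proof (intro exI conjI)
    show "(\<lambda>h. horo_rel G A `` {h}) ` Y \<subseteq> H0 // horo_rel G A" using YH by (auto intro: quotientI)
    show "S = \<Union> ((\<lambda>h. horo_rel G A `` {h}) ` Y)" unfolding S_def by blast
  qed
  then have dich: "emeasure \<eta>1 S = 0 \<or> emeasure \<eta>1 (H0 - S) = 0" "emeasure \<eta>2 S = 0 \<or> emeasure \<eta>2 (H0 - S) = 0"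
    using erg S(1) unfolding ergodic_measure_def by blast+
  have HS: "H0 - S \<in> sets M0" using S H0_sets by auto
  have split: "emeasure \<eta> T = emeasure \<eta> (T \<inter> S) + emeasure \<eta> (T - S)"
    if "sets \<eta> = sets M0" "T \<in> sets M0" for \<eta> T
  proof -
    have "T \<inter> S \<in> sets \<eta>" "T - S \<in> sets \<eta>" using that S by auto
    from plus_emeasure[OF this] show ?thesis by (simp add: Int_Diff_Un Int_Diff_disjoint)
  qed
  have null: "emeasure \<eta> T = 0" if "sets \<eta> = sets M0" "emeasure \<eta> N = 0" "N \<in> sets M0" "T \<subseteq> N" for \<eta> T N
    using that emeasure_mono[of T N \<eta>] by (metis le_zero_eq)
  have XHS: "T - S \<subseteq> H0 - S" if "T \<in> sets M0" for T using sets.sets_into_space[OF that] by auto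
  have "emeasure \<eta>2 (H0 - S) \<noteq> 0"
  proof
    assume 2: "emeasure \<eta>2 (H0 - S) = 0"
    have "emeasure \<eta>2 T \<le> emeasure \<eta>1 T" if T: "T \<in> sets M0" for T
    proof -
      have "emeasure \<eta>2 T = emeasure \<eta>2 (T \<inter> S)"
        using split[OF s2(1) T] null[OF s2(1) 2 HS XHS[OF T]] by simp
      also have "\<dots> \<le> emeasure \<eta>1 (T \<inter> S)" using T S by (intro Y(2)[rule_format]) (auto simp flip: S_def)
      also have "\<dots> \<le> emeasure \<eta>1 T" using T S s1 by (intro emeasure_mono) auto
      finally show ?thesis .
    qed
    then have "\<eta>2 = \<eta>1" using s1 s2 by (intro prob_space_eq_if_le) auto
    then show False using \<open>\<eta>1 \<noteq> \<eta>2\<close> by simp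
  qed
  then have z2: "emeasure \<eta>2 S = 0" using dich by simp
  have "emeasure \<eta>1 S \<noteq> 0"
  proof
    assume 1: "emeasure \<eta>1 S = 0"
    have "emeasure \<eta>1 T \<le> emeasure \<eta>2 T" if T: "T \<in> sets M0" for T
    proof -
      have "emeasure \<eta>1 T = emeasure \<eta>1 (T - S)"
        using split[OF s1(1) T] null[OF s1(1) 1 S(1), of "T \<inter> S"] by simp
      also have "\<dots> \<le> emeasure \<eta>2 (T - S)" using T S by (intro Y(3)[rule_format]) (auto simp flip: S_def)
      also have "\<dots> \<le> emeasure \<eta>2 T" using T S s2 by (intro emeasure_mono) auto
      finally show ?thesis .
    qed
    then have "\<eta>1 = \<eta>2" using s1 s2 by (intro prob_space_eq_if_le) auto
    then show False using \<open>\<eta>1 \<noteq> \<eta>2\<close> by simp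
  qed
  then have z1: "emeasure \<eta>1 (H0 - S) = 0" using dich by simp
  have "p1.prob S = 1"
    using p1.prob_compl[of S] S s1 z1 by (simp add: p1.emeasure_eq_measure)
  moreover have "p2.prob S = 0" using z2 by (simp add: p2.emeasure_eq_measure)
  ultimately show ?thesis using S(1) by blast
qed

text \<open>The sets that can be approximated by local sets in all the measures at once form a \<open>\<sigma>\<close>-algebra.\<close>

lemma approx_by_local:
  assumes E: "finite E" "\<And>\<eta>. \<eta> \<in> E \<Longrightarrow> sets \<eta> = sets M0 \<and> prob_space \<eta>"
    and S: "S \<in> sets M0" and "0 < \<epsilon>"
  shows "\<exists>U\<in>local_sets. \<forall>\<eta>\<in>E. measure \<eta> ((S - U) \<union> (U - S)) < \<epsilon>"
  using S \<open>0 < \<epsilon>\<close> unfolding sets_M0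
proof (induction arbitrary: \<epsilon> rule: sigma_sets.induct)
  case (Basic S)
  then show ?case by (intro bexI[of _ S]) auto
next
  case Empty
  have "{} \<in> local_sets" using local_at_UN[of "{}" 0] by (auto simp: local_sets_def)
  then show ?case using Empty by (intro bexI[of _ "{}"]) auto
next
  case (Compl S)
  obtain U where U: "U \<in> local_sets" "\<forall>\<eta>\<in>E. measure \<eta> ((S - U) \<union> (U - S)) < \<epsilon>"
    using Compl.IH[OF Compl.prems] by blast
  have L: "local_sets \<subseteq> Pow H0" by (auto simp: local_sets_def dest: local_atD(1))
  have sub: "S \<subseteq> H0" "U \<subseteq> H0" using sigma_sets_into_sp[OF L Compl.hyps] U(1) L by auto
  have "(H0 - S - (H0 - U)) \<union> (H0 - U - (H0 - S)) = (S - U) \<union> (U - S)" using sub by blast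
  moreover have "H0 - U \<in> local_sets"
    using U(1) local_at_Diff[OF local_at_H0] by (auto simp: local_sets_def)
  ultimately show ?case using U(2) by (intro bexI[of _ "H0 - U"]) auto
next
  case (Union a)
  have a: "a i \<in> sets M0" for i using Union.hyps by (simp add: sets_M0)
  have ev: "\<forall>\<eta>\<in>E. eventually (\<lambda>N. measure \<eta> (\<Union> (range a)) - measure \<eta> (\<Union>i<N. a i) < \<epsilon> / 2) sequentially"
  proof
    fix \<eta> assume "\<eta> \<in> E"
    then have s: "sets \<eta> = sets M0" and "prob_space \<eta>" using E by auto
    interpret prob_space \<eta> by fact
    have "(\<lambda>N. measure \<eta> (\<Union>i<N. a i)) \<longlonglongrightarrow> measure \<eta> (\<Union>N. \<Union>i<N. a i)"
    proof (rule finite_Lim_measure_incseq)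
      show "range (\<lambda>N. \<Union>i<N. a i) \<subseteq> events" using a s by auto
      show "incseq (\<lambda>N. \<Union>i<N. a i)" by (rule incseq_SucI) (simp add: lessThan_Suc)
    qed
    moreover have "(\<Union>N. \<Union>i<N. a i) = \<Union> (range a)" by auto
    ultimately have "(\<lambda>N. measure \<eta> (\<Union>i<N. a i)) \<longlonglongrightarrow> measure \<eta> (\<Union> (range a))" by simp
    from tendsto_diff[OF tendsto_const[of "measure \<eta> (\<Union> (range a))"] this]
    have "(\<lambda>N. measure \<eta> (\<Union> (range a)) - measure \<eta> (\<Union>i<N. a i)) \<longlonglongrightarrow> 0" by simp
    then show "eventually (\<lambda>N. measure \<eta> (\<Union> (range a)) - measure \<eta> (\<Union>i<N. a i) < \<epsilon> / 2) sequentially"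
      by (rule order_tendstoD(2)) (use Union.prems in simp)
  qed
  then have "eventually (\<lambda>N. \<forall>\<eta>\<in>E. measure \<eta> (\<Union> (range a)) - measure \<eta> (\<Union>i<N. a i) < \<epsilon> / 2) sequentially"
    using E(1) by (simp add: eventually_ball_finite)
  then obtain N where N: "\<forall>\<eta>\<in>E. measure \<eta> (\<Union> (range a)) - measure \<eta> (\<Union>i<N. a i) < \<epsilon> / 2"
    unfolding eventually_sequentially by blast
  define \<delta> where "\<delta> = \<epsilon> / (2 * (real N + 1))"
  have \<delta>: "0 < \<delta>" "real N * \<delta> \<le> \<epsilon> / 2" using Union.prems by (auto simp: \<delta>_def field_simps)
  have "\<forall>i. \<exists>U. U \<in> local_sets \<and> (\<forall>\<eta>\<in>E. measure \<eta> ((a i - U) \<union> (U - a i)) < \<delta>)"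
    using Union.IH[OF \<delta>(1)] by blast
  from choice[OF this] obtain U where
    "\<forall>i. U i \<in> local_sets \<and> (\<forall>\<eta>\<in>E. measure \<eta> ((a i - U i) \<union> (U i - a i)) < \<delta>)" by (elim exE)
  then have U: "U i \<in> local_sets" "\<forall>\<eta>\<in>E. measure \<eta> ((a i - U i) \<union> (U i - a i)) < \<delta>" for i
    by auto
  define V where "V = (\<Union>i\<in>{..<N}. U i)"
  have Ulev: "\<exists>n. \<forall>i\<in>{..<N}. local_at n (U i)" by (rule local_common_level) (auto simp: U(1))
  then obtain n where n: "\<forall>i\<in>{..<N}. local_at n (U i)" by blast
  have V: "V \<in> local_sets" unfolding local_sets_def V_def using local_at_UN[of "{..<N}" n U] n by blast
  have "measure \<eta> ((\<Union> (range a) - V) \<union> (V - \<Union> (range a))) < \<epsilon>" if \<eta>: "\<eta> \<in> E" for \<eta>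
  proof -
    have s: "sets \<eta> = sets M0" and "prob_space \<eta>" using E \<eta> by auto
    interpret prob_space \<eta> by fact
    define Dl where "Dl i = (a i - U i) \<union> (U i - a i)" for i
    define T where "T = \<Union> (range a) - (\<Union>i<N. a i)"
    have Dl: "Dl i \<in> sets \<eta>" for i using a local_in_sets[OF U(1)] s by (auto simp: Dl_def)
    have T: "T \<in> sets \<eta>" using a s by (auto simp: T_def)
    have "(\<Union> (range a) - V) \<union> (V - \<Union> (range a)) \<subseteq> T \<union> (\<Union>i<N. Dl i)"
    proof
      fix h assume h: "h \<in> (\<Union> (range a) - V) \<union> (V - \<Union> (range a))"
      show "h \<in> T \<union> (\<Union>i<N. Dl i)"
      proof (cases "h \<in> V")
        case True
        then obtain i where "i < N" "h \<in> U i" by (auto simp: V_def)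
        then show ?thesis using h True by (auto simp: Dl_def)
      next
        case False
        then have "\<And>i. i < N \<Longrightarrow> h \<notin> U i" by (auto simp: V_def)
        then show ?thesis using h False by (auto simp: T_def Dl_def)
      qed
    qed
    then have "prob ((\<Union> (range a) - V) \<union> (V - \<Union> (range a))) \<le> prob (T \<union> (\<Union>i<N. Dl i))"
      using T Dl by (intro finite_measure_mono) auto
    also have "\<dots> \<le> prob T + prob (\<Union>i<N. Dl i)" using T Dl by (intro measure_Un_le) auto
    also have "prob (\<Union>i<N. Dl i) \<le> (\<Sum>i<N. prob (Dl i))"
      using Dl by (intro finite_measure_subadditive_finite) auto
    also have "\<dots> \<le> (\<Sum>i<N. \<delta>)" using U(2) \<eta> by (intro sum_mono) (auto simp: Dl_def less_imp_le)
    also have "prob T = prob (\<Union> (range a)) - prob (\<Union>i<N. a i)"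
      unfolding T_def using a s by (intro finite_measure_Diff) auto
    finally have "prob ((\<Union> (range a) - V) \<union> (V - \<Union> (range a)))
        \<le> prob (\<Union> (range a)) - prob (\<Union>i<N. a i) + (\<Sum>i<N. \<delta>)" by simp
    moreover have "prob (\<Union> (range a)) - prob (\<Union>i<N. a i) < \<epsilon> / 2" using N \<eta> by blast
    moreover have "(\<Sum>i<N. \<delta>) \<le> \<epsilon> / 2" using \<delta>(2) by simp
    ultimately show ?thesis by linarith
  qed
  then show ?case using V by blast
qed

text \<open>Sets of full measure for one and of measure zero for the others are approximated by local sets so
  well that removing the other approximations costs less than one half.\<close>

lemma disjoint_local_supports:
  assumes E: "finite E" "E \<subseteq> {\<eta> \<in> invariant_measures G A. ergodic_measure G A \<eta>}"
  shows "\<exists>n U. (\<forall>\<eta>\<in>E. local_at n (U \<eta>) \<and> 1 / 2 \<le> measure \<eta> (U \<eta>)) \<and>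
    (\<forall>\<eta>\<in>E. \<forall>\<eta>'\<in>E. \<eta> \<noteq> \<eta>' \<longrightarrow> U \<eta> \<inter> U \<eta>' = {})"
proof -
  have s: "sets \<eta> = sets M0 \<and> prob_space \<eta> \<and> space \<eta> = H0" if "\<eta> \<in> E" for \<eta>
    using that E(2) invariant_measuresD by blast
  have "\<forall>p\<in>E \<times> E. \<exists>S. S \<in> sets M0 \<and> (fst p \<noteq> snd p \<longrightarrow> measure (fst p) S = 1 \<and> measure (snd p) S = 0)"
  proof
    fix p assume p: "p \<in> E \<times> E"
    show "\<exists>S. S \<in> sets M0 \<and> (fst p \<noteq> snd p \<longrightarrow> measure (fst p) S = 1 \<and> measure (snd p) S = 0)"
    proof (cases "fst p = snd p")
      case True
      then show ?thesis using H0_sets by blast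
    next
      case False
      then show ?thesis using ergodic_singular[of "fst p" "snd p"] p E(2) by (auto simp: subset_iff)
    qed
  qed
  from bchoice[OF this] obtain S where S: "\<forall>p\<in>E \<times> E. S p \<in> sets M0 \<and> (fst p \<noteq> snd p \<longrightarrow> measure (fst p) (S p) = 1 \<and> measure (snd p) (S p) = 0)"
    by (elim exE)
  have S1: "S (\<eta>, \<eta>') \<in> sets M0" if "\<eta> \<in> E" "\<eta>' \<in> E" for \<eta> \<eta>'
    using S[rule_format, of "(\<eta>, \<eta>')"] that by simp
  have S2: "measure \<eta> (S (\<eta>, \<eta>')) = 1" "measure \<eta>' (S (\<eta>, \<eta>')) = 0"
    if "\<eta> \<in> E" "\<eta>' \<in> E" "\<eta> \<noteq> \<eta>'" for \<eta> \<eta>'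
    using S[rule_format, of "(\<eta>, \<eta>')"] that by simp_all
  define Q where "Q \<eta> = H0 \<inter> (\<Inter>\<eta>'\<in>E - {\<eta>}. S (\<eta>, \<eta>'))" for \<eta>
  have Q: "Q \<eta> \<in> sets M0" if "\<eta> \<in> E" for \<eta>
  proof (cases "E - {\<eta>} = {}")
    case True
    then show ?thesis using H0_sets unfolding Q_def True by simp
  next
    case False
    then show ?thesis unfolding Q_def using S1 that E(1) H0_sets by (intro sets.Int sets.finite_INT) auto
  qed
  have Q1: "measure \<eta> (Q \<eta>) = 1" if \<eta>: "\<eta> \<in> E" for \<eta>
  proof -
    interpret prob_space \<eta> using s[OF \<eta>] by simp
    have "AE h in \<eta>. \<forall>\<eta>'\<in>E - {\<eta>}. h \<in> S (\<eta>, \<eta>')"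
    proof (rule AE_finite_allI)
      show "finite (E - {\<eta>})" using E(1) by simp
      fix \<eta>' assume "\<eta>' \<in> E - {\<eta>}"
      then show "AE h in \<eta>. h \<in> S (\<eta>, \<eta>')"
        using S1[OF \<eta>, of \<eta>'] S2(1)[OF \<eta>, of \<eta>'] s[OF \<eta>] by (subst prob_eq_1[symmetric]) auto
    qed
    then have "AE h in \<eta>. h \<in> Q \<eta>" using s[OF \<eta>] by (auto simp: Q_def)
    then show ?thesis using prob_eq_1[of "Q \<eta>"] Q[OF \<eta>] s[OF \<eta>] by simp
  qed
  have Q0: "measure \<eta>' (Q \<eta>) = 0" if \<eta>: "\<eta> \<in> E" "\<eta>' \<in> E" "\<eta> \<noteq> \<eta>'" for \<eta> \<eta>'
  proof -
    interpret prob_space \<eta>' using s[OF \<eta>(2)] by simp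
    have "prob (Q \<eta>) \<le> prob (S (\<eta>, \<eta>'))"
      using \<eta> S1[OF \<eta>(1,2)] s[OF \<eta>(2)] by (intro finite_measure_mono) (auto simp: Q_def)
    then show ?thesis using S2(2)[OF \<eta>] measure_nonneg[of \<eta>' "Q \<eta>"] by simp
  qed
  define k where "k = card E"
  define \<delta> where "\<delta> = 1 / (2 * (real k + 1))"
  have \<delta>: "0 < \<delta>" "real (k + 1) * \<delta> = 1 / 2" by (auto simp: \<delta>_def field_simps)
  have "\<forall>\<eta>\<in>E. \<exists>V. V \<in> local_sets \<and> (\<forall>\<eta>'\<in>E. measure \<eta>' ((Q \<eta> - V) \<union> (V - Q \<eta>)) < \<delta>)"
    using approx_by_local[OF E(1) _ Q \<delta>(1)] s by blast
  from bchoice[OF this] obtain V where V: "\<forall>\<eta>\<in>E. V \<eta> \<in> local_sets \<and> (\<forall>\<eta>'\<in>E. measure \<eta>' ((Q \<eta> - V \<eta>) \<union> (V \<eta> - Q \<eta>)) < \<delta>)"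
    by (elim exE)
  obtain n where n: "\<forall>\<eta>\<in>E. local_at n (V \<eta>)" using local_common_level[OF E(1), of V] V by blast
  define U where "U \<eta> = V \<eta> - (\<Union>\<eta>'\<in>E - {\<eta>}. V \<eta>')" for \<eta>
  have "local_at n (U \<eta>)" if "\<eta> \<in> E" for \<eta>
    unfolding U_def using n that by (intro local_at_Diff local_at_UN) auto
  moreover have "1 / 2 \<le> measure \<eta> (U \<eta>)" if \<eta>: "\<eta> \<in> E" for \<eta>
  proof -
    interpret prob_space \<eta> using s[OF \<eta>] by simp
    have Vs: "V \<eta>' \<in> sets \<eta>" if "\<eta>' \<in> E" for \<eta>' using V that local_in_sets s[OF \<eta>] by auto
    have Qs: "Q \<eta>' \<in> sets \<eta>" if "\<eta>' \<in> E" for \<eta>' using Q that s[OF \<eta>] by auto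
    define W where "W \<eta>' = (Q \<eta>' - V \<eta>') \<union> (V \<eta>' - Q \<eta>')" for \<eta>'
    have Ws: "W \<eta>' \<in> sets \<eta>" "prob (W \<eta>') < \<delta>" if "\<eta>' \<in> E" for \<eta>'
      using V that Vs Qs \<eta> by (auto simp: W_def)
    have Us: "U \<eta> \<in> sets \<eta>" unfolding U_def using Vs \<eta> E(1) by (intro sets.Diff sets.finite_UN) auto
    have V0: "prob (V \<eta>') \<le> \<delta>" if "\<eta>' \<in> E - {\<eta>}" for \<eta>'
    proof -
      have "prob (V \<eta>') \<le> prob (Q \<eta>' \<union> W \<eta>')"
        using that Qs Ws by (intro finite_measure_mono) (auto simp: W_def)
      also have "\<dots> \<le> prob (Q \<eta>') + prob (W \<eta>')" using that Qs Ws by (intro measure_Un_le) auto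
      finally show ?thesis using Q0[of \<eta>' \<eta>] Ws(2)[of \<eta>'] that \<eta> by auto
    qed
    have "1 = prob (Q \<eta>)" using Q1[OF \<eta>] by simp
    also have "\<dots> \<le> prob (U \<eta> \<union> (W \<eta> \<union> (\<Union>\<eta>'\<in>E - {\<eta>}. V \<eta>')))"
      using \<eta> E(1) Us Ws Vs by (intro finite_measure_mono sets.Un sets.finite_UN) (auto simp: U_def W_def)
    also have "\<dots> \<le> prob (U \<eta>) + prob (W \<eta> \<union> (\<Union>\<eta>'\<in>E - {\<eta>}. V \<eta>'))"
      using \<eta> E(1) Us Ws Vs by (intro measure_Un_le sets.Un sets.finite_UN) auto
    also have "prob (W \<eta> \<union> (\<Union>\<eta>'\<in>E - {\<eta>}. V \<eta>')) \<le> prob (W \<eta>) + prob (\<Union>\<eta>'\<in>E - {\<eta>}. V \<eta>')"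
      using \<eta> E(1) Ws Vs by (intro measure_Un_le sets.finite_UN) auto
    also have "prob (\<Union>\<eta>'\<in>E - {\<eta>}. V \<eta>') \<le> (\<Sum>\<eta>'\<in>E - {\<eta>}. prob (V \<eta>'))"
      using Vs E(1) by (intro finite_measure_subadditive_finite) auto
    also have "\<dots> \<le> (\<Sum>\<eta>'\<in>E - {\<eta>}. \<delta>)" by (intro sum_mono V0)
    also have "\<dots> \<le> real k * \<delta>" using \<delta>(1) E(1) by (simp add: k_def card_Diff1_le mult_right_mono)
    finally show ?thesis using Ws(2)[OF \<eta>] \<delta> by (simp add: algebra_simps)
  qed
  moreover have "U \<eta> \<inter> U \<eta>' = {}" if "\<eta> \<in> E" "\<eta>' \<in> E" "\<eta> \<noteq> \<eta>'" for \<eta> \<eta>'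
    using that by (auto simp: U_def)
  ultimately show ?thesis by blast
qed

text \<open>The number of germs at a deep point: values on the ball of radius \<open>4 * D\<close>, normalised
  at its centre.\<close>

definition germ_bound :: nat where
  "germ_bound = card (PiE (ball_at \<one> (4 * D)) (\<lambda>_. {- 4 * D..4 * D}))"

text \<open>Choose an element of the deep set in each of the sets.  Elements with the same germ at \<open>x\<close> agree on the ball
  of radius \<open>n\<close>, hence lie in the same local set.\<close>

lemma deep_set_multiplicity:
  assumes x: "x \<in> sphere_one n" and "m \<le> n" and "finite E"
    and U: "\<And>\<eta>. \<eta> \<in> E \<Longrightarrow> local_at m (U \<eta>)" "\<And>\<eta> \<eta>'. \<eta> \<in> E \<Longrightarrow> \<eta>' \<in> E \<Longrightarrow> \<eta> \<noteq> \<eta>' \<Longrightarrow> U \<eta> \<inter> U \<eta>' = {}"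
  shows "card {\<eta> \<in> E. deep_set n x \<inter> U \<eta> \<noteq> {}} \<le> germ_bound"
proof -
  have xc: "x \<in> carrier G" "wd \<one> x = int n" using x by (auto simp: sphere_one_def)
  define I where "I = {\<eta> \<in> E. deep_set n x \<inter> U \<eta> \<noteq> {}}"
  have "\<forall>\<eta>\<in>I. \<exists>h. h \<in> deep_set n x \<inter> U \<eta>" by (auto simp: I_def)
  from bchoice[OF this] obtain k where k: "\<forall>\<eta>\<in>I. k \<eta> \<in> deep_set n x \<inter> U \<eta>" by (elim exE)
  have kH: "k \<eta> \<in> horo G A" "k \<eta> \<one> = 0" "k \<eta> x = - int n" "k \<eta> \<in> H0" if "\<eta> \<in> I" for \<eta>
    using k that by (auto simp: deep_set_def H0_iff)
  define germ where "germ \<eta> = (\<lambda>z\<in>ball_at \<one> (4 * D). k \<eta> (x \<otimes> z) + int n)" for \<eta>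
  have "germ ` I \<subseteq> PiE (ball_at \<one> (4 * D)) (\<lambda>_. {- 4 * D..4 * D})"
  proof (intro image_subsetI PiE_I)
    fix \<eta> z assume \<eta>: "\<eta> \<in> I" and z: "z \<in> ball_at \<one> (4 * D)"
    have zc: "z \<in> carrier G" "wd x (x \<otimes> z) \<le> 4 * D"
      using z wd_left[OF xc(1) one_closed, of z] xc(1) by (auto simp: ball_at_def)
    have "k \<eta> (x \<otimes> z) \<le> k \<eta> x + wd (x \<otimes> z) x" "k \<eta> x \<le> k \<eta> (x \<otimes> z) + wd x (x \<otimes> z)"
      using horo_lip[OF kH(1)[OF \<eta>]] xc zc by auto
    moreover have "wd (x \<otimes> z) x = wd x (x \<otimes> z)" using xc zc by (intro d_sym) auto
    ultimately show "germ \<eta> z \<in> {- 4 * D..4 * D}" using kH(3)[OF \<eta>] zc(2) z by (simp add: germ_def)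
  qed (auto simp: germ_def)
  moreover have "inj_on germ I"
  proof (rule inj_onI, rule ccontr)
    fix \<eta> \<eta>' assume \<eta>: "\<eta> \<in> I" "\<eta>' \<in> I" "germ \<eta> = germ \<eta>'" "\<eta> \<noteq> \<eta>'"
    have agree: "k \<eta> z = k \<eta>' z" if z: "z \<in> ball_at x (4 * D)" for z
    proof -
      obtain y where y: "y \<in> ball_at \<one> (4 * D)" "z = x \<otimes> y" using z ball_at_translate[OF xc(1)] by blast
      show ?thesis using fun_cong[OF \<eta>(3), of y] y by (simp add: germ_def)
    qed
    have "k \<eta> y = k \<eta>' y" if y: "y \<in> ball_at \<one> (int m)" for y
      by (rule determined_by_deep_values[OF kH(1-3)[OF \<eta>(1)] kH(1-3)[OF \<eta>(2)] xc agree])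
        (use y \<open>m \<le> n\<close> in \<open>auto simp: ball_at_def\<close>)
    then have "k \<eta>' \<in> U \<eta>"
      using local_atD(2)[OF U(1), of \<eta> "k \<eta>" "k \<eta>'"] k \<eta> kH(4)[OF \<eta>(2)] by (auto simp: I_def)
    then show False using U(2)[of \<eta> \<eta>'] k \<eta> by (auto simp: I_def)
  qed
  moreover have "finite (PiE (ball_at \<one> (4 * D)) (\<lambda>_. {- 4 * D..4 * D}))"
    by (intro finite_PiE finite_ball_at) auto
  ultimately show ?thesis unfolding germ_bound_def I_def by (intro card_inj_on_le)
qed

text \<open>Pairs of a measure and a point of the sphere whose deep set meets the support of the measure are counted
  in two ways.  The mass bound gives each measure a definite proportion of the sphere, and
  the number of germs bounds the measures at each point.\<close>

lemma finite_ergodic: "finite {\<eta> \<in> invariant_measures G A. ergodic_measure G A \<eta>}"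
proof -
  obtain C where C: "C > 0" "\<And>m. \<exists>n\<ge>m. \<forall>\<eta>\<in>invariant_measures G A. \<forall>x\<in>sphere_one n.
     real (card (sphere_one n)) * measure \<eta> (deep_set n x) \<le> C"
    using deep_set_mass_uniform by blast
  have bound: "real (card E) \<le> 2 * C * real germ_bound"
    if E: "finite E" "E \<subseteq> {\<eta> \<in> invariant_measures G A. ergodic_measure G A \<eta>}" for E
  proof (cases "E = {}")
    case True
    then show ?thesis using C(1) by simp
  next
    case False
    from disjoint_local_supports[OF E] obtain m U where
      U': "\<forall>\<eta>\<in>E. local_at m (U \<eta>) \<and> 1 / 2 \<le> measure \<eta> (U \<eta>)"
        "\<forall>\<eta>\<in>E. \<forall>\<eta>'\<in>E. \<eta> \<noteq> \<eta>' \<longrightarrow> U \<eta> \<inter> U \<eta>' = {}"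
      by (elim exE conjE)
    note U = bspec[OF U'(1), THEN conjunct1] bspec[OF U'(1), THEN conjunct2] U'(2)[rule_format]
    from C(2)[of m] obtain n where n: "n \<ge> m" "\<forall>\<eta>\<in>invariant_measures G A. \<forall>x\<in>sphere_one n.
        real (card (sphere_one n)) * measure \<eta> (deep_set n x) \<le> C"
      by (elim exE conjE)
    define c where "c = real (card (sphere_one n))"
    define I where "I \<eta> = {x \<in> sphere_one n. deep_set n x \<inter> U \<eta> \<noteq> {}}" for \<eta>
    have fI: "finite (I \<eta>)" for \<eta> using finite_sphere_one by (simp add: I_def)
    have half: "c \<le> 2 * C * real (card (I \<eta>)) \<and> 0 < c" if \<eta>: "\<eta> \<in> E" for \<eta>
    proof -
      have inv: "\<eta> \<in> invariant_measures G A" using E(2) \<eta> by blast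
      note s = invariant_measuresD[OF inv]
      interpret prob_space \<eta> by fact
      have Ud: "U \<eta> \<subseteq> (\<Union>x\<in>I \<eta>. deep_set n x)"
      proof
        fix h assume h: "h \<in> U \<eta>"
        then have hH: "h \<in> H0" using local_atD(1)[OF U(1)[OF \<eta>]] by blast
        then obtain x where "x \<in> sphere_one n" "h x = - int n" using deep_point_exists[of h n] by (auto simp: H0_iff)
        then show "h \<in> (\<Union>x\<in>I \<eta>. deep_set n x)" using h hH by (auto simp: I_def deep_set_def)
      qed
      have ds: "deep_set n x \<in> sets \<eta>" if "x \<in> I \<eta>" for x
        using that deep_set_sets s by (auto simp: I_def sphere_one_def)
      have "1 / 2 \<le> prob (\<Union>x\<in>I \<eta>. deep_set n x)"
        using U(2)[OF \<eta>] Ud ds fI by (intro order_trans[OF U(2)[OF \<eta>]] finite_measure_mono sets.finite_UN) auto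
      also have "\<dots> \<le> (\<Sum>x\<in>I \<eta>. prob (deep_set n x))"
        using ds fI by (intro finite_measure_subadditive_finite) auto
      finally have sum: "1 / 2 \<le> (\<Sum>x\<in>I \<eta>. prob (deep_set n x))" .
      have "I \<eta> \<noteq> {}" using sum by auto
      then have "sphere_one n \<noteq> {}" by (auto simp: I_def)
      then have c0: "0 < c" using finite_sphere_one by (simp add: c_def card_gt_0_iff)
      have "c * (1 / 2) \<le> c * (\<Sum>x\<in>I \<eta>. prob (deep_set n x))" using sum c0 by (intro mult_left_mono) auto
      also have "\<dots> = (\<Sum>x\<in>I \<eta>. c * prob (deep_set n x))" by (rule sum_distrib_left)
      also have "\<dots> \<le> (\<Sum>x\<in>I \<eta>. C)" using n(2) inv unfolding c_def by (intro sum_mono) (simp add: I_def)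
      finally show ?thesis using c0 by (simp add: algebra_simps)
    qed
    have "real (card E) * c = (\<Sum>\<eta>\<in>E. c)" by simp
    also have "\<dots> \<le> (\<Sum>\<eta>\<in>E. 2 * C * real (card (I \<eta>)))" using half by (intro sum_mono) blast
    also have "\<dots> = 2 * C * real (\<Sum>\<eta>\<in>E. card (I \<eta>))" by (simp add: sum_distrib_left)
    also have "(\<Sum>\<eta>\<in>E. card (I \<eta>)) = (\<Sum>x\<in>sphere_one n. card {\<eta> \<in> E. deep_set n x \<inter> U \<eta> \<noteq> {}})"
    proof -
      have "(\<Sum>\<eta>\<in>E. card (I \<eta>)) = (\<Sum>\<eta>\<in>E. \<Sum>x\<in>sphere_one n. of_bool (deep_set n x \<inter> U \<eta> \<noteq> {}))"
        using finite_sphere_one by (simp add: I_def of_bool_def sum.If_cases Int_def)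
      also have "\<dots> = (\<Sum>x\<in>sphere_one n. \<Sum>\<eta>\<in>E. of_bool (deep_set n x \<inter> U \<eta> \<noteq> {}))" by (rule sum.swap)
      also have "\<dots> = (\<Sum>x\<in>sphere_one n. card {\<eta> \<in> E. deep_set n x \<inter> U \<eta> \<noteq> {}})"
        using E(1) by (simp add: of_bool_def sum.If_cases Int_def)
      finally show ?thesis .
    qed
    also have "2 * C * real (\<Sum>x\<in>sphere_one n. card {\<eta> \<in> E. deep_set n x \<inter> U \<eta> \<noteq> {}})
        \<le> 2 * C * real (\<Sum>x\<in>sphere_one n. germ_bound)"
    proof -
      have "(\<Sum>x\<in>sphere_one n. card {\<eta> \<in> E. deep_set n x \<inter> U \<eta> \<noteq> {}}) \<le> (\<Sum>x\<in>sphere_one n. germ_bound)"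
      proof (rule sum_mono)
        fix x assume x: "x \<in> sphere_one n"
        show "card {\<eta> \<in> E. deep_set n x \<inter> U \<eta> \<noteq> {}} \<le> germ_bound"
          by (rule deep_set_multiplicity[OF x n(1) E(1), of U]) (fact U(1), fact U(3))
      qed
      then have "real (\<Sum>x\<in>sphere_one n. card {\<eta> \<in> E. deep_set n x \<inter> U \<eta> \<noteq> {}})
          \<le> real (\<Sum>x\<in>sphere_one n. germ_bound)" by (rule of_nat_mono)
      then show ?thesis by (rule mult_left_mono) (use C(1) in simp)
    qed
    also have "\<dots> = 2 * C * real germ_bound * c" by (simp add: c_def)
    finally show ?thesis using half False by fastforce
  qed
  show ?thesis
  proof (rule ccontr)
    assume "infinite {\<eta> \<in> invariant_measures G A. ergodic_measure G A \<eta>}"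
    then obtain E where "finite E" "card E = nat \<lceil>2 * C * real germ_bound\<rceil> + 1"
      "E \<subseteq> {\<eta> \<in> invariant_measures G A. ergodic_measure G A \<eta>}"
      using infinite_arbitrarily_large by blast
    then show False using bound[of E] by linarith
  qed
qed

end


section \<open>Existence of an invariant measure\<close>

text \<open>A cluster point in the compact cube.  Passing to a finer filter instead of a subsequence allows for
  uncountably many coordinates, here all sets of functions.\<close>

lemma common_limit_filter:
  fixes v :: "nat \<Rightarrow> 'i \<Rightarrow> real"
  assumes "\<And>n i. v n i \<in> {0..1}"
  shows "\<exists>m F. F \<noteq> bot \<and> F \<le> sequentially \<and> (\<forall>i. ((\<lambda>n. v n i) \<longlongrightarrow> m i) F)"
proof -
  define K :: "('i \<Rightarrow> real) set" where "K = PiE UNIV (\<lambda>_. {0..1})"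
  have "compactin (product_topology (\<lambda>i. euclidean) UNIV) K"
    unfolding K_def compactin_PiE by simp
  then have "compact K" by (simp add: euclidean_product_topology)
  moreover have "filtermap v sequentially \<noteq> bot" by (simp add: filtermap_bot_iff)
  moreover have "eventually (\<lambda>x. x \<in> K) (filtermap v sequentially)"
    unfolding eventually_filtermap by (rule always_eventually) (use assms in \<open>auto simp: K_def PiE_iff\<close>)
  ultimately obtain m where m: "inf (nhds m) (filtermap v sequentially) \<noteq> bot"
    unfolding compact_filter by blast
  define F where "F = inf (filtercomap v (nhds m)) sequentially"
  have "F \<noteq> bot"
  proof
    assume "F = bot"
    then have "eventually (\<lambda>_. False) F" by simp
    then obtain P Q where PQ: "eventually P (filtercomap v (nhds m))" "eventually Q sequentially"
      "\<And>n. P n \<Longrightarrow> Q n \<Longrightarrow> False"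
      unfolding F_def eventually_inf by blast
    obtain P' where P': "eventually P' (nhds m)" "\<And>n. P' (v n) \<Longrightarrow> P n"
      using PQ(1) unfolding eventually_filtercomap by blast
    have "eventually (\<lambda>y. \<not> P' y) (filtermap v sequentially)"
      unfolding eventually_filtermap using PQ(2) by (rule eventually_mono) (use PQ(3) P'(2) in blast)
    then have "eventually (\<lambda>_. False) (inf (nhds m) (filtermap v sequentially))"
      unfolding eventually_inf using P'(1) by blast
    then show False using m by (simp add: trivial_limit_def)
  qed
  moreover have "F \<le> sequentially" by (simp add: F_def)
  moreover have lim: "(v \<longlongrightarrow> m) F"
    unfolding filterlim_def F_def filtermap_le_iff_le_filtercomap by simp
  have "((\<lambda>n. v n i) \<longlongrightarrow> m i) F" for i
    unfolding tendsto_def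
  proof (intro allI impI)
    fix S :: "real set" assume S: "open S" "m i \<in> S"
    have "open ((\<lambda>x. x i) -` S)" by (rule open_vimage[OF S(1)]) simp
    from topological_tendstoD[OF lim this] S(2) show "eventually (\<lambda>n. v n i \<in> S) F" by simp
  qed
  ultimately show ?thesis by blast
qed

context hyperbolic_cayley
begin

lemma translate_in_trans_dom:
  assumes "g \<in> carrier G" "h \<in> H0" "translate G g h \<in> H0"
  shows "h \<in> trans_dom g"
  using translate_H0_iff assms by blast

lemma partial_transformation_preimage:
  assumes pt: "partial_transformation G A B E \<phi>" and W: "W \<in> sets M0"
  shows "{h \<in> B. \<phi> h \<in> W} \<in> sets M0"
proof -
  have BE: "B \<in> sets M0" "E \<in> sets M0" "\<phi> ` B = E"
    "\<phi> \<in> restrict_space M0 B \<rightarrow>\<^sub>M restrict_space M0 E"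
    using pt by (auto simp: partial_transformation_def bij_betw_def)
  have sub: "B \<subseteq> H0" using sets.sets_into_space[OF BE(1)] by simp
  have "W \<inter> E \<in> sets (restrict_space M0 E)" using W BE(2) by (simp add: restrict_sets_iff)
  from measurable_sets[OF BE(4) this]
  have "\<phi> -` (W \<inter> E) \<inter> space (restrict_space M0 B) \<in> sets M0" using BE(1) by (simp add: restrict_sets_iff)
  moreover have "\<phi> -` (W \<inter> E) \<inter> space (restrict_space M0 B) = {h \<in> B. \<phi> h \<in> W}"
    using sub BE(3) by (auto simp: space_restrict_space)
  ultimately show ?thesis by simp
qed

text \<open>A partial transformation is on each piece of a countable partition the translation by one
  group element.\<close>

lemma invariant_if_translations:
  assumes s: "sets \<eta> = sets M0" "prob_space \<eta>"
    and inv: "\<And>g B. g \<in> carrier G \<Longrightarrow> B \<in> sets M0 \<Longrightarrow> B \<subseteq> trans_dom g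
      \<Longrightarrow> emeasure \<eta> (translate G g ` B) = emeasure \<eta> B"
  shows "\<eta> \<in> invariant_measures G A"
proof -
  have sp: "space \<eta> = H0" using sets_eq_imp_space_eq[OF s(1)] by simp
  have "distr (restrict_space \<eta> B) (restrict_space \<eta> E) \<phi> = restrict_space \<eta> E"
    if pt: "partial_transformation G A B E \<phi>" for B E \<phi>
  proof (rule measure_eqI)
    show "sets (distr (restrict_space \<eta> B) (restrict_space \<eta> E) \<phi>) = sets (restrict_space \<eta> E)" by simp
    have BE: "B \<in> sets M0" "E \<in> sets M0" "bij_betw \<phi> B E" "\<And>h. h \<in> B \<Longrightarrow> (h, \<phi> h) \<in> horo_rel G A"
      using pt by (auto simp: partial_transformation_def)
    have sub: "B \<subseteq> H0" "E \<subseteq> H0" using sets.sets_into_space[OF BE(1)] sets.sets_into_space[OF BE(2)] by auto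
    have meas: "\<phi> \<in> restrict_space \<eta> B \<rightarrow>\<^sub>M restrict_space \<eta> E"
      using pt measurable_cong_sets[OF sets_restrict_space_cong[OF s(1)] sets_restrict_space_cong[OF s(1)]]
      unfolding partial_transformation_def by blast
    fix V assume "V \<in> sets (distr (restrict_space \<eta> B) (restrict_space \<eta> E) \<phi>)"
    then have VE: "V \<in> sets (restrict_space \<eta> E)" by simp
    then have V: "V \<in> sets M0" "V \<subseteq> E" using BE(2) s(1) by (simp_all add: restrict_sets_iff)
    define Q where "Q = {h \<in> B. \<phi> h \<in> V}"
    have Q: "Q \<in> sets M0" unfolding Q_def by (rule partial_transformation_preimage[OF pt V(1)])
    have \<phi>Q: "\<phi> ` Q = V" "inj_on \<phi> Q"
      using BE(3) V(2) by (auto simp: Q_def bij_betw_def inj_on_def)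
    define e where "e = from_nat_into (carrier G)"
    have e: "e i \<in> carrier G" for i unfolding e_def using from_nat_into[of "carrier G" i] by blast
    have re: "range e = carrier G" unfolding e_def using range_from_nat_into[OF _ countable_carrier] by blast
    define F where "F i = {h \<in> Q. h \<in> trans_dom (e i) \<and> \<phi> h = translate G (e i) h}" for i
    have F: "F i \<in> sets M0" for i
    proof -
      have eq: "F i = (\<Inter>f\<in>carrier G. \<Union>v::int. Q \<inter> trans_dom (e i) \<inter> {h \<in> H0. h (inv (e i) \<otimes> f) = v}
          \<inter> {h \<in> B. \<phi> h \<in> {h' \<in> H0. h' f = v}})" (is "_ = ?R")
      proof
        show "F i \<subseteq> ?R"
        proof
          fix h assume h: "h \<in> F i"
          then have hB: "h \<in> B" "h \<in> H0" "\<phi> h \<in> H0" using sub V by (auto simp: F_def Q_def)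
          have "\<phi> h f = h (inv (e i) \<otimes> f)" if "f \<in> carrier G" for f
            using h that by (simp add: F_def translate_apply)
          then show "h \<in> ?R" using h hB by (auto simp: F_def)
        qed
        show "?R \<subseteq> F i"
        proof
          fix h assume h: "h \<in> ?R"
          then have hQ: "h \<in> Q" "h \<in> trans_dom (e i)" using one_closed by auto
          have eqf: "\<phi> h f = h (inv (e i) \<otimes> f)" if "f \<in> carrier G" for f using h that by auto
          have "\<phi> h \<in> H0" using hQ(1) V sub by (auto simp: Q_def)
          then have ext: "\<phi> h \<in> extensional (carrier G)" using horoD(4) by (simp add: H0_iff)
          have "\<phi> h = translate G (e i) h"
          proof
            fix f show "\<phi> h f = translate G (e i) h f"
              using eqf[of f] ext by (cases "f \<in> carrier G") (auto simp: translate_def extensional_def)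
          qed
          then show "h \<in> F i" using hQ by (simp add: F_def)
        qed
      qed
      show ?thesis unfolding eq
      proof (rule sets.countable_INT'[OF countable_carrier])
        show "carrier G \<noteq> {}" using one_closed by blast
        show "(\<lambda>f. \<Union>v::int. Q \<inter> trans_dom (e i) \<inter> {h \<in> H0. h (inv (e i) \<otimes> f) = v}
          \<inter> {h \<in> B. \<phi> h \<in> {h' \<in> H0. h' f = v}}) ` carrier G \<subseteq> sets M0"
        proof (rule image_subsetI, rule sets.countable_UN'')
          fix f and v :: int assume f: "f \<in> carrier G"
          have "inv (e i) \<otimes> f \<in> carrier G" using f e by simp
          then show "Q \<inter> trans_dom (e i) \<inter> {h \<in> H0. h (inv (e i) \<otimes> f) = v}
              \<inter> {h \<in> B. \<phi> h \<in> {h' \<in> H0. h' f = v}} \<in> sets M0"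
            using Q trans_dom_sets[OF e] value_in_sets[of "inv (e i) \<otimes> f" "\<lambda>w. w = v"]
              partial_transformation_preimage[OF pt value_in_sets[OF f, of "\<lambda>w. w = v"]]
            by (intro sets.Int) auto
        qed auto
      qed
    qed
    have UF: "(\<Union>i. F i) = Q"
    proof
      show "(\<Union>i. F i) \<subseteq> Q" by (auto simp: F_def)
      show "Q \<subseteq> (\<Union>i. F i)"
      proof
        fix h assume h: "h \<in> Q"
        then have "(h, \<phi> h) \<in> horo_rel G A" using BE(4) by (simp add: Q_def)
        then obtain g where g: "g \<in> carrier G" "\<phi> h = translate G g h" "h \<in> H0" "translate G g h \<in> H0"
          unfolding horo_rel_def by blast
        obtain i where i: "g = e i" using g(1) re by blast
        have "h \<in> F i" using h g translate_in_trans_dom[OF g(1,3,4)] i by (simp add: F_def)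
        then show "h \<in> (\<Union>i. F i)" by blast
      qed
    qed
    define Z where "Z = disjointed F"
    have Z: "Z i \<in> sets M0" "Z i \<subseteq> F i" for i
      using sets.range_disjointed_sets[of F M0] F disjointed_subset[of F i] by (auto simp: Z_def)
    have dZ: "disjoint_family Z" unfolding Z_def by (rule disjoint_family_disjointed)
    have UZ: "(\<Union>i. Z i) = Q" unfolding Z_def UN_disjointed_eq UF ..
    have img: "\<phi> ` Z i = translate G (e i) ` Z i" for i
      using Z(2)[of i] by (intro image_cong) (auto simp: F_def)
    have ZD: "Z i \<subseteq> trans_dom (e i)" for i using Z(2)[of i] by (auto simp: F_def)
    have imgs: "\<phi> ` Z i \<in> sets M0" for i unfolding img by (rule translate_image_sets[OF e Z(1) ZD])
    have dimg: "disjoint_family (\<lambda>i. \<phi> ` Z i)"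
      unfolding disjoint_family_on_def
    proof (intro ballI impI)
      fix i j :: nat assume "i \<noteq> j"
      then have "Z i \<inter> Z j = {}" using dZ by (auto simp: disjoint_family_on_def)
      moreover have "Z i \<subseteq> Q" "Z j \<subseteq> Q" using UZ by auto
      ultimately show "\<phi> ` Z i \<inter> \<phi> ` Z j = {}" using \<phi>Q(2) by (simp flip: inj_on_image_Int)
    qed
    have Uimg: "(\<Union>i. \<phi> ` Z i) = V" using UZ \<phi>Q(1) by blast
    have "emeasure \<eta> V = suminf (\<lambda>i. emeasure \<eta> (\<phi> ` Z i))"
    proof -
      have "range (\<lambda>i. \<phi> ` Z i) \<subseteq> sets \<eta>" using imgs s(1) by auto
      from suminf_emeasure[OF this dimg] show ?thesis using Uimg by simp
    qed
    also have "\<dots> = suminf (\<lambda>i. emeasure \<eta> (Z i))" unfolding img using inv[OF e Z(1) ZD] by simp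
    also have "\<dots> = emeasure \<eta> Q"
    proof -
      have "range Z \<subseteq> sets \<eta>" using Z(1) s(1) by auto
      from suminf_emeasure[OF this dZ] show ?thesis using UZ by simp
    qed
    finally have VQ: "emeasure \<eta> V = emeasure \<eta> Q" .
    have "emeasure (distr (restrict_space \<eta> B) (restrict_space \<eta> E) \<phi>) V
        = emeasure (restrict_space \<eta> B) (\<phi> -` V \<inter> space (restrict_space \<eta> B))"
      by (rule emeasure_distr[OF meas VE])
    also have "\<phi> -` V \<inter> space (restrict_space \<eta> B) = Q" using sub sp by (auto simp: Q_def space_restrict_space)
    also have "emeasure (restrict_space \<eta> B) Q = emeasure \<eta> Q"
      using BE(1) s(1) by (intro emeasure_restrict) (auto simp: Q_def)
    also have "\<dots> = emeasure (restrict_space \<eta> E) V"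
      using BE(2) V(2) s(1) VQ by (simp add: emeasure_restrict)
    finally show "emeasure (distr (restrict_space \<eta> B) (restrict_space \<eta> E) \<phi>) V = emeasure (restrict_space \<eta> E) V" .
  qed
  then show ?thesis using s unfolding invariant_measures_def by blast
qed

subsection \<open>The compact space of normalised functions\<close>

text \<open>A compact space that contains the normalised horofunctions as well as the normalised distance functions of
  points of the group.  The latter are not horofunctions, since they have a minimum.\<close>

definition norm_funs :: "('a \<Rightarrow> int) set" where
  "norm_funs = PiE (carrier G) (\<lambda>g. {- wd \<one> g..wd \<one> g})"

definition cyl_at :: "nat \<Rightarrow> ('a \<Rightarrow> int) set \<Rightarrow> bool" where
  "cyl_at n U \<longleftrightarrow> U \<subseteq> norm_funs \<and> (\<forall>h\<in>U. \<forall>h'\<in>norm_funs.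
     (\<forall>y\<in>ball_at \<one> (int n). h y = h' y) \<longrightarrow> h' \<in> U)"

definition cyls :: "('a \<Rightarrow> int) set set" where
  "cyls = {U. \<exists>n. cyl_at n U}"

lemma cyl_atD:
  assumes "cyl_at n U"
  shows "U \<subseteq> norm_funs"
    "h \<in> U \<Longrightarrow> h' \<in> norm_funs \<Longrightarrow> (\<And>y. y \<in> ball_at \<one> (int n) \<Longrightarrow> h y = h' y) \<Longrightarrow> h' \<in> U"
  using assms unfolding cyl_at_def by blast+

lemma cyl_atI:
  assumes "U \<subseteq> norm_funs"
    "\<And>h h'. h \<in> U \<Longrightarrow> h' \<in> norm_funs \<Longrightarrow> (\<And>y. y \<in> ball_at \<one> (int n) \<Longrightarrow> h y = h' y) \<Longrightarrow> h' \<in> U"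
  shows "cyl_at n U"
  using assms unfolding cyl_at_def by blast

lemma ball_mono: "n \<le> m \<Longrightarrow> ball_at x (int n) \<subseteq> ball_at x (int m)"
  by (auto simp: ball_at_def)

lemma cyl_at_mono:
  assumes "cyl_at n U" "n \<le> m"
  shows "cyl_at m U"
proof (rule cyl_atI)
  show "U \<subseteq> norm_funs" by (rule cyl_atD(1)[OF assms(1)])
  fix h h' assume h: "h \<in> U" "h' \<in> norm_funs" and eq: "\<And>y. y \<in> ball_at \<one> (int m) \<Longrightarrow> h y = h' y"
  show "h' \<in> U" using eq ball_mono[OF assms(2), of \<one>] by (intro cyl_atD(2)[OF assms(1) h]) blast
qed

lemma cyl_at_compl: "cyl_at n U \<Longrightarrow> cyl_at n (norm_funs - U)"
proof (rule cyl_atI)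
  fix h h' assume U: "cyl_at n U" and h: "h \<in> norm_funs - U" "h' \<in> norm_funs"
    and eq: "\<And>y. y \<in> ball_at \<one> (int n) \<Longrightarrow> h y = h' y"
  have "h \<in> U" if "h' \<in> U" using cyl_atD(2)[OF U that, of h] h eq by simp
  then show "h' \<in> norm_funs - U" using h by blast
qed auto

lemma cyls_algebra: "Sigma_Algebra.algebra norm_funs cyls"
  unfolding algebra_iff_Un
proof (intro conjI ballI)
  show "cyls \<subseteq> Pow norm_funs" by (auto simp: cyls_def dest: cyl_atD(1))
  have "cyl_at 0 {}" by (rule cyl_atI) auto
  then show "{} \<in> cyls" by (auto simp: cyls_def)
  show "norm_funs - U \<in> cyls" if "U \<in> cyls" for U
    using that cyl_at_compl by (auto simp: cyls_def)
  fix U V assume "U \<in> cyls" "V \<in> cyls"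
  then obtain n m where nm: "cyl_at n U" "cyl_at m V" by (auto simp: cyls_def)
  have nm': "cyl_at (max n m) U" "cyl_at (max n m) V"
    using cyl_at_mono[OF nm(1), of "max n m"] cyl_at_mono[OF nm(2), of "max n m"] by auto
  have "cyl_at (max n m) (U \<union> V)"
  proof (rule cyl_atI)
    show "U \<union> V \<subseteq> norm_funs" using nm cyl_atD(1) by auto
    fix h h' assume h: "h \<in> U \<union> V" "h' \<in> norm_funs" "\<And>y. y \<in> ball_at \<one> (int (max n m)) \<Longrightarrow> h y = h' y"
    then show "h' \<in> U \<union> V" using cyl_atD(2)[OF nm'(1), of h h'] cyl_atD(2)[OF nm'(2), of h h'] by blast
  qed
  then show "U \<union> V \<in> cyls" by (auto simp: cyls_def)
qed

text \<open>Cylinder sets are closed in a product of finite discrete spaces.\<close>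

lemma cyls_compact:
  assumes "range C \<subseteq> cyls" "decseq C" "(\<Inter>i. C i) = {}"
  shows "\<exists>i::nat. C i = {}"
proof (rule ccontr)
  assume ne: "\<not> ?thesis"
  define T where "T = product_topology (\<lambda>g. discrete_topology {- wd \<one> g..wd \<one> g}) (carrier G)"
  have top: "topspace T = norm_funs" by (simp add: T_def norm_funs_def)
  have comp: "compact_space T"
    unfolding T_def compact_space_product_topology by (simp add: compact_space_discrete_topology)
  have op: "openin T U" if U: "cyl_at n U" for n U
  proof -
    define N where "N h = PiE (carrier G) (\<lambda>g. if g \<in> ball_at \<one> (int n) then {h g} else {- wd \<one> g..wd \<one> g})" for h
    have "openin T (N h)" if h: "h \<in> norm_funs" for h
      unfolding T_def N_def openin_PiE_gen
    proof (intro disjI2 conjI ballI)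
      show "finite {g \<in> carrier G. (if g \<in> ball_at \<one> (int n) then {h g} else {- wd \<one> g..wd \<one> g})
          \<noteq> topspace (discrete_topology {- wd \<one> g..wd \<one> g})}"
        by (rule finite_subset[OF _ finite_ball_at[OF one_closed, of "int n"]]) auto
      show "openin (discrete_topology {- wd \<one> g..wd \<one> g}) (if g \<in> ball_at \<one> (int n) then {h g} else {- wd \<one> g..wd \<one> g})"
        if "g \<in> carrier G" for g
      proof -
        have "h g \<in> {- wd \<one> g..wd \<one> g}" using h that unfolding norm_funs_def by (rule PiE_mem)
        then show ?thesis by simp
      qed
    qed
    moreover have "U = (\<Union>h\<in>U. N h)"
    proof
      show "U \<subseteq> (\<Union>h\<in>U. N h)"
      proof
        fix h assume h: "h \<in> U"
        then have "h \<in> norm_funs" using cyl_atD(1)[OF U] by blast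
        then have "h \<in> N h" unfolding N_def norm_funs_def by (auto simp: PiE_iff)
        then show "h \<in> (\<Union>h\<in>U. N h)" using h by blast
      qed
      show "(\<Union>h\<in>U. N h) \<subseteq> U"
      proof
        fix h' assume "h' \<in> (\<Union>h\<in>U. N h)"
        then obtain h where h: "h \<in> U" "h' \<in> N h" by blast
        have hn: "h \<in> norm_funs" using h(1) cyl_atD(1)[OF U] by blast
        have eq: "h y = h' y" if "y \<in> ball_at \<one> (int n)" for y
          using h(2) that unfolding N_def by (auto simp: PiE_iff ball_at_def)
        have "h' \<in> norm_funs"
          unfolding norm_funs_def
        proof (rule PiE_I)
          fix g assume g: "g \<in> carrier G"
          have "h' g \<in> (if g \<in> ball_at \<one> (int n) then {h g} else {- wd \<one> g..wd \<one> g})"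
            using h(2) g unfolding N_def by (rule PiE_mem)
          moreover have "h g \<in> {- wd \<one> g..wd \<one> g}" using hn g unfolding norm_funs_def by (rule PiE_mem)
          ultimately show "h' g \<in> {- wd \<one> g..wd \<one> g}" by (auto split: if_splits)
        next
          fix g assume "g \<notin> carrier G"
          then show "h' g = undefined" using h(2) unfolding N_def by (rule PiE_arb[rotated])
        qed
        then show "h' \<in> U" using cyl_atD(2)[OF U h(1)] eq by blast
      qed
    qed
    ultimately show ?thesis using cyl_atD(1)[OF U] openin_Union[of "N ` U" T] by (metis (no_types, lifting) imageE subsetD)
  qed
  have "closedin T (C i)" for i
  proof -
    obtain n where n: "cyl_at n (C i)" using assms(1) by (auto simp: cyls_def)
    show ?thesis unfolding closedin_def top using op[OF cyl_at_compl[OF n]] cyl_atD(1)[OF n] by simp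
  qed
  then show False using compact_space_imp_nest[OF comp, of C] assms(2,3) ne by blast
qed

subsection \<open>Uniform measures on spheres\<close>

definition sphere_fun :: "'a \<Rightarrow> 'a \<Rightarrow> int" where
  "sphere_fun x = (\<lambda>f\<in>carrier G. wd x f - wd \<one> x)"

definition sphere_weight :: "nat \<Rightarrow> ('a \<Rightarrow> int) set \<Rightarrow> real" where
  "sphere_weight n U = card {x \<in> sphere_one n. sphere_fun x \<in> U} / card (sphere_one n)"

lemma sphere_fun_norm: "x \<in> carrier G \<Longrightarrow> sphere_fun x \<in> norm_funs"
proof -
  assume x: "x \<in> carrier G"
  have "- wd \<one> g \<le> wd x g - wd \<one> x \<and> wd x g - wd \<one> x \<le> wd \<one> g" if g: "g \<in> carrier G" for g
    using d_tri[OF one_closed g x] d_tri[OF x one_closed g] d_sym[OF x one_closed] d_sym[OF g x] by linarith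
  then show ?thesis by (auto simp: sphere_fun_def norm_funs_def)
qed

lemma sphere_one_nonempty:
  assumes "infinite (carrier G)"
  shows "sphere_one n \<noteq> {}"
proof -
  have "\<not> carrier G \<subseteq> ball_at \<one> (int n)" using assms finite_ball_at[OF one_closed] finite_subset by blast
  then obtain g where g: "g \<in> carrier G" "\<not> wd \<one> g \<le> int n" unfolding ball_at_def by blast
  then obtain z where "z \<in> carrier G" "wd \<one> z = int n" using d_interp[OF one_closed g(1), of "int n"] by auto
  then show ?thesis by (auto simp: sphere_one_def)
qed

lemma translate_sphere_fun:
  assumes x: "x \<in> sphere_one n" "sphere_fun x (inv g) = 0" and g: "g \<in> carrier G"
  shows "g \<otimes> x \<in> sphere_one n \<and> sphere_fun (g \<otimes> x) g = 0 \<and> translate G g (sphere_fun x) = sphere_fun (g \<otimes> x)"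
proof -
  have xc: "x \<in> carrier G" "wd \<one> x = int n" using x by (auto simp: sphere_one_def)
  have gx: "g \<otimes> x \<in> carrier G" using g xc by simp
  have "wd (g \<otimes> x) (g \<otimes> inv g) = wd x (inv g)" using wd_left[OF g xc(1), of "inv g"] g by simp
  then have l: "wd \<one> (g \<otimes> x) = int n"
    using x(2) g xc d_sym[OF gx one_closed] by (simp add: sphere_fun_def)
  have "wd (g \<otimes> x) g = int n"
    using wd_left[OF g xc(1) one_closed] g xc d_sym[OF xc(1) one_closed] by simp
  then have "sphere_fun (g \<otimes> x) g = 0" using g l by (simp add: sphere_fun_def)
  moreover have "translate G g (sphere_fun x) = sphere_fun (g \<otimes> x)"
  proof
    fix f
    show "translate G g (sphere_fun x) f = sphere_fun (g \<otimes> x) f"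
    proof (cases "f \<in> carrier G")
      case True
      have "wd (g \<otimes> x) (g \<otimes> (inv g \<otimes> f)) = wd x (inv g \<otimes> f)" using wd_left[OF g xc(1)] g True by simp
      then show ?thesis using True g l xc mult_inv_cancel(2)[OF g True True]
        by (simp add: translate_apply sphere_fun_def)
    next
      case False
      then show ?thesis by (simp add: translate_def sphere_fun_def)
    qed
  qed
  ultimately show ?thesis using gx l by (simp add: sphere_one_def)
qed

text \<open>Translation exchanges elements of a sphere, so the uniform measures are exactly invariant.\<close>

lemma sphere_weight_translate:
  assumes g: "g \<in> carrier G"
  shows "sphere_weight n {h. h (inv g) = 0 \<and> translate G g h \<in> U} = sphere_weight n {h. h g = 0 \<and> h \<in> U}"
proof -
  define S where "S = {x \<in> sphere_one n. sphere_fun x (inv g) = 0 \<and> translate G g (sphere_fun x) \<in> U}"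
  define S' where "S' = {x \<in> sphere_one n. sphere_fun x g = 0 \<and> sphere_fun x \<in> U}"
  note move = translate_sphere_fun
  have "bij_betw (\<lambda>x. g \<otimes> x) S S'"
  proof (rule bij_betwI[where g="\<lambda>x. inv g \<otimes> x"])
    show "(\<lambda>x. g \<otimes> x) \<in> S \<rightarrow> S'"
    proof
      fix x assume "x \<in> S"
      then have "x \<in> sphere_one n" "sphere_fun x (inv g) = 0" "translate G g (sphere_fun x) \<in> U"
        by (auto simp: S_def)
      then show "g \<otimes> x \<in> S'" using move[of x n g] g by (simp add: S'_def)
    qed
    show "(\<lambda>x. inv g \<otimes> x) \<in> S' \<rightarrow> S"
    proof
      fix x assume "x \<in> S'"
      then have x: "x \<in> sphere_one n" "sphere_fun x g = 0" "sphere_fun x \<in> U" by (auto simp: S'_def)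
      have xc: "x \<in> carrier G" using x by (simp add: sphere_one_def)
      have m1: "inv g \<otimes> x \<in> sphere_one n \<and> sphere_fun (inv g \<otimes> x) (inv g) = 0"
        using move[of x n "inv g"] x g by simp
      then have "translate G g (sphere_fun (inv g \<otimes> x)) = sphere_fun (g \<otimes> (inv g \<otimes> x))"
        using move[of "inv g \<otimes> x" n g] g by blast
      also have "g \<otimes> (inv g \<otimes> x) = x" by (rule mult_inv_cancel(2)[OF g xc xc])
      finally show "inv g \<otimes> x \<in> S" using m1 x(3) by (simp add: S_def)
    qed
    show "inv g \<otimes> (g \<otimes> x) = x" if "x \<in> S" for x
    proof -
      have "x \<in> carrier G" using that by (simp add: S_def sphere_one_def)
      then show ?thesis by (intro mult_inv_cancel(3)[OF g])
    qed
    show "g \<otimes> (inv g \<otimes> x) = x" if "x \<in> S'" for x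
    proof -
      have "x \<in> carrier G" using that by (simp add: S'_def sphere_one_def)
      then show ?thesis by (intro mult_inv_cancel(2)[OF g])
    qed
  qed
  then have "card S = card S'" by (rule bij_betw_same_card)
  then show ?thesis by (simp add: sphere_weight_def S_def S'_def)
qed

text \<open>The conditions of \<open>horo_iff\<close> at one triple of points.  Each of them is a cylinder set, and there are
  countably many.\<close>

definition good :: "'a \<Rightarrow> 'a \<Rightarrow> 'a \<Rightarrow> ('a \<Rightarrow> int) set" where
  "good a b m = {h \<in> norm_funs. \<bar>h a - h b\<bar> \<le> wd a b \<and> (\<exists>y\<in>carrier G. wd a y = 1 \<and> h y = h a - 1)
     \<and> h m + wd a b \<le> max (h a + wd m b) (h b + wd m a) + 2 * D}"

lemma H0_eq_good: "H0 = (\<Inter>t\<in>carrier G \<times> carrier G \<times> carrier G. case t of (a, b, m) \<Rightarrow> good a b m)"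
proof
  show "H0 \<subseteq> (\<Inter>t\<in>carrier G \<times> carrier G \<times> carrier G. case t of (a, b, m) \<Rightarrow> good a b m)"
  proof (intro subsetI INT_I)
    fix h t assume h: "h \<in> H0" and t: "t \<in> carrier G \<times> carrier G \<times> carrier G"
    then obtain a b m where t': "t = (a, b, m)" "a \<in> carrier G" "b \<in> carrier G" "m \<in> carrier G" by blast
    have hh: "int_lipschitz h" "descending h" "four_point_fun (2 * D) h" "h \<in> extensional (carrier G)"
      using h horoD by (auto simp: H0_iff)
    have "h \<in> norm_funs"
      unfolding norm_funs_def
    proof (rule PiE_I)
      fix g assume "g \<in> carrier G"
      then show "h g \<in> {- wd \<one> g..wd \<one> g}" using H0_bound[OF h, of g] by (simp add: abs_le_iff)
    qed (use hh(4) in \<open>simp add: extensional_def\<close>)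
    then show "h \<in> (case t of (a, b, m) \<Rightarrow> good a b m)"
      using hh(1-3) t' unfolding good_def int_lipschitz_def descending_def four_point_fun_def by simp
  qed
  show "(\<Inter>t\<in>carrier G \<times> carrier G \<times> carrier G. case t of (a, b, m) \<Rightarrow> good a b m) \<subseteq> H0"
  proof
    fix h assume "h \<in> (\<Inter>t\<in>carrier G \<times> carrier G \<times> carrier G. case t of (a, b, m) \<Rightarrow> good a b m)"
    then have h: "h \<in> good a b m" if "a \<in> carrier G" "b \<in> carrier G" "m \<in> carrier G" for a b m
      using that by force
    have hn: "h \<in> norm_funs" using h[of \<one> \<one> \<one>] by (simp add: good_def)
    then have "h \<one> \<in> {- wd \<one> \<one>..wd \<one> \<one>}" unfolding norm_funs_def by (rule PiE_mem) simp
    then have "h \<one> = 0" by simp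
    moreover have "int_lipschitz h" unfolding int_lipschitz_def
    proof (intro ballI)
      fix u v assume "u \<in> carrier G" "v \<in> carrier G"
      then show "\<bar>h u - h v\<bar> \<le> wd u v" using h[of u v u] by (simp add: good_def)
    qed
    moreover have "descending h" unfolding descending_def
    proof
      fix x assume "x \<in> carrier G"
      then show "\<exists>y\<in>carrier G. wd x y = 1 \<and> h y = h x - 1" using h[of x x x] by (simp add: good_def)
    qed
    moreover have "four_point_fun (2 * D) h" unfolding four_point_fun_def
    proof (intro ballI)
      fix a b m assume "a \<in> carrier G" "b \<in> carrier G" "m \<in> carrier G"
      then show "h m + wd a b \<le> max (h a + wd m b) (h b + wd m a) + 2 * D"
        using h[of a b m] by (simp add: good_def)
    qed
    moreover have "h \<in> extensional (carrier G)" using hn by (simp add: norm_funs_def PiE_def)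
    ultimately show "h \<in> H0" by (simp add: H0_iff horo_iff)
  qed
qed

lemma good_cyl:
  assumes abm: "a \<in> carrier G" "b \<in> carrier G" "m \<in> carrier G"
  shows "good a b m \<in> cyls"
proof -
  define n where "n = nat (wd \<one> a + wd \<one> b + wd \<one> m + 1)"
  have nn: "0 \<le> wd \<one> a" "0 \<le> wd \<one> b" "0 \<le> wd \<one> m" using abm d_nonneg by auto
  have "cyl_at n (good a b m)"
  proof (rule cyl_atI)
    show "good a b m \<subseteq> norm_funs" by (auto simp: good_def)
    fix h h' assume h: "h \<in> good a b m" "h' \<in> norm_funs" and eq: "\<And>y. y \<in> ball_at \<one> (int n) \<Longrightarrow> h y = h' y"
    obtain y where y: "y \<in> carrier G" "wd a y = 1" "h y = h a - 1" using h(1) by (auto simp: good_def)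
    have "wd \<one> y \<le> int n" using d_tri[OF one_closed abm(1) y(1)] y(2) nn by (simp add: n_def)
    then have e: "h' a = h a" "h' b = h b" "h' m = h m" "h' y = h y"
      using eq[of a] eq[of b] eq[of m] eq[of y] abm y nn by (auto simp: ball_at_def n_def)
    have "\<exists>y\<in>carrier G. wd a y = 1 \<and> h' y = h' a - 1" using y e by (intro bexI[of _ y]) auto
    then show "h' \<in> good a b m" using h e unfolding good_def by simp
  qed
  then show ?thesis by (auto simp: cyls_def)
qed

text \<open>A distance function satisfies all conditions except the existence of a lower neighbour at its source, so
  for a fixed triple a large sphere has no exceptions.\<close>

lemma sphere_fun_good:
  assumes abm: "a \<in> carrier G" "b \<in> carrier G" "m \<in> carrier G" and x: "x \<in> carrier G" "x \<noteq> a"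
  shows "sphere_fun x \<in> good a b m"
proof -
  have sy: "wd x a = wd a x" "wd x b = wd b x" "wd x m = wd m x" using abm x d_sym by auto
  have "wd a x \<noteq> 0" using d_eq_0[OF abm(1) x(1)] x(2) by auto
  then have "1 \<le> wd a x" using d_nonneg[OF abm(1) x(1)] by linarith
  then obtain y where y: "y \<in> carrier G" "wd a y = 1" "wd y x = wd a x - 1"
    using d_interp[OF abm(1) x(1), of 1] by auto
  have "wd x y = wd y x" using x y d_sym by auto
  then have 1: "\<exists>y\<in>carrier G. wd a y = 1 \<and> sphere_fun x y = sphere_fun x a - 1"
    using y sy abm by (intro bexI[of _ y]) (auto simp: sphere_fun_def)
  have 2: "\<bar>sphere_fun x a - sphere_fun x b\<bar> \<le> wd a b"
    using d_tri[OF x(1) abm(1,2)] d_tri[OF x(1) abm(2,1)] d_sym[OF abm(1,2)] abm by (simp add: sphere_fun_def abs_le_iff)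
  have "wd m x + wd a b \<le> wd m a + wd x b + D \<or> wd m x + wd a b \<le> wd m b + wd x a + D"
    by (rule four_pt[OF abm(3) x(1) abm(1,2)])
  then have "sphere_fun x m + wd a b \<le> max (sphere_fun x a + wd m b) (sphere_fun x b + wd m a) + 2 * D"
    using D(2) sy abm by (auto simp: sphere_fun_def)
  then show ?thesis using 1 2 sphere_fun_norm[OF x(1)] by (simp add: good_def)
qed

lemma local_sets_eq: "(\<inter>) H0 ` cyls = local_sets" and H0_norm: "H0 \<subseteq> norm_funs"
proof -
  show H0: "H0 \<subseteq> norm_funs" unfolding H0_eq_good using one_closed by (force simp: good_def)
  show "(\<inter>) H0 ` cyls = local_sets"
  proof
    show "(\<inter>) H0 ` cyls \<subseteq> local_sets"
    proof (rule image_subsetI)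
      fix U assume "U \<in> cyls"
      then obtain n where n: "cyl_at n U" by (auto simp: cyls_def)
      have "local_at n (H0 \<inter> U)"
      proof (rule local_atI)
        fix h h' assume h: "h \<in> H0 \<inter> U" "h' \<in> H0" "\<And>y. y \<in> ball_at \<one> (int n) \<Longrightarrow> h y = h' y"
        then show "h' \<in> H0 \<inter> U" using cyl_atD(2)[OF n, of h h'] H0 by blast
      qed auto
      then show "H0 \<inter> U \<in> local_sets" by (auto simp: local_sets_def)
    qed
    show "local_sets \<subseteq> (\<inter>) H0 ` cyls"
    proof
      fix V assume "V \<in> local_sets"
      then obtain n where n: "local_at n V" by (auto simp: local_sets_def)
      define U where "U = {h \<in> norm_funs. \<exists>v\<in>V. \<forall>y\<in>ball_at \<one> (int n). v y = h y}"
      have "cyl_at n U"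
      proof (rule cyl_atI)
        fix h h' assume h: "h \<in> U" "h' \<in> norm_funs" "\<And>y. y \<in> ball_at \<one> (int n) \<Longrightarrow> h y = h' y"
        then obtain v where v: "v \<in> V" "\<forall>y\<in>ball_at \<one> (int n). v y = h y" by (auto simp: U_def)
        then have "\<forall>y\<in>ball_at \<one> (int n). v y = h' y" using h(3) by simp
        then show "h' \<in> U" using h(2) v(1) unfolding U_def by blast
      qed (auto simp: U_def)
      moreover have "V = H0 \<inter> U"
      proof
        show "V \<subseteq> H0 \<inter> U" using local_atD(1)[OF n] H0 by (auto simp: U_def)
        show "H0 \<inter> U \<subseteq> V"
        proof
          fix h assume "h \<in> H0 \<inter> U"
          then obtain v where "v \<in> V" "\<forall>y\<in>ball_at \<one> (int n). v y = h y" "h \<in> H0" by (auto simp: U_def)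
          then show "h \<in> V" using local_atD(2)[OF n, of v h] by blast
        qed
      qed
      ultimately show "V \<in> (\<inter>) H0 ` cyls" by (auto simp: cyls_def)
    qed
  qed
qed

text \<open>On cylinder sets the translation has to be replaced by a cylinder condition, because it does not
  preserve the space of normalised functions.\<close>

definition pre_cyl :: "'a \<Rightarrow> nat \<Rightarrow> ('a \<Rightarrow> int) set \<Rightarrow> ('a \<Rightarrow> int) set" where
  "pre_cyl g n U = {h \<in> norm_funs. h (inv g) = 0 \<and> (\<exists>u\<in>U. \<forall>y\<in>ball_at \<one> (int n). u y = translate G g h y)}"

lemma pre_cyl_in_cyls:
  assumes g: "g \<in> carrier G"
  shows "pre_cyl g n U \<in> cyls"
proof -
  define m where "m = n + nat (wd \<one> g)"
  have ig: "inv g \<in> carrier G" "wd \<one> (inv g) = wd \<one> g" "0 \<le> wd \<one> g" using g wd_one_inv d_nonneg by auto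
  have "cyl_at m (pre_cyl g n U)"
  proof (rule cyl_atI)
    fix h h' assume h: "h \<in> pre_cyl g n U" "h' \<in> norm_funs" and eq: "\<And>y. y \<in> ball_at \<one> (int m) \<Longrightarrow> h y = h' y"
    have "inv g \<in> ball_at \<one> (int m)" using ig by (simp add: ball_at_def m_def)
    then have 1: "h' (inv g) = 0" using eq h(1) by (force simp: pre_cyl_def)
    have tr: "translate G g h y = translate G g h' y" if y: "y \<in> ball_at \<one> (int n)" for y
    proof -
      have yc: "y \<in> carrier G" "wd \<one> y \<le> int n" using y by (auto simp: ball_at_def)
      have "wd \<one> (inv g \<otimes> y) \<le> int m" using wd_one_mult[OF ig(1) yc(1)] yc ig by (simp add: m_def)
      then have "inv g \<otimes> y \<in> ball_at \<one> (int m)" using yc ig by (simp add: ball_at_def)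
      then show ?thesis using eq yc by (simp add: translate_apply)
    qed
    obtain u where "u \<in> U" "\<forall>y\<in>ball_at \<one> (int n). u y = translate G g h y"
      using h(1) by (auto simp: pre_cyl_def)
    then have "\<exists>u\<in>U. \<forall>y\<in>ball_at \<one> (int n). u y = translate G g h' y" using tr by (intro bexI[of _ u]) auto
    then show "h' \<in> pre_cyl g n U" using 1 h(2) by (simp add: pre_cyl_def)
  qed (auto simp: pre_cyl_def)
  then show ?thesis by (auto simp: cyls_def)
qed

lemma pre_cyl_iff:
  assumes "cyl_at n U" "h \<in> norm_funs" "h (inv g) = 0" "translate G g h \<in> norm_funs"
  shows "h \<in> pre_cyl g n U \<longleftrightarrow> translate G g h \<in> U"
proof
  assume "h \<in> pre_cyl g n U"
  then obtain u where "u \<in> U" "\<forall>y\<in>ball_at \<one> (int n). u y = translate G g h y" by (auto simp: pre_cyl_def)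
  then show "translate G g h \<in> U" using cyl_atD(2)[OF assms(1), of u "translate G g h"] assms(4) by blast
next
  assume "translate G g h \<in> U"
  then show "h \<in> pre_cyl g n U" using assms(2,3) by (auto simp: pre_cyl_def)
qed

end


context hyperbolic_cayley
begin

lemma local_sets_Int_stable: "Int_stable local_sets"
proof (rule Int_stableI)
  fix U V assume "U \<in> local_sets" "V \<in> local_sets"
  then obtain n m where nm: "local_at n U" "local_at m V" by (auto simp: local_sets_def)
  have "local_at (max n m) U" "local_at (max n m) V"
    using local_at_mono[OF nm(1), of "max n m"] local_at_mono[OF nm(2), of "max n m"] by auto
  then have "local_at (max n m) (U - (U - V))" by (intro local_at_Diff)
  moreover have "U - (U - V) = U \<inter> V" by blast
  ultimately show "U \<inter> V \<in> local_sets" by (auto simp: local_sets_def)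
qed

text \<open>Local sets are stable under intersections and generate the Borel sets.\<close>

lemma translate_measure_extend:
  assumes s: "sets \<eta> = sets M0" "prob_space \<eta>" and g: "g \<in> carrier G"
    and basic: "\<And>V. V \<in> local_sets \<Longrightarrow>
      emeasure \<eta> {h \<in> trans_dom g. translate G g h \<in> V} = emeasure \<eta> (V \<inter> trans_dom (inv g))"
    and V: "V \<in> sets M0"
  shows "emeasure \<eta> {h \<in> trans_dom g. translate G g h \<in> V} = emeasure \<eta> (V \<inter> trans_dom (inv g))"
proof -
  interpret prob_space \<eta> by fact
  define Pre where "Pre V = {h \<in> trans_dom g. translate G g h \<in> V}" for V
  have ig: "inv g \<in> carrier G" using g by simp
  have Dg: "trans_dom g \<in> sets \<eta>" "trans_dom (inv g) \<in> sets \<eta>" using trans_dom_sets g ig s by auto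
  have Pre: "Pre V \<in> sets \<eta>" if "V \<in> sets M0" for V
    unfolding Pre_def using translate_preimage[OF g that] s by simp
  have sub: "trans_dom g \<subseteq> H0" for g by (auto simp: trans_dom_def)
  have PreH: "Pre H0 = trans_dom g" using translate_H0[OF g] sub by (auto simp: Pre_def)
  have LP: "local_sets \<subseteq> Pow H0" by (auto simp: local_sets_def dest: local_atD(1))
  have Vs: "V \<in> sigma_sets H0 local_sets" using V by (simp add: sets_M0)
  have "emeasure \<eta> (Pre V) = emeasure \<eta> (V \<inter> trans_dom (inv g))"
    using local_sets_Int_stable LP Vs
  proof (induction rule: sigma_sets_induct_disjoint)
    case (basic V)
    then show ?case using assms(4) by (simp add: Pre_def)
  next
    case empty
    then show ?case by (simp add: Pre_def)
  next
    case (compl V)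
    then have Vm: "V \<in> sets M0" by (simp add: sets_M0)
    have "H0 \<in> local_sets" using local_at_H0[of 0] by (auto simp: local_sets_def)
    from assms(4)[OF this] have tot: "emeasure \<eta> (trans_dom g) = emeasure \<eta> (trans_dom (inv g))"
      using PreH sub[of "inv g"] by (simp add: Pre_def Int_absorb1)
    have "Pre (H0 - V) = trans_dom g - Pre V" using PreH by (auto simp: Pre_def)
    then have "emeasure \<eta> (Pre (H0 - V)) = emeasure \<eta> (trans_dom g) - emeasure \<eta> (Pre V)"
      using Dg Pre[OF Vm] by (simp add: emeasure_Diff Pre_def)
    also have "\<dots> = emeasure \<eta> (trans_dom (inv g)) - emeasure \<eta> (V \<inter> trans_dom (inv g))"
      using tot compl by simp
    also have "\<dots> = emeasure \<eta> (trans_dom (inv g) - (V \<inter> trans_dom (inv g)))"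
      using Dg Vm s by (intro emeasure_Diff[symmetric]) auto
    also have "trans_dom (inv g) - (V \<inter> trans_dom (inv g)) = (H0 - V) \<inter> trans_dom (inv g)"
      using sub[of "inv g"] by blast
    finally show ?case .
  next
    case (union C)
    have C: "C i \<in> sets M0" for i using union.hyps by (auto simp: sets_M0)
    have "emeasure \<eta> (Pre (\<Union>i. C i)) = suminf (\<lambda>i. emeasure \<eta> (Pre (C i)))"
    proof -
      have r: "range (\<lambda>i. Pre (C i)) \<subseteq> sets \<eta>" using Pre[OF C] by auto
      have d: "disjoint_family (\<lambda>i. Pre (C i))"
        using union.hyps(1) unfolding disjoint_family_on_def Pre_def by blast
      have "(\<Union>i. Pre (C i)) = Pre (\<Union>i. C i)" by (auto simp: Pre_def)
      then show ?thesis using suminf_emeasure[OF r d] by simp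
    qed
    also have "\<dots> = suminf (\<lambda>i. emeasure \<eta> (C i \<inter> trans_dom (inv g)))" using union.IH by simp
    also have "\<dots> = emeasure \<eta> ((\<Union>i. C i) \<inter> trans_dom (inv g))"
    proof -
      have r: "range (\<lambda>i. C i \<inter> trans_dom (inv g)) \<subseteq> sets \<eta>" using C Dg s by auto
      have d: "disjoint_family (\<lambda>i. C i \<inter> trans_dom (inv g))"
        using union.hyps(1) unfolding disjoint_family_on_def by blast
      have "(\<Union>i. C i \<inter> trans_dom (inv g)) = (\<Union>i. C i) \<inter> trans_dom (inv g)" by blast
      then show ?thesis using suminf_emeasure[OF r d] by simp
    qed
    finally show ?case .
  qed
  then show ?thesis by (simp add: Pre_def)
qed

lemma sphere_weight_pre_cyl:
  assumes g: "g \<in> carrier G" and U: "cyl_at n U"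
  shows "sphere_weight k (pre_cyl g n U) = sphere_weight k {h \<in> U. h g = 0}"
proof -
  have "sphere_fun x \<in> pre_cyl g n U \<longleftrightarrow> sphere_fun x (inv g) = 0 \<and> translate G g (sphere_fun x) \<in> U"
    if x: "x \<in> sphere_one k" for x
  proof (cases "sphere_fun x (inv g) = 0")
    case True
    have xc: "x \<in> carrier G" using x by (simp add: sphere_one_def)
    have "translate G g (sphere_fun x) \<in> norm_funs"
      using translate_sphere_fun[OF x True g] sphere_fun_norm[of "g \<otimes> x"] g xc by simp
    then show ?thesis using pre_cyl_iff[OF U sphere_fun_norm[OF xc] True] True by simp
  qed (simp add: pre_cyl_def)
  then have "{x \<in> sphere_one k. sphere_fun x \<in> pre_cyl g n U}
      = {x \<in> sphere_one k. sphere_fun x \<in> {h. h (inv g) = 0 \<and> translate G g h \<in> U}}" by auto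
  then have "sphere_weight k (pre_cyl g n U) = sphere_weight k {h. h (inv g) = 0 \<and> translate G g h \<in> U}"
    by (simp add: sphere_weight_def)
  also have "\<dots> = sphere_weight k {h. h g = 0 \<and> h \<in> U}" by (rule sphere_weight_translate[OF g])
  also have "{h. h g = 0 \<and> h \<in> U} = {h \<in> U. h g = 0}" by blast
  finally show ?thesis .
qed

lemma sphere_weight_limit:
  assumes inf: "infinite (carrier G)"
  shows "\<exists>m :: (('a \<Rightarrow> int) set \<Rightarrow> real). (\<forall>U. 0 \<le> m U) \<and> (\<forall>U V. U \<inter> V = {} \<longrightarrow> m (U \<union> V) = m U + m V) \<and>
    (\<forall>U. eventually (\<lambda>n. sphere_weight n U = 1) sequentially \<longrightarrow> m U = 1) \<and>
    (\<forall>U V. (\<forall>n. sphere_weight n U = sphere_weight n V) \<longrightarrow> m U = m V)"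
proof -
  have pos: "0 < card (sphere_one n)" for n
    using sphere_one_nonempty[OF inf] finite_sphere_one by (simp add: card_gt_0_iff)
  have fin: "finite {x \<in> sphere_one n. P x}" for n P using finite_sphere_one by simp
  have "sphere_weight n U \<in> {0..1}" for n U
    using card_mono[OF finite_sphere_one, of "{x \<in> sphere_one n. sphere_fun x \<in> U}" n] pos[of n]
    by (auto simp: sphere_weight_def)
  from common_limit_filter[of sphere_weight, OF this]
  obtain m F where F: "F \<noteq> bot" "F \<le> sequentially" "\<forall>U. ((\<lambda>n. sphere_weight n U) \<longlongrightarrow> m U) F"
    by (elim exE conjE)
  have lim: "((\<lambda>n. sphere_weight n U) \<longlongrightarrow> m U) F" for U using F(3) by blast
  have "0 \<le> m U" for U
    by (rule tendsto_lowerbound[OF lim _ F(1)]) (simp add: sphere_weight_def)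
  moreover have "m (U \<union> V) = m U + m V" if "U \<inter> V = {}" for U V
  proof (rule tendsto_unique[OF F(1) lim])
    have "sphere_weight n (U \<union> V) = sphere_weight n U + sphere_weight n V" for n
    proof -
      have "{x \<in> sphere_one n. sphere_fun x \<in> U \<union> V}
          = {x \<in> sphere_one n. sphere_fun x \<in> U} \<union> {x \<in> sphere_one n. sphere_fun x \<in> V}" by blast
      moreover have "{x \<in> sphere_one n. sphere_fun x \<in> U} \<inter> {x \<in> sphere_one n. sphere_fun x \<in> V} = {}"
        using that by blast
      ultimately have "card {x \<in> sphere_one n. sphere_fun x \<in> U \<union> V}
          = card {x \<in> sphere_one n. sphere_fun x \<in> U} + card {x \<in> sphere_one n. sphere_fun x \<in> V}"
        by (simp add: card_Un_disjoint fin)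
      then show ?thesis by (simp add: sphere_weight_def add_divide_distrib)
    qed
    then show "((\<lambda>n. sphere_weight n (U \<union> V)) \<longlongrightarrow> m U + m V) F"
      using tendsto_add[OF lim[of U] lim[of V]] by simp
  qed
  moreover have "m U = 1" if "eventually (\<lambda>n. sphere_weight n U = 1) sequentially" for U
  proof (rule tendsto_unique[OF F(1) lim])
    have "eventually (\<lambda>n. sphere_weight n U = 1) F" by (rule filter_leD[OF F(2) that])
    then show "((\<lambda>n. sphere_weight n U) \<longlongrightarrow> 1) F" by (rule tendsto_eventually)
  qed
  moreover have "m U = m V" if "\<forall>n. sphere_weight n U = sphere_weight n V" for U V
  proof (rule tendsto_unique[OF F(1) lim])
    have "(\<lambda>n. sphere_weight n U) = (\<lambda>n. sphere_weight n V)" using that by blast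
    then show "((\<lambda>n. sphere_weight n U) \<longlongrightarrow> m V) F" using lim[of V] by simp
  qed
  ultimately show ?thesis by blast
qed

text \<open>Compactness makes the limit of the uniform measures countably additive on cylinder sets, so it extends to a
  measure.  Each of the countably many conditions that define \<open>H0\<close> has measure one, and invariance
  passes from the spheres to the limit on cylinder sets and from there to Borel sets.\<close>

lemma invariant_measure_exists:
  assumes inf: "infinite (carrier G)"
  shows "invariant_measures G A \<noteq> {}"
proof -
  from sphere_weight_limit[OF inf] obtain m :: "('a \<Rightarrow> int) set \<Rightarrow> real" where
    m: "\<forall>U. 0 \<le> m U" "\<forall>U V. U \<inter> V = {} \<longrightarrow> m (U \<union> V) = m U + m V"
      "\<forall>U. eventually (\<lambda>n. sphere_weight n U = 1) sequentially \<longrightarrow> m U = 1"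
      "\<forall>U V. (\<forall>n. sphere_weight n U = sphere_weight n V) \<longrightarrow> m U = m V"
    by (elim exE conjE)
  have pos: "0 < card (sphere_one n)" for n
    using sphere_one_nonempty[OF inf] finite_sphere_one by (simp add: card_gt_0_iff)
  have m_empty: "m {} = 0" using m(2)[rule_format, of "{}" "{}"] by simp
  have m_norm: "m norm_funs = 1"
  proof (rule m(3)[rule_format], rule always_eventually, rule allI)
    fix n
    have "{x \<in> sphere_one n. sphere_fun x \<in> norm_funs} = sphere_one n"
      using sphere_fun_norm by (auto simp: sphere_one_def)
    then show "sphere_weight n norm_funs = 1" using pos[of n] by (simp add: sphere_weight_def)
  qed
  have m_good: "m (good a b k) = 1" if abk: "a \<in> carrier G" "b \<in> carrier G" "k \<in> carrier G" for a b k
  proof (rule m(3)[rule_format])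
    have "sphere_weight n (good a b k) = 1" if n: "wd \<one> a < int n" for n
    proof -
      have "sphere_fun x \<in> good a b k" if "x \<in> sphere_one n" for x
        using that n abk by (intro sphere_fun_good) (auto simp: sphere_one_def)
      then have "{x \<in> sphere_one n. sphere_fun x \<in> good a b k} = sphere_one n" by blast
      then show ?thesis using pos[of n] by (simp add: sphere_weight_def)
    qed
    then show "eventually (\<lambda>n. sphere_weight n (good a b k) = 1) sequentially"
      unfolding eventually_sequentially by (intro exI[of _ "nat (wd \<one> a) + 1"]) auto
  qed
  interpret cyls: Sigma_Algebra.algebra norm_funs cyls by (rule cyls_algebra)
  define f where "f U = ennreal (m U)" for U
  have "\<exists>\<mu>. (\<forall>U\<in>cyls. \<mu> U = f U) \<and> measure_space norm_funs (sigma_sets norm_funs cyls) \<mu>"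
  proof (rule cyls.caratheodory_empty_continuous)
    show "positive cyls f" by (simp add: positive_def f_def m_empty)
    show "additive cyls f" unfolding additive_def f_def using m(1,2) by (simp add: ennreal_plus)
    show "f U \<noteq> \<infinity>" for U by (simp add: f_def)
    fix C :: "nat \<Rightarrow> ('a \<Rightarrow> int) set" assume C: "range C \<subseteq> cyls" "decseq C" "(\<Inter>i. C i) = {}"
    obtain i where i: "C i = {}" using cyls_compact[OF C] by blast
    have "C j = {}" if "i \<le> j" for j using decseqD[OF C(2) that] i by blast
    then have "eventually (\<lambda>j. f (C j) = 0) sequentially"
      unfolding eventually_sequentially by (intro exI[of _ i]) (simp add: f_def m_empty)
    then show "(\<lambda>i. f (C i)) \<longlonglongrightarrow> 0" by (rule tendsto_eventually)
  qed
  then obtain \<mu> where \<mu>: "\<forall>U\<in>cyls. \<mu> U = f U" "measure_space norm_funs (sigma_sets norm_funs cyls) \<mu>"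
    by (elim exE conjE)
  define \<Lambda> where "\<Lambda> = measure_of norm_funs (sigma_sets norm_funs cyls) \<mu>"
  have cP: "cyls \<subseteq> Pow norm_funs" by (rule cyls.space_closed)
  have sP: "sigma_sets norm_funs cyls \<subseteq> Pow norm_funs" using sigma_sets_into_sp[OF cP] by blast
  have \<Lambda>: "space \<Lambda> = norm_funs" "sets \<Lambda> = sigma_sets norm_funs cyls"
    unfolding \<Lambda>_def using sP by (simp_all add: space_measure_of sets_measure_of sigma_sets_sigma_sets_eq[OF cP])
  have e\<Lambda>: "emeasure \<Lambda> U = ennreal (m U)" if "U \<in> cyls" for U
  proof -
    have "emeasure \<Lambda> U = \<mu> U"
      unfolding \<Lambda>_def using \<mu>(2) that unfolding measure_space_def
      by (intro emeasure_measure_of_sigma) (auto intro: sigma_sets.Basic)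
    then show ?thesis using \<mu>(1) that by (simp add: f_def)
  qed
  interpret L: prob_space \<Lambda>
    by (rule prob_spaceI) (use e\<Lambda>[OF cyls.top] m_norm \<Lambda> in simp)
  have c_sets: "U \<in> sets \<Lambda>" if "U \<in> cyls" for U using that \<Lambda> by (auto intro: sigma_sets.Basic)
  define I where "I = carrier G \<times> carrier G \<times> carrier G"
  have I: "countable I" "I \<noteq> {}" using countable_carrier one_closed by (auto simp: I_def)
  define gt where "gt t = (case t of (a, b, k) \<Rightarrow> good a b k)" for t
  have gt: "gt t \<in> cyls" "m (gt t) = 1" if "t \<in> I" for t
    using that good_cyl m_good by (auto simp: I_def gt_def)
  have H0_INT: "H0 = (\<Inter>t\<in>I. gt t)" unfolding H0_eq_good I_def gt_def ..
  have H0s: "H0 \<in> sets \<Lambda>"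
    unfolding H0_INT using gt(1) c_sets by (intro sets.countable_INT' I) auto
  have "AE h in \<Lambda>. \<forall>t\<in>I. h \<in> gt t"
    unfolding AE_ball_countable[OF I(1)]
  proof
    fix t assume t: "t \<in> I"
    have "L.prob (gt t) = 1" using e\<Lambda>[OF gt(1)[OF t]] gt(2)[OF t] by (simp add: measure_def)
    then show "AE h in \<Lambda>. h \<in> gt t" by (rule L.AE_prob_1)
  qed
  then have AEH: "AE h in \<Lambda>. h \<in> H0" unfolding H0_INT by simp
  define \<eta> where "\<eta> = restrict_space \<Lambda> H0"
  have s\<eta>: "sets \<eta> = sets M0"
    unfolding \<eta>_def sets_restrict_space \<Lambda>(2) sets_M0
    using sigma_sets_Int[of H0 norm_funs cyls] H0s \<Lambda>(2) H0_norm local_sets_eq by simp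
  have H0L: "H0 \<inter> space \<Lambda> \<in> sets \<Lambda>" using H0s by simp
  have e\<eta>: "emeasure \<eta> (H0 \<inter> U) = ennreal (m U)" if U: "U \<in> cyls" for U
  proof -
    have "emeasure \<eta> (H0 \<inter> U) = emeasure \<Lambda> (H0 \<inter> U)"
      unfolding \<eta>_def by (rule emeasure_restrict_space[OF H0L]) simp
    also have "\<dots> = emeasure \<Lambda> U"
      using AEH c_sets[OF U] H0s by (intro emeasure_eq_AE) auto
    finally show ?thesis using e\<Lambda>[OF U] by simp
  qed
  have p\<eta>: "prob_space \<eta>"
  proof (rule prob_spaceI)
    have "space \<eta> = H0 \<inter> norm_funs" using \<Lambda>(1) by (simp add: \<eta>_def space_restrict_space)
    then show "emeasure \<eta> (space \<eta>) = 1" using e\<eta>[OF cyls.top] m_norm by simp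
  qed
  have basic: "emeasure \<eta> {h \<in> trans_dom g. translate G g h \<in> V} = emeasure \<eta> (V \<inter> trans_dom (inv g))"
    if g: "g \<in> carrier G" and V: "V \<in> local_sets" for g V
  proof -
    obtain U where U: "U \<in> cyls" "V = H0 \<inter> U" using V local_sets_eq by blast
    then obtain n where n: "cyl_at n U" by (auto simp: cyls_def)
    define U' where "U' = {h \<in> U. h g = 0}"
    have U': "U' \<in> cyls"
    proof -
      define k where "k = max n (nat (wd \<one> g))"
      have gb: "g \<in> ball_at \<one> (int k)" using g by (simp add: ball_at_def k_def)
      have nk: "cyl_at k U" by (rule cyl_at_mono[OF n]) (simp add: k_def)
      have "cyl_at k U'"
      proof (rule cyl_atI)
        show "U' \<subseteq> norm_funs" using cyl_atD(1)[OF n] by (auto simp: U'_def)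
        fix h h' assume h: "h \<in> U'" "h' \<in> norm_funs" "\<And>y. y \<in> ball_at \<one> (int k) \<Longrightarrow> h y = h' y"
        then show "h' \<in> U'" using cyl_atD(2)[OF nk, of h h'] gb by (force simp: U'_def)
      qed
      then show ?thesis by (auto simp: cyls_def)
    qed
    have "{h \<in> trans_dom g. translate G g h \<in> V} = H0 \<inter> pre_cyl g n U"
    proof -
      have "h \<in> pre_cyl g n U \<longleftrightarrow> translate G g h \<in> V" if h: "h \<in> trans_dom g" for h
      proof -
        have hh: "h \<in> H0" "h (inv g) = 0" "translate G g h \<in> H0"
          using h translate_H0[OF g h] by (auto simp: trans_dom_def)
        then have hn: "h \<in> norm_funs" "translate G g h \<in> norm_funs" using H0_norm by blast+
        show ?thesis using pre_cyl_iff[OF n hn(1) hh(2) hn(2)] hh(3) U(2) by blast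
      qed
      moreover have "h \<in> trans_dom g" if "h \<in> H0 \<inter> pre_cyl g n U" for h
        using that by (simp add: trans_dom_def pre_cyl_def)
      moreover have "h \<in> H0" if "h \<in> trans_dom g" for h using that by (simp add: trans_dom_def)
      ultimately show ?thesis by blast
    qed
    then have "emeasure \<eta> {h \<in> trans_dom g. translate G g h \<in> V} = ennreal (m (pre_cyl g n U))"
      using e\<eta>[OF pre_cyl_in_cyls[OF g]] by simp
    also have "m (pre_cyl g n U) = m U'"
      unfolding U'_def by (rule m(4)[rule_format]) (rule sphere_weight_pre_cyl[OF g n])
    also have "ennreal (m U') = emeasure \<eta> (H0 \<inter> U')" using e\<eta>[OF U'] by simp
    also have "H0 \<inter> U' = V \<inter> trans_dom (inv g)"
      using U(2) g by (auto simp: U'_def trans_dom_def)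
    finally show ?thesis .
  qed
  have "\<eta> \<in> invariant_measures G A"
  proof (rule invariant_if_translations[OF s\<eta> p\<eta>])
    fix g B assume g: "g \<in> carrier G" and B: "B \<in> sets M0" "B \<subseteq> trans_dom g"
    define V where "V = translate G g ` B"
    have V: "V \<in> sets M0" unfolding V_def by (rule translate_image_sets[OF g B])
    have "V \<subseteq> trans_dom (inv g)" using translate_H0[OF g] B(2) by (auto simp: V_def)
    then have "emeasure \<eta> V = emeasure \<eta> (V \<inter> trans_dom (inv g))" by (simp add: Int_absorb2)
    also have "\<dots> = emeasure \<eta> {h \<in> trans_dom g. translate G g h \<in> V}"
      by (rule translate_measure_extend[OF s\<eta> p\<eta> g basic[OF g] V, symmetric])
    also have "{h \<in> trans_dom g. translate G g h \<in> V} = B"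
    proof
      show "B \<subseteq> {h \<in> trans_dom g. translate G g h \<in> V}" using B(2) by (auto simp: V_def)
      show "{h \<in> trans_dom g. translate G g h \<in> V} \<subseteq> B"
      proof
        fix h assume h: "h \<in> {h \<in> trans_dom g. translate G g h \<in> V}"
        then obtain h' where h': "h' \<in> B" "translate G g h = translate G g h'" by (auto simp: V_def)
        then have "h = h'" using translate_bij(1)[OF g] h B(2) unfolding inj_on_def by blast
        then show "h \<in> B" using h'(1) by simp
      qed
    qed
    finally show "emeasure \<eta> (translate G g ` B) = emeasure \<eta> B" by (simp add: V_def)
  qed
  then show ?thesis by blast
qed

end

section \<open>Independence of the generating set\<close>

lemma finite_group_elementary:
  assumes "group G" "finite (carrier G)"
  shows "\<not> nonelementary G"
proof -
  interpret group G by fact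
  have g1: "generate G {\<one>\<^bsub>G\<^esub>} = {\<one>\<^bsub>G\<^esub>}" by (rule generate_one)
  have sub: "subgroup {\<one>\<^bsub>G\<^esub>} G" by (rule triv_subgroup)
  have "finite (rcosets\<^bsub>G\<^esub> {\<one>\<^bsub>G\<^esub>})" using assms(2) by (simp add: RCOSETS_def)
  then show ?thesis unfolding nonelementary_def using g1 sub one_closed by metis
qed

lemma word_metrics_comparable:
  assumes "cayley G S" "cayley G A"
  shows "\<exists>l\<ge>1. \<forall>x\<in>carrier G. \<forall>y\<in>carrier G. cayley.wd G S x y \<le> l * cayley.wd G A x y"
proof -
  interpret s: cayley G S by fact
  interpret a: cayley G A by fact
  define l where "l = Max (insert 1 ((\<lambda>g. s.wd \<one>\<^bsub>G\<^esub> g) ` A))"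
  have fin: "finite (insert 1 ((\<lambda>g. s.wd \<one>\<^bsub>G\<^esub> g) ` A))" using a.A_props(1) by simp
  have l1: "1 \<le> l" unfolding l_def using fin by (intro Max_ge) auto
  have lA: "s.wd \<one>\<^bsub>G\<^esub> g \<le> l" if "g \<in> A" for g unfolding l_def using fin that by (intro Max_ge) auto
  have words: "int (s.word_len (a.word_prod ws)) \<le> l * int (length ws)" if "set ws \<subseteq> A" for ws
    using that
  proof (induction ws)
    case Nil
    then show ?case using s.word_len_eq_0[of "\<one>\<^bsub>G\<^esub>"] by simp
  next
    case (Cons g ws)
    have c: "g \<in> carrier G" "a.word_prod ws \<in> carrier G"
      using Cons.prems a.A_props(2) a.word_prod_closed by auto
    have "int (s.word_len g) \<le> l" using lA[of g] Cons.prems c by (simp add: s.wd_def)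
    moreover have "int (s.word_len (a.word_prod ws)) \<le> l * int (length ws)" using Cons by simp
    moreover have "int (s.word_len (g \<otimes>\<^bsub>G\<^esub> a.word_prod ws)) \<le> int (s.word_len g) + int (s.word_len (a.word_prod ws))"
      using s.word_len_mult[OF c] by linarith
    ultimately show ?case by (simp add: algebra_simps)
  qed
  have "s.wd x y \<le> l * a.wd x y" if xy: "x \<in> carrier G" "y \<in> carrier G" for x y
  proof -
    obtain ws where ws: "set ws \<subseteq> A" "length ws = a.word_len (inv\<^bsub>G\<^esub> x \<otimes>\<^bsub>G\<^esub> y)"
      "a.word_prod ws = inv\<^bsub>G\<^esub> x \<otimes>\<^bsub>G\<^esub> y"
      using a.shortest_word[of "inv\<^bsub>G\<^esub> x \<otimes>\<^bsub>G\<^esub> y"] xy by auto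
    show ?thesis using words[OF ws(1)] ws(2,3) by (simp add: s.wd_def a.wd_def)
  qed
  then show ?thesis using l1 by blast
qed

lemma word_hyperbolic_four_point:
  assumes "word_hyperbolic G" "cayley G A"
  shows "\<exists>D\<ge>0. graph_metric.four_point (carrier G) (cayley.wd G A) D"
proof -
  interpret a: cayley G A by fact
  obtain S \<delta> where S: "fin_sym_generating_set G S" "slim_triangles G S \<delta>"
    using assms(1) unfolding word_hyperbolic_def by blast
  interpret s: cayley G S using S(1) by unfold_locales
  obtain \<delta>' where \<delta>': "0 \<le> \<delta>'" "s.slim \<delta>'" using s.slim_from_graph[OF S(2)] by blast
  have D: "s.four_point (6 * \<delta>' + 2)" "0 \<le> 6 * \<delta>' + 2" using s.slim_imp_four_point \<delta>' by auto
  obtain l where l: "1 \<le> l" "\<And>x y. x \<in> carrier G \<Longrightarrow> y \<in> carrier G \<Longrightarrow> s.wd x y \<le> l * a.wd x y"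
    using word_metrics_comparable[OF s.cayley_axioms a.cayley_axioms] by blast
  obtain \<mu> where \<mu>: "1 \<le> \<mu>" "\<And>x y. x \<in> carrier G \<Longrightarrow> y \<in> carrier G \<Longrightarrow> a.wd x y \<le> \<mu> * s.wd x y"
    using word_metrics_comparable[OF a.cayley_axioms s.cayley_axioms] by blast
  show ?thesis
    by (rule four_point_transfer[OF s.graph_metric_axioms a.graph_metric_axioms l \<mu> D])
qed

theorem theorem1p4:
  fixes G :: "('a, 'b) monoid_scheme" and A :: "'a set"
  assumes "group G"
    and "word_hyperbolic G"
    and "nonelementary G"
    and "fin_sym_generating_set G A"
  shows "invariant_measures G A \<noteq> {} \<and>
         finite {\<eta> \<in> invariant_measures G A. ergodic_measure G A \<eta>}"
proof -
  have cay: "cayley G A" using assms(1,4) by (simp add: cayley_def cayley_axioms_def)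
  obtain D where D: "0 \<le> D" "graph_metric.four_point (carrier G) (cayley.wd G A) D"
    using word_hyperbolic_four_point[OF assms(2) cay] by blast
  interpret hyperbolic_cayley G A D
    using cay D by (simp add: hyperbolic_cayley_def hyperbolic_cayley_axioms_def)
  have "infinite (carrier G)" using finite_group_elementary assms(1,3) by blast
  then show ?thesis using invariant_measure_exists finite_ergodic by blast
qed

end
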